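(* Let $\Sigma$ be a signature. The endofunctor $P_fP_f\!\int$ on $Lax_{Inj}(\mathcal{L}_\Sigma^{op},Poset)$ (sending $H$ to $P_fP_f\circ\int\! H$) has a cofree comonad $C(P_fP_f\!\int)$ on $Lax_{Inj}(\mathcal{L}_\Sigma^{op},Poset)$. Moreover, let $P$ be any logic program over $\Sigma$ (existential variables allowed), regarded as a $P_fP_f\!\int$-coalgebra $p:At\to P_fP_f\!\int\! At$, where for $A\in At(n)$, $p_n(A)$ is the set of sets $\{\theta B_1,\ldots,\theta B_k\}$ over all clauses $B\gets B_1,\ldots,B_k$ of $P$ and substitutions $\theta$ with $\theta B=A$, the variables of the body not occurring in the head being taken as fresh variables $x_{n+1},\ldots,x_{n+l}$, so that each $\theta B_i\in At(n+l)$ is regarded as an element of $\int\! At(n)$ via the colimit injection. Then the corresponding $C(P_fP_f\!\int)$-coalgebra $\overline{p}:At\to C(P_fP_f\!\int)(At)$ sends each atom $A(x_1,\ldots,x_n)\in At(n)$ to the coinductive tree for $A(x_1,\ldots,x_n)$.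
   Context: Signatures, terms, atoms, clauses: $\Sigma$ is a set of function symbols with arities; a logic program over $\Sigma$ uses predicate symbols with arities; atoms are $Q(t_1,\ldots,t_k)$; a clause is $B\gets B_1,\ldots,B_k$ ($k\ge0$); a logic program is a finite set of clauses. A matcher for $t$ against $u$ is a substitution $\theta$ with $\theta t=u$; an mgm is a most general one. $\mathcal{L}_\Sigma$: objects natural numbers; with fixed variables $x_1,\ldots,x_n$, $\mathcal{L}_\Sigma(n,m)$ is the set of $m$-tuples of terms in $x_1,\ldots,x_n$; composition is substitution. $At:\mathcal{L}_\Sigma^{op}\to Poset$ sends $n$ to the discrete poset of atoms of $P$ with variables among $x_1,\ldots,x_n$, and $f=(f_1,\ldots,f_m):n\to m$ to substitution $A(x_1,\ldots,x_m)\mapsto A(f_1/x_1,\ldots,f_m/x_m)$. $Inj$ is the category of natural numbers and injections, with canonical identity-on-objects $J:Inj^{op}\to\mathcal{L}_\Sigma$ (injection $i:n\to m$ goes to the tuple $(x_{i(1)},\ldots,x_{i(n)}):m\to n$). For $H:\mathcal{L}_\Sigma^{op}\to Poset$, $\int\! H(n)$ is the colimit of $n/Inj\xrightarrow{cod}Inj\xrightarrow{J^{op}}\mathcal{L}_\Sigma^{op}\xrightarrow{H}Poset$, with injections $\rho_j:H(m)\to\int\!H(n)$; on $f:n\to n'$ in $\mathcal{L}_\Sigma$, $\int\!H(f)$ is induced by the maps $\rho_{j}\circ H(f+k):H(n'+k)\to\int\!H(n)$ ($j:n\to n+k$ canonical, $f+k=(f_1,\ldots,f_{n'},x_{n+1},\ldots,x_{n+k})$);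 on maps $\alpha$, $(\int\!\alpha)_n$ is induced by $\rho_j\circ\alpha_{n+k}$. $P_f$ on $Poset$: finite subsets, $S\le T$ iff every $a\in S$ is below some $b\in T$, action by image. A lax transformation $\alpha:H\to K$ of functors $\mathcal{L}_\Sigma^{op}\to Poset$ is a family of order-preserving $\alpha_n:Hn\to Kn$ with $(Kf)\circ\alpha_m\le\alpha_n\circ(Hf)$ for all $f:n\to m$ in $\mathcal{L}_\Sigma$. $Lax_{Inj}(\mathcal{L}_\Sigma^{op},Poset)$ has functors $\mathcal{L}_\Sigma^{op}\to Poset$ as objects and as maps the lax transformations with $K(Ji)\circ\alpha_n=\alpha_m\circ H(Ji)$ for all injections $i$. Given a coalgebra $p:H\to EH$ for an endofunctor $E$ with cofree comonad $C(E)$, the corresponding $C(E)$-coalgebra is the unique coalgebra $\overline{p}:H\to C(E)H$ of the comonad whose composite with the canonical map $C(E)H\to EH$ is $p$; pointwise, $C(P_fP_f\!\int)(At)(n)$ is the limit of the chain $At(n)\leftarrow At(n)\times(P_fP_f\!\int\!At)(n)\leftarrow At(n)\times (P_fP_f\!\int(At\times P_fP_f\!\int\!At))(n)\leftarrow\cdots$ and its elements are identified with and/or trees in the evident way. Coinductive tree for $A$: the possibly infinite tree with root $A$, nodes being and-nodes (atoms) or or-nodes ($\bullet$), such that each and-node $A'$ has, for each clause $B_i\gets B^i_1,\ldots,B^i_{n_i}$ of $P$ with $A'=\theta B_i$ for the mgm $\theta$, an or-node child whose children are the and-nodes given by the distinct atoms among $\theta B^i_1,\ldots,\theta B^i_{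n_i}$.
   Formalization: Poset is replaced by preordered sets, because the stated order on P_f is not antisymmetric ({b} and {a,b} for a<b); C(P_fP_f∫)(At)(n) is shown to embed in the limit of the chain rather than equal it, and trees are identified with elements by their truncations. *)

theory Defs
  imports Main "HOL-Library.FSet" "HOL-Library.FuncSet"
begin

section \<open>Categories, comonads and cofree comonads\<close>

record ('o, 'a) category =
  Ob :: "'o set"
  Ar :: "'a set"
  Dom :: "'a \<Rightarrow> 'o"
  Cod :: "'a \<Rightarrow> 'o"
  Ide :: "'o \<Rightarrow> 'a"
  Cmp :: "'a \<Rightarrow> 'a \<Rightarrow> 'a"

definition hom :: "('o, 'a) category \<Rightarrow> 'o \<Rightarrow> 'o \<Rightarrow> 'a set" where
  "hom C x y = {f \<in> Ar C. Dom C f = x \<and> Cod C f = y}"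

definition is_category :: "('o, 'a) category \<Rightarrow> bool" where
  "is_category C \<longleftrightarrow>
     (\<forall>f\<in>Ar C. Dom C f \<in> Ob C \<and> Cod C f \<in> Ob C) \<and>
     (\<forall>x\<in>Ob C. Ide C x \<in> hom C x x) \<and>
     (\<forall>x y z f g. f \<in> hom C x y \<longrightarrow> g \<in> hom C y z \<longrightarrow> Cmp C g f \<in> hom C x z) \<and>
     (\<forall>x y f. f \<in> hom C x y \<longrightarrow> Cmp C f (Ide C x) = f \<and> Cmp C (Ide C y) f = f) \<and>
     (\<forall>w x y z f g h. f \<in> hom C w x \<longrightarrow> g \<in> hom C x y \<longrightarrow> h \<in> hom C y z \<longrightarrow>
        Cmp C h (Cmp C g f) = Cmp C (Cmp C h g) f)"

record ('o, 'a) endofunctor =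
  Fo :: "'o \<Rightarrow> 'o"
  Fa :: "'a \<Rightarrow> 'a"

definition is_endofunctor ::
    "('o, 'a) category \<Rightarrow> ('o, 'a, 'm) endofunctor_scheme \<Rightarrow> bool" where
  "is_endofunctor C E \<longleftrightarrow>
     (\<forall>x\<in>Ob C. Fo E x \<in> Ob C) \<and>
     (\<forall>x y f. f \<in> hom C x y \<longrightarrow> Fa E f \<in> hom C (Fo E x) (Fo E y)) \<and>
     (\<forall>x\<in>Ob C. Fa E (Ide C x) = Ide C (Fo E x)) \<and>
     (\<forall>x y z f g. f \<in> hom C x y \<longrightarrow> g \<in> hom C y z \<longrightarrow>
        Fa E (Cmp C g f) = Cmp C (Fa E g) (Fa E f))"

definition is_nat_trans ::
    "('o, 'a) category \<Rightarrow> ('o, 'a, 'm) endofunctor_scheme \<Rightarrow> ('o, 'a, 'n) endofunctor_scheme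
       \<Rightarrow> ('o \<Rightarrow> 'a) \<Rightarrow> bool" where
  "is_nat_trans C E G t \<longleftrightarrow>
     (\<forall>x\<in>Ob C. t x \<in> hom C (Fo E x) (Fo G x)) \<and>
     (\<forall>x y f. f \<in> hom C x y \<longrightarrow> Cmp C (Fa G f) (t x) = Cmp C (t y) (Fa E f))"

record ('o, 'a) comonad = "('o, 'a) endofunctor" +
  counit :: "'o \<Rightarrow> 'a"
  comult :: "'o \<Rightarrow> 'a"

definition is_comonad :: "('o, 'a) category \<Rightarrow> ('o, 'a) comonad \<Rightarrow> bool" where
  "is_comonad C D \<longleftrightarrow>
     is_endofunctor C D \<and>
     is_nat_trans C D \<lparr>Fo = id, Fa = id\<rparr> (counit D) \<and>
     is_nat_trans C D \<lparr>Fo = Fo D \<circ> Fo D, Fa = Fa D \<circ> Fa D\<rparr> (comult D) \<and>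
     (\<forall>x\<in>Ob C.
        Cmp C (counit D (Fo D x)) (comult D x) = Ide C (Fo D x) \<and>
        Cmp C (Fa D (counit D x)) (comult D x) = Ide C (Fo D x) \<and>
        Cmp C (comult D (Fo D x)) (comult D x) = Cmp C (Fa D (comult D x)) (comult D x))"

definition is_comonad_map ::
    "('o, 'a) category \<Rightarrow> ('o, 'a) comonad \<Rightarrow> ('o, 'a) comonad \<Rightarrow> ('o \<Rightarrow> 'a) \<Rightarrow> bool" where
  "is_comonad_map C D D' t \<longleftrightarrow>
     is_nat_trans C D D' t \<and>
     (\<forall>x\<in>Ob C.
        Cmp C (counit D' x) (t x) = counit D x \<and>
        Cmp C (comult D' x) (t x) =
          Cmp C (Fa D' (t x)) (Cmp C (t (Fo D x)) (comult D x)))"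

definition is_comonad_coalg ::
    "('o, 'a) category \<Rightarrow> ('o, 'a) comonad \<Rightarrow> 'o \<Rightarrow> 'a \<Rightarrow> bool" where
  "is_comonad_coalg C D x a \<longleftrightarrow>
     a \<in> hom C x (Fo D x) \<and>
     Cmp C (counit D x) a = Ide C x \<and>
     Cmp C (comult D x) a = Cmp C (Fa D a) a"

text \<open>
  A comonad \<open>D\<close> with a natural transformation \<open>\<kappa>\<close> from \<open>D\<close> to \<open>E\<close> is cofree on \<open>E\<close> if it is
  universal among such pairs, and if every \<open>E\<close>-coalgebra \<open>p\<close> has a unique corresponding
  \<open>D\<close>-coalgebra, i.e. one whose composite with \<open>\<kappa>\<close> is \<open>p\<close>.  (For an arbitrary category the
  second property does not follow from the first.)
\<close>

definition is_cofree_comonad ::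
    "('o, 'a) category \<Rightarrow> ('o, 'a) endofunctor \<Rightarrow> ('o, 'a) comonad \<Rightarrow> ('o \<Rightarrow> 'a) \<Rightarrow> bool" where
  "is_cofree_comonad C E D \<kappa> \<longleftrightarrow>
     is_comonad C D \<and> is_nat_trans C D E \<kappa> \<and>
     (\<forall>D' \<tau>. is_comonad C D' \<and> is_nat_trans C D' E \<tau> \<longrightarrow>
        (\<exists>!t. t \<in> extensional (Ob C) \<and> is_comonad_map C D' D t \<and>
              (\<forall>x\<in>Ob C. Cmp C (\<kappa> x) (t x) = \<tau> x))) \<and>
     (\<forall>x\<in>Ob C. \<forall>p\<in>hom C x (Fo E x). \<exists>!a. is_comonad_coalg C D x a \<and> Cmp C (\<kappa> x) a = p)"

definition corresponding_coalg ::
    "('o, 'a) category \<Rightarrow> ('o, 'a) comonad \<Rightarrow> ('o \<Rightarrow> 'a) \<Rightarrow> 'o \<Rightarrow> 'a \<Rightarrow> 'a" where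
  "corresponding_coalg C D \<kappa> x p = (THE a. is_comonad_coalg C D x a \<and> Cmp C (\<kappa> x) a = p)"


section \<open>Terms, atoms, clauses and programs\<close>

text \<open>
  A signature is a set of symbols paired with their arities, so that it may be empty.
  Variables are indexed from 0: the variables of the context \<open>n\<close> are \<open>Var 0, \<dots>, Var (n - 1)\<close>.
\<close>

datatype 'f trm = Var nat | Fn 'f "'f trm list"
datatype ('f, 'p) atom = Atom 'p "'f trm list"
datatype ('f, 'p) clause = Clause (head: "('f, 'p) atom") (body: "('f, 'p) atom list")

inductive_set terms :: "('f \<times> nat) set \<Rightarrow> 'f trm set" for \<Sigma> where
  "Var i \<in> terms \<Sigma>"
| "(f, length ts) \<in> \<Sigma> \<Longrightarrow> (\<And>t. t \<in> set ts \<Longrightarrow> t \<in> terms \<Sigma>) \<Longrightarrow> Fn f ts \<in> terms \<Sigma>"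

primrec tvars :: "'f trm \<Rightarrow> nat set" where
  "tvars (Var i) = {i}"
| "tvars (Fn f ts) = \<Union> (set (map tvars ts))"

primrec tsubst :: "(nat \<Rightarrow> 'f trm) \<Rightarrow> 'f trm \<Rightarrow> 'f trm" where
  "tsubst \<theta> (Var i) = \<theta> i"
| "tsubst \<theta> (Fn f ts) = Fn f (map (tsubst \<theta>) ts)"

primrec avars :: "('f, 'p) atom \<Rightarrow> nat set" where
  "avars (Atom q ts) = \<Union> (tvars ` set ts)"

primrec asubst :: "(nat \<Rightarrow> 'f trm) \<Rightarrow> ('f, 'p) atom \<Rightarrow> ('f, 'p) atom" where
  "asubst \<theta> (Atom q ts) = Atom q (map (tsubst \<theta>) ts)"

definition atoms :: "('f \<times> nat) set \<Rightarrow> ('p \<times> nat) set \<Rightarrow> ('f, 'p) atom set" where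
  "atoms \<Sigma> R = {Atom q ts | q ts. (q, length ts) \<in> R \<and> set ts \<subseteq> terms \<Sigma>}"

definition atoms_in ::
    "('f \<times> nat) set \<Rightarrow> ('p \<times> nat) set \<Rightarrow> nat \<Rightarrow> ('f, 'p) atom set" where
  "atoms_in \<Sigma> R n = {A \<in> atoms \<Sigma> R. avars A \<subseteq> {..<n}}"

definition is_program ::
    "('f \<times> nat) set \<Rightarrow> ('p \<times> nat) set \<Rightarrow> ('f, 'p) clause set \<Rightarrow> bool" where
  "is_program \<Sigma> R P \<longleftrightarrow>
     finite P \<and> (\<forall>c\<in>P. head c \<in> atoms \<Sigma> R \<and> set (body c) \<subseteq> atoms \<Sigma> R)"

definition substs :: "('f \<times> nat) set \<Rightarrow> (nat \<Rightarrow> 'f trm) set" where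
  "substs \<Sigma> = {\<theta>. \<forall>v. \<theta> v \<in> terms \<Sigma>}"

definition matchers ::
    "('f \<times> nat) set \<Rightarrow> ('f, 'p) atom \<Rightarrow> ('f, 'p) atom \<Rightarrow> (nat \<Rightarrow> 'f trm) set" where
  "matchers \<Sigma> B A = {\<theta> \<in> substs \<Sigma>. asubst \<theta> B = A}"

definition is_mgm ::
    "('f \<times> nat) set \<Rightarrow> ('f, 'p) atom \<Rightarrow> ('f, 'p) atom \<Rightarrow> (nat \<Rightarrow> 'f trm) \<Rightarrow> bool" where
  "is_mgm \<Sigma> B A \<theta> \<longleftrightarrow>
     \<theta> \<in> matchers \<Sigma> B A \<and>
     (\<forall>\<sigma>\<in>matchers \<Sigma> B A. \<exists>\<tau>\<in>substs \<Sigma>. \<forall>v. \<sigma> v = tsubst \<tau> (\<theta> v))"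

definition existential_vars :: "('f, 'p) clause \<Rightarrow> nat set" where
  "existential_vars c = \<Union> (avars ` set (body c)) - avars (head c)"


section \<open>Ordered sets and the category of lax transformations\<close>

text \<open>
  The order given on finite subsets (\<open>S \<le> T\<close> iff every element of \<open>S\<close> is below one of \<open>T\<close>)
  is reflexive and transitive, but not antisymmetric unless the underlying order is discrete.
  The ordered sets here are therefore preordered sets.

  Elements of ordered sets are taken from a universe, because functors with values in ordered
  sets of one type must be closed under finite powersets, quotients and countable limits.
  The constructors supply (freely generated, hence injective) codes for: atoms; arbitrary
  urelements; representatives of elements of the colimits over \<open>n/Inj\<close>; pairs; finite sets;
  sequences (elements of countable limits).  As \<open>'u\<close> is arbitrary, there is no bound on the
  cardinality of the ordered sets considered.
\<close>

datatype ('f, 'p, 'u) univ =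
    UAtom "('f, 'p) atom"
  | UBase 'u
  | URep nat "nat list" "('f, 'p, 'u) univ"
  | UPair "('f, 'p, 'u) univ" "('f, 'p, 'u) univ"
  | USet "('f, 'p, 'u) univ fset"
  | USeq "nat \<Rightarrow> ('f, 'p, 'u) univ"

record 'a oset =
  Car :: "'a set"
  Le :: "'a rel"

definition monotone_maps :: "'a oset \<Rightarrow> 'a oset \<Rightarrow> ('a \<Rightarrow> 'a) set" where
  "monotone_maps X Y =
     {g \<in> Car X \<rightarrow> Car Y. \<forall>(x, y)\<in>Le X. (g x, g y) \<in> Le Y}"

text \<open>
  \<open>L \<Sigma> n m\<close> is the hom-set from \<open>n\<close> to \<open>m\<close>, and \<open>inj_maps n m\<close> consists of the injections from
  \<open>{..<n}\<close> to \<open>{..<m}\<close>, as lists of values.  Since \<open>lcomp g f\<close> is the composite of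
  \<open>f \<in> L \<Sigma> n m\<close> and \<open>g \<in> L \<Sigma> m k\<close>, a functor on the opposite category sends \<open>f \<in> L \<Sigma> n m\<close> to
  a map from the value at \<open>m\<close> to the value at \<open>n\<close>; the first argument of \<open>fmap\<close> is \<open>n\<close>
  (\<open>m\<close> is the length of \<open>f\<close>).
\<close>

definition L :: "('f \<times> nat) set \<Rightarrow> nat \<Rightarrow> nat \<Rightarrow> 'f trm list set" where
  "L \<Sigma> n m = {f. length f = m \<and> (\<forall>t\<in>set f. t \<in> terms \<Sigma> \<and> tvars t \<subseteq> {..<n})}"

definition tuple_subst :: "'f trm list \<Rightarrow> nat \<Rightarrow> 'f trm" where
  "tuple_subst f i = (if i < length f then f ! i else Var i)"

definition lcomp :: "'f trm list \<Rightarrow> 'f trm list \<Rightarrow> 'f trm list" where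
  "lcomp g f = map (tsubst (tuple_subst f)) g"

definition inj_maps :: "nat \<Rightarrow> nat \<Rightarrow> nat list set" where
  "inj_maps n m = {i. length i = n \<and> distinct i \<and> set i \<subseteq> {..<m}}"

definition J :: "nat list \<Rightarrow> 'f trm list" where
  "J i = map Var i"

record ('f, 'a) func =
  fob :: "nat \<Rightarrow> 'a oset"
  fmap :: "nat \<Rightarrow> 'f trm list \<Rightarrow> 'a \<Rightarrow> 'a"

definition is_func :: "('f \<times> nat) set \<Rightarrow> ('f, 'a) func \<Rightarrow> bool" where
  "is_func \<Sigma> H \<longleftrightarrow>
     (\<forall>n. preorder_on (Car (fob H n)) (Le (fob H n))) \<and>
     (\<forall>n m. \<forall>f\<in>L \<Sigma> n m. fmap H n f \<in> monotone_maps (fob H m) (fob H n)) \<and>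
     (\<forall>n. \<forall>x\<in>Car (fob H n). fmap H n (map Var [0..<n]) x = x) \<and>
     (\<forall>n m k. \<forall>f\<in>L \<Sigma> n m. \<forall>g\<in>L \<Sigma> m k. \<forall>x\<in>Car (fob H k).
        fmap H n (lcomp g f) x = fmap H n f (fmap H m g x))"

record ('f, 'a) lax =
  src :: "('f, 'a) func"
  trg :: "('f, 'a) func"
  cmpt :: "nat \<Rightarrow> 'a \<Rightarrow> 'a"

text \<open>Components are extensional, so that equality of arrows is equality of components.\<close>

definition is_lax :: "('f \<times> nat) set \<Rightarrow> ('f, 'a) lax \<Rightarrow> bool" where
  "is_lax \<Sigma> \<alpha> \<longleftrightarrow>
     is_func \<Sigma> (src \<alpha>) \<and> is_func \<Sigma> (trg \<alpha>) \<and>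
     (\<forall>n. cmpt \<alpha> n \<in> monotone_maps (fob (src \<alpha>) n) (fob (trg \<alpha>) n)
            \<inter> extensional (Car (fob (src \<alpha>) n))) \<and>
     (\<forall>n m. \<forall>f\<in>L \<Sigma> n m. \<forall>x\<in>Car (fob (src \<alpha>) m).
        (fmap (trg \<alpha>) n f (cmpt \<alpha> m x), cmpt \<alpha> n (fmap (src \<alpha>) n f x)) \<in> Le (fob (trg \<alpha>) n)) \<and>
     (\<forall>n m. \<forall>i\<in>inj_maps n m. \<forall>x\<in>Car (fob (src \<alpha>) n).
        fmap (trg \<alpha>) m (J i) (cmpt \<alpha> n x) = cmpt \<alpha> m (fmap (src \<alpha>) m (J i) x))"

definition Lax_Inj :: "('f \<times> nat) set \<Rightarrow> (('f, 'a) func, ('f, 'a) lax) category" where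
  "Lax_Inj \<Sigma> = \<lparr>
     Ob = {H. is_func \<Sigma> H},
     Ar = {\<alpha>. is_lax \<Sigma> \<alpha>},
     Dom = src,
     Cod = trg,
     Ide = (\<lambda>H. \<lparr>src = H, trg = H, cmpt = (\<lambda>n. restrict id (Car (fob H n)))\<rparr>),
     Cmp = (\<lambda>\<beta> \<alpha>. \<lparr>src = src \<alpha>, trg = trg \<beta>,
                  cmpt = (\<lambda>n. restrict (cmpt \<beta> n \<circ> cmpt \<alpha> n) (Car (fob (src \<alpha>) n)))\<rparr>)\<rparr>"


section \<open>The endofunctor\<close>

text \<open>
  The elements of the coproduct of the \<open>H(m)\<close>, indexed by the objects \<open>j : n \<rightarrow> m\<close> of \<open>n/Inj\<close>, are
  coded by \<open>URep m j x\<close> with \<open>x \<in> H(m)\<close>.  The colimit is the quotient of the coproduct by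
  \<open>colim_eq\<close>, ordered by \<open>colim_le\<close>, the least preorder containing the identifications and the
  orders of the \<open>H(m)\<close>.  The colimit injection \<open>\<rho>\<close> sends an element to a chosen representative
  of its class.
\<close>

inductive colim_eq ::
    "('f, ('f, 'p, 'u) univ) func \<Rightarrow> nat \<Rightarrow> ('f, 'p, 'u) univ \<Rightarrow> ('f, 'p, 'u) univ \<Rightarrow> bool"
  for H n where
  push: "\<lbrakk>j \<in> inj_maps n m; k \<in> inj_maps m m'; x \<in> Car (fob H m)\<rbrakk> \<Longrightarrow>
    colim_eq H n (URep m j x) (URep m' (map (\<lambda>i. k ! i) j) (fmap H m' (J k) x))"
| refl: "\<lbrakk>j \<in> inj_maps n m; x \<in> Car (fob H m)\<rbrakk> \<Longrightarrow> colim_eq H n (URep m j x) (URep m j x)"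
| sym: "colim_eq H n a b \<Longrightarrow> colim_eq H n b a"
| trans: "\<lbrakk>colim_eq H n a b; colim_eq H n b c\<rbrakk> \<Longrightarrow> colim_eq H n a c"

inductive colim_le ::
    "('f, ('f, 'p, 'u) univ) func \<Rightarrow> nat \<Rightarrow> ('f, 'p, 'u) univ \<Rightarrow> ('f, 'p, 'u) univ \<Rightarrow> bool"
  for H n where
  eq: "colim_eq H n a b \<Longrightarrow> colim_le H n a b"
| le: "\<lbrakk>j \<in> inj_maps n m; (x, y) \<in> Le (fob H m)\<rbrakk> \<Longrightarrow> colim_le H n (URep m j x) (URep m j y)"
| trans: "\<lbrakk>colim_le H n a b; colim_le H n b c\<rbrakk> \<Longrightarrow> colim_le H n a c"

definition \<rho> ::
    "('f, ('f, 'p, 'u) univ) func \<Rightarrow> nat \<Rightarrow> nat \<Rightarrow> nat list \<Rightarrow> ('f, 'p, 'u) univ \<Rightarrow> ('f, 'p, 'u) univ"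
  where "\<rho> H n m j x = (SOME a. colim_eq H n (URep m j x) a)"

definition int_ob :: "('f, ('f, 'p, 'u) univ) func \<Rightarrow> nat \<Rightarrow> ('f, 'p, 'u) univ oset" where
  "int_ob H n =
     (let X = {\<rho> H n m j x | m j x. j \<in> inj_maps n m \<and> x \<in> Car (fob H m)}
      in \<lparr>Car = X, Le = {(a, b). a \<in> X \<and> b \<in> X \<and> colim_le H n a b}\<rparr>)"

text \<open>The canonical injection from \<open>n\<close> to \<open>n + k\<close> is \<open>[0..<n]\<close>.\<close>

definition int_map ::
    "('f, ('f, 'p, 'u) univ) func \<Rightarrow> nat \<Rightarrow> 'f trm list \<Rightarrow> ('f, 'p, 'u) univ \<Rightarrow> ('f, 'p, 'u) univ" where
  "int_map H n f a = (THE b. \<exists>k x. x \<in> Car (fob H (length f + k)) \<and>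
      a = \<rho> H (length f) (length f + k) [0..<length f] x \<and>
      b = \<rho> H n (n + k) [0..<n] (fmap H (n + k) (f @ map Var [n..<n + k]) x))"

definition Integral :: "('f, ('f, 'p, 'u) univ) func \<Rightarrow> ('f, ('f, 'p, 'u) univ) func" where
  "Integral H = \<lparr>fob = int_ob H, fmap = int_map H\<rparr>"

definition int_comp ::
    "('f, ('f, 'p, 'u) univ) lax \<Rightarrow> nat \<Rightarrow> ('f, 'p, 'u) univ \<Rightarrow> ('f, 'p, 'u) univ" where
  "int_comp \<alpha> n a = (THE b. \<exists>k x. x \<in> Car (fob (src \<alpha>) (n + k)) \<and>
      a = \<rho> (src \<alpha>) n (n + k) [0..<n] x \<and>
      b = \<rho> (trg \<alpha>) n (n + k) [0..<n] (cmpt \<alpha> (n + k) x))"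

text \<open>\<open>uset S\<close> codes \<open>S\<close> only if \<open>S\<close> is finite; below this is ensured by finiteness of the program.\<close>

definition uset :: "('f, 'p, 'u) univ set \<Rightarrow> ('f, 'p, 'u) univ" where
  "uset S = USet (Abs_fset S)"

fun uimage ::
    "(('f, 'p, 'u) univ \<Rightarrow> ('f, 'p, 'u) univ) \<Rightarrow> ('f, 'p, 'u) univ \<Rightarrow> ('f, 'p, 'u) univ" where
  "uimage g (USet S) = USet (g |`| S)"
| "uimage g a = a"

definition Pf :: "('f, 'p, 'u) univ oset \<Rightarrow> ('f, 'p, 'u) univ oset" where
  "Pf X = \<lparr>Car = {USet S | S. fset S \<subseteq> Car X},
           Le = {(USet S, USet T) | S T. fset S \<subseteq> Car X \<and> fset T \<subseteq> Car X \<and>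
                   (\<forall>a\<in>fset S. \<exists>b\<in>fset T. (a, b) \<in> Le X)}\<rparr>"

definition PfPfInt_ob :: "('f, ('f, 'p, 'u) univ) func \<Rightarrow> ('f, ('f, 'p, 'u) univ) func" where
  "PfPfInt_ob H = \<lparr>fob = (\<lambda>n. Pf (Pf (fob (Integral H) n))),
                   fmap = (\<lambda>n f. uimage (uimage (fmap (Integral H) n f)))\<rparr>"

definition PfPfInt ::
    "(('f, ('f, 'p, 'u) univ) func, ('f, ('f, 'p, 'u) univ) lax) endofunctor" where
  "PfPfInt = \<lparr>
     Fo = PfPfInt_ob,
     Fa = (\<lambda>\<alpha>. \<lparr>src = PfPfInt_ob (src \<alpha>), trg = PfPfInt_ob (trg \<alpha>),
                 cmpt = (\<lambda>n. restrict (uimage (uimage (int_comp \<alpha> n)))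
                                (Car (fob (PfPfInt_ob (src \<alpha>)) n)))\<rparr>)\<rparr>"


section \<open>The coalgebra of a logic program\<close>

definition At ::
    "('f \<times> nat) set \<Rightarrow> ('p \<times> nat) set \<Rightarrow> ('f, ('f, 'p, 'u) univ) func" where
  "At \<Sigma> R = \<lparr>
     fob = (\<lambda>n. \<lparr>Car = UAtom ` atoms_in \<Sigma> R n, Le = Id_on (UAtom ` atoms_in \<Sigma> R n)\<rparr>),
     fmap = (\<lambda>n f a. case a of UAtom A \<Rightarrow> UAtom (asubst (tuple_subst f) A) | _ \<Rightarrow> a)\<rparr>"

definition program_comp ::
    "('f \<times> nat) set \<Rightarrow> ('p \<times> nat) set \<Rightarrow> ('f, 'p) clause set \<Rightarrow> nat \<Rightarrow> ('f, 'p) atom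
       \<Rightarrow> ('f, 'p, 'u) univ" where
  "program_comp \<Sigma> R P n A = uset
     {uset {\<rho> (At \<Sigma> R) n (n + l) [0..<n] (UAtom (asubst \<theta> B)) | B. B \<in> set (body c)} | c \<theta> l.
        c \<in> P \<and> \<theta> \<in> matchers \<Sigma> (head c) A \<and>
        bij_betw \<theta> (existential_vars c) (Var ` {n..<n + l})}"

definition program_coalg ::
    "('f \<times> nat) set \<Rightarrow> ('p \<times> nat) set \<Rightarrow> ('f, 'p) clause set \<Rightarrow> ('f, ('f, 'p, 'u) univ) lax" where
  "program_coalg \<Sigma> R P = \<lparr>
     src = At \<Sigma> R, trg = Fo PfPfInt (At \<Sigma> R),
     cmpt = (\<lambda>n. \<lambda>a\<in>Car (fob (At \<Sigma> R) n).
               case a of UAtom A \<Rightarrow> program_comp \<Sigma> R P n A | _ \<Rightarrow> a)\<rparr>"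


section \<open>Coinductive trees\<close>

text \<open>
  An and-node is an atom in a context.  Its or-node children are indexed by clauses, so that
  distinct clauses give distinct or-nodes; an or-node is given by the set of its child trees.
\<close>

codatatype ('f, 'p) tree =
  AndNode (ctx: nat) (label: "('f, 'p) atom")
          (ors: "('f, 'p) clause \<Rightarrow> ('f, 'p) tree fset option")

text \<open>
  The most general matcher is unique only up to renaming of the variables that do not occur in
  the head.  Any choice is allowed for which the existential variables are sent to variables
  outside the context \<open>n\<close>; the atoms of the resulting body then live in a larger context \<open>m\<close>.
  The bijection expresses that the children are the distinct atoms of the instantiated body.
\<close>

coinductive is_coind_tree ::
    "('f \<times> nat) set \<Rightarrow> ('p \<times> nat) set \<Rightarrow> ('f, 'p) clause set \<Rightarrow> ('f, 'p) tree \<Rightarrow> bool"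
  for \<Sigma> R P where
  "\<lbrakk>A \<in> atoms_in \<Sigma> R n;
    \<forall>c. c \<in> P \<and> matchers \<Sigma> (head c) A \<noteq> {} \<longrightarrow>
      (\<exists>\<theta> m S. is_mgm \<Sigma> (head c) A \<theta> \<and>
         \<theta> ` existential_vars c \<subseteq> Var ` {n..} \<and> n \<le> m \<and>
         asubst \<theta> ` set (body c) \<subseteq> atoms_in \<Sigma> R m \<and>
         ks c = Some S \<and>
         bij_betw label (fset S) (asubst \<theta> ` set (body c)) \<and>
         (\<forall>T\<in>fset S. ctx T = m \<and> is_coind_tree \<Sigma> R P T));
    \<forall>c. \<not> (c \<in> P \<and> matchers \<Sigma> (head c) A \<noteq> {}) \<longrightarrow> ks c = None\<rbrakk>
   \<Longrightarrow> is_coind_tree \<Sigma> R P (AndNode n A ks)"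


section \<open>Elements of the cofree comonad as and/or trees\<close>

definition prod_func ::
    "('f, ('f, 'p, 'u) univ) func \<Rightarrow> ('f, ('f, 'p, 'u) univ) func \<Rightarrow> ('f, ('f, 'p, 'u) univ) func" where
  "prod_func H K = \<lparr>
     fob = (\<lambda>n. \<lparr>Car = {UPair x y | x y. x \<in> Car (fob H n) \<and> y \<in> Car (fob K n)},
                 Le = {(UPair x y, UPair x' y') | x y x' y'.
                         (x, x') \<in> Le (fob H n) \<and> (y, y') \<in> Le (fob K n)}\<rparr>),
     fmap = (\<lambda>n f a. case a of UPair x y \<Rightarrow> UPair (fmap H n f x) (fmap K n f y) | _ \<Rightarrow> a)\<rparr>"

definition pairing ::
    "('f, ('f, 'p, 'u) univ) lax \<Rightarrow> ('f, ('f, 'p, 'u) univ) lax \<Rightarrow> ('f, ('f, 'p, 'u) univ) lax" where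
  "pairing \<alpha> \<beta> = \<lparr>src = src \<alpha>, trg = prod_func (trg \<alpha>) (trg \<beta>),
     cmpt = (\<lambda>n. \<lambda>a\<in>Car (fob (src \<alpha>) n). UPair (cmpt \<alpha> n a) (cmpt \<beta> n a))\<rparr>"

text \<open>The objects \<open>H\<close>, \<open>H \<times> E H\<close>, \<open>H \<times> E (H \<times> E H)\<close>, \<dots> of the chain, for \<open>E\<close> the endofunctor.\<close>

primrec stage ::
    "('f, ('f, 'p, 'u) univ) func \<Rightarrow> nat \<Rightarrow> ('f, ('f, 'p, 'u) univ) func" where
  "stage H 0 = H"
| "stage H (Suc i) = prod_func H (Fo PfPfInt (stage H i))"

text \<open>
  The canonical cone from \<open>D H\<close> to the chain, for a comonad \<open>D\<close> with \<open>\<kappa>\<close> from \<open>D\<close> to \<open>E\<close>: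
  the counit, and inductively the counit paired with \<open>D H \<rightarrow> D D H \<rightarrow> E D H \<rightarrow> E (stage H i)\<close>.
\<close>

primrec cone ::
    "('f \<times> nat) set \<Rightarrow> (('f, ('f, 'p, 'u) univ) func, ('f, ('f, 'p, 'u) univ) lax) comonad
       \<Rightarrow> (('f, ('f, 'p, 'u) univ) func \<Rightarrow> ('f, ('f, 'p, 'u) univ) lax)
       \<Rightarrow> ('f, ('f, 'p, 'u) univ) func \<Rightarrow> nat \<Rightarrow> ('f, ('f, 'p, 'u) univ) lax" where
  "cone \<Sigma> D \<kappa> H 0 = counit D H"
| "cone \<Sigma> D \<kappa> H (Suc i) =
     pairing (counit D H)
       (Cmp (Lax_Inj \<Sigma>) (Fa PfPfInt (cone \<Sigma> D \<kappa> H i))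
          (Cmp (Lax_Inj \<Sigma>) (\<kappa> (Fo D H)) (comult D H)))"

text \<open>The truncation of an and/or tree of atoms, as an element of a stage of the chain.\<close>

primrec truncation ::
    "('f \<times> nat) set \<Rightarrow> ('p \<times> nat) set \<Rightarrow> nat \<Rightarrow> ('f, 'p) tree \<Rightarrow> ('f, 'p, 'u) univ" where
  "truncation \<Sigma> R 0 = (\<lambda>T. UAtom (label T))"
| "truncation \<Sigma> R (Suc i) = (\<lambda>T. UPair (UAtom (label T))
     (uset {uset {\<rho> (stage (At \<Sigma> R) i) (ctx T) (ctx T') [0..<ctx T] (truncation \<Sigma> R i T') | T'.
                    T' \<in> fset S} | c S. ors T c = Some S}))"

text \<open>
  An element of \<open>D At n\<close> is identified with the and/or tree that has the same image in every
  stage of the chain.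
\<close>

definition represents ::
    "('f \<times> nat) set \<Rightarrow> ('p \<times> nat) set
       \<Rightarrow> (('f, ('f, 'p, 'u) univ) func, ('f, ('f, 'p, 'u) univ) lax) comonad
       \<Rightarrow> (('f, ('f, 'p, 'u) univ) func \<Rightarrow> ('f, ('f, 'p, 'u) univ) lax)
       \<Rightarrow> nat \<Rightarrow> ('f, 'p, 'u) univ \<Rightarrow> ('f, 'p) tree \<Rightarrow> bool" where
  "represents \<Sigma> R D \<kappa> n a T \<longleftrightarrow>
     a \<in> Car (fob (Fo D (At \<Sigma> R)) n) \<and> ctx T = n \<and>
     (\<forall>i. cmpt (cone \<Sigma> D \<kappa> (At \<Sigma> R) i) n a = truncation \<Sigma> R i T)"

end

theory Submission
  imports Defs
begin

text \<open>
  Let \<open>E\<close> be the endofunctor.  A cofree \<open>E\<close>-coalgebra on \<open>H\<close> consists of the sequences in the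
  limit of the chain \<open>H \<leftarrow> H \<times> E H \<leftarrow> H \<times> E (H \<times> E H) \<leftarrow> \<dots>\<close> that can be unfolded hereditarily, with
  the pointwise order and action.  Its structure map is well defined and monotone because \<open>E\<close>,
  although it does not preserve limits, reflects equality and order along the limit: only finitely
  many witnesses are possible at each stage, so one of them works at all stages.  For finite
  powersets this is immediate; for the colimit over \<open>n/Inj\<close> two elements are related iff they have
  related images in a common \<open>H(m)\<close>, where \<open>m\<close> can be bounded.  Cofree coalgebras yield a cofree
  comonad.  For any cofree comonad \<open>D\<close>, the image of the \<open>D\<close>-coalgebra of \<open>p\<close> in the stages of the
  chain is determined recursively by \<open>p\<close>, and the truncations of a coinductive tree satisfy the same
  recursion, since the choice of fresh variables is immaterial in the colimit.
\<close>


section \<open>Terms, tuples and injections\<close>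

text \<open>Laxness and strictness have one source each. Instantiating an atom may let more clauses
  match, so the coalgebra of a program is in general only lax natural; an injective renaming can be
  undone by a substitution, so along injections it is strict. That strictness in turn is what allows
  a transformation to act on the colimits. The obstacle is that \<open>n/Inj\<close> is not
  filtered: no injection equalizes two distinct parallel ones. Injections do amalgamate, however,
  and this already lets equality and order in the colimit be detected by a single cospan. Bounding
  the cospan relies on functors acting along all arrows of \<open>L\<close>, among them renamings
  that are not injective. Every choice of matcher is compared with one standard matcher, which
  shifts the variables outside the head by \<open>n\<close>.\<close>

lemma tsubst_tsubst: "tsubst \<sigma> (tsubst \<theta> t) = tsubst (\<lambda>v. tsubst \<sigma> (\<theta> v)) t"
  by (induction t) auto

lemma tsubst_cong: "(\<And>v. v \<in> tvars t \<Longrightarrow> \<sigma> v = \<theta> v) \<Longrightarrow> tsubst \<sigma> t = tsubst \<theta> t"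
  by (induction t) auto

lemma tsubst_Var [simp]: "tsubst Var t = t"
  by (induction t) (auto intro: map_idI)

lemma tvars_tsubst: "tvars (tsubst \<theta> t) = (\<Union>v\<in>tvars t. tvars (\<theta> v))"
  by (induction t) auto

lemma tsubst_terms:
  "t \<in> terms \<Sigma> \<Longrightarrow> (\<And>v. v \<in> tvars t \<Longrightarrow> \<theta> v \<in> terms \<Sigma>) \<Longrightarrow> tsubst \<theta> t \<in> terms \<Sigma>"
proof (induction t rule: terms.induct)
  case (2 f ts)
  then have "tsubst \<theta> t \<in> terms \<Sigma>" if "t \<in> set ts" for t
    using that by fastforce
  with 2 show ?case by (auto intro!: terms.intros(2))
qed simp

lemma asubst_asubst: "asubst \<sigma> (asubst \<theta> A) = asubst (\<lambda>v. tsubst \<sigma> (\<theta> v)) A"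
  by (cases A) (auto simp: tsubst_tsubst)

lemma asubst_cong: "(\<And>v. v \<in> avars A \<Longrightarrow> \<sigma> v = \<theta> v) \<Longrightarrow> asubst \<sigma> A = asubst \<theta> A"
  by (cases A) (auto intro: tsubst_cong)

lemma asubst_Var [simp]: "asubst Var A = A"
  by (cases A) (auto intro: map_idI)

lemma avars_asubst: "avars (asubst \<theta> A) = (\<Union>v\<in>avars A. tvars (\<theta> v))"
  by (cases A) (auto simp: tvars_tsubst)

lemma asubst_atoms:
  "A \<in> atoms \<Sigma> R \<Longrightarrow> (\<And>v. v \<in> avars A \<Longrightarrow> \<theta> v \<in> terms \<Sigma>) \<Longrightarrow> asubst \<theta> A \<in> atoms \<Sigma> R"
  by (fastforce simp: atoms_def intro: tsubst_terms)

text \<open>Constructors are injective, so equal instances force equal values at every variable that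
  occurs. Through \<open>asubst_eq_iff\<close>, two matchers of one head against one atom agree on
  the variables of the head; all freedom lies in the other variables.\<close>

lemma tsubst_eq_iff: "tsubst \<sigma> t = tsubst \<theta> t \<longleftrightarrow> (\<forall>v\<in>tvars t. \<sigma> v = \<theta> v)"
  by (induction t) auto

lemma asubst_eq_iff: "asubst \<sigma> A = asubst \<theta> A \<longleftrightarrow> (\<forall>v\<in>avars A. \<sigma> v = \<theta> v)"
  by (cases A) (auto simp: tsubst_eq_iff)

lemma finite_tvars [simp]: "finite (tvars t)"
  by (induction t) auto

lemma finite_avars [simp]: "finite (avars A)"
  by (cases A) auto

section \<open>Arrows of the syntactic category and renamings\<close>

lemma L_length: "f \<in> L \<Sigma> n m \<Longrightarrow> length f = m"
  by (simp add: L_def)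

lemma L_iff: "f \<in> L \<Sigma> n m \<longleftrightarrow> length f = m \<and> (\<forall>i<m. f ! i \<in> terms \<Sigma> \<and> tvars (f ! i) \<subseteq> {..<n})"
  by (auto simp: L_def all_set_conv_all_nth)

lemma length_lcomp [simp]: "length (lcomp g f) = length g"
  by (simp add: lcomp_def)

lemma length_J [simp]: "length (J s) = length s"
  by (simp add: J_def)

lemma nth_lcomp: "i < length g \<Longrightarrow> lcomp g f ! i = tsubst (tuple_subst f) (g ! i)"
  by (simp add: lcomp_def)

lemma nth_J [simp]: "i < length s \<Longrightarrow> J s ! i = Var (s ! i)"
  by (simp add: J_def)

lemma tuple_subst_terms: "f \<in> L \<Sigma> n m \<Longrightarrow> tuple_subst f v \<in> terms \<Sigma>"
  by (auto simp: tuple_subst_def L_iff terms.intros)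

lemma lcomp_in_L:
  assumes f: "f \<in> L \<Sigma> n m" and g: "g \<in> L \<Sigma> m k"
  shows "lcomp g f \<in> L \<Sigma> n k"
proof -
  have "tsubst (tuple_subst f) (g ! i) \<in> terms \<Sigma>" if "i < k" for i
    using g that by (intro tsubst_terms tuple_subst_terms[OF f]) (auto simp: L_iff)
  moreover have "tvars (tsubst (tuple_subst f) (g ! i)) \<subseteq> {..<n}" if "i < k" for i
    using f g that by (fastforce simp: L_iff tvars_tsubst tuple_subst_def)
  ultimately show ?thesis
    using g by (auto simp: L_iff[of "lcomp g f"] nth_lcomp L_length)
qed

lemma J_in_L: "set s \<subseteq> {..<n} \<Longrightarrow> J s \<in> L \<Sigma> n (length s)"
  by (auto simp: J_def L_def intro: terms.intros)

lemma J_inj_in_L: "i \<in> inj_maps n m \<Longrightarrow> J i \<in> L \<Sigma> m n"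
  using J_in_L[of i m \<Sigma>] by (simp add: inj_maps_def)

lemma id_in_L: "map Var [0..<n] \<in> L \<Sigma> n n"
  by (auto simp: L_def intro: terms.intros)

lemma lcomp_J: "set s \<subseteq> {..<length g} \<Longrightarrow> lcomp (J s) g = map ((!) g) s"
  by (auto simp: lcomp_def J_def tuple_subst_def)

lemma lcomp_J_J: "set s \<subseteq> {..<length k} \<Longrightarrow> lcomp (J s) (J k) = J (map ((!) k) s)"
  by (auto simp: lcomp_J) (auto simp: J_def)

section \<open>Injections, their extension and amalgamation\<close>

lemma inj_maps_length: "j \<in> inj_maps n m \<Longrightarrow> length j = n"
  by (simp add: inj_maps_def)

lemma inj_maps_set: "j \<in> inj_maps n m \<Longrightarrow> set j \<subseteq> {..<m}"
  by (simp add: inj_maps_def)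

lemma inj_maps_nth: "j \<in> inj_maps n m \<Longrightarrow> i < n \<Longrightarrow> j ! i < m"
  using nth_mem by (fastforce simp: inj_maps_def)

lemma upt_inj_maps: "n \<le> m \<Longrightarrow> [0..<n] \<in> inj_maps n m"
  by (auto simp: inj_maps_def)

lemma finite_inj_maps: "finite (inj_maps n m)"
  by (rule finite_subset[OF _ finite_lists_length_eq[of "{..<m}" n]]) (auto simp: inj_maps_def)

lemma map_inj_maps:
  assumes "inj_on \<phi> {..<n}" "\<phi> ` {..<n} \<subseteq> {..<m}"
  shows "map \<phi> [0..<n] \<in> inj_maps n m"
  using assms by (auto simp: inj_maps_def distinct_map atLeast0LessThan)

lemma inj_maps_comp:
  assumes j: "j \<in> inj_maps n m" and k: "k \<in> inj_maps m p"
  shows "map ((!) k) j \<in> inj_maps n p"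
proof -
  have "inj_on ((!) k) (set j)"
    using assms by (intro inj_on_nth) (auto simp: inj_maps_def)
  moreover have "k ! v < p" if "v \<in> set j" for v
    using that inj_maps_set[OF j] by (intro inj_maps_nth[OF k]) auto
  ultimately show ?thesis using j by (auto simp: inj_maps_def distinct_map)
qed

lemma J_comp:
  assumes j: "j \<in> inj_maps n m" and k: "k \<in> inj_maps m p"
  shows "lcomp (J j) (J k) = J (map ((!) k) j)"
  using assms by (intro lcomp_J_J) (auto simp: inj_maps_def)

lemma map_nth_upt_id: "set j \<subseteq> {..<m} \<Longrightarrow> map ((!) [0..<m]) j = j"
  by (rule map_idI) auto

text \<open>Shifting the elements outside the image of \<open>j\<close> beyond \<open>N\<close> avoids any choice of a bijection.\<close>

lemma inj_extend:
  assumes j: "j \<in> inj_maps n m" and w: "w \<in> inj_maps n N"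
  obtains q where "q \<in> inj_maps m (N + m + K)" "map ((!) q) j = w"
proof -
  \<comment> \<open>\<open>idx\<close> inverts \<open>j\<close> on its image; the position found
    there is looked up in \<open>w\<close>.\<close>
  define idx where "idx v = (THE i. i < n \<and> j ! i = v)" for v
  have idx: "idx (j ! i) = i" if "i < n" for i
    using j that unfolding idx_def by (auto simp: inj_maps_def nth_eq_iff_index_eq)
  have idxv: "idx v < n \<and> j ! idx v = v" if "v \<in> set j" for v
    using that j idx by (auto simp: in_set_conv_nth inj_maps_def)
  \<comment> \<open>Values on the image of \<open>j\<close> are below \<open>N\<close> and all
    others are at least \<open>N\<close>, so the two cases cannot collide. \<open>K\<close> adds
    room in the codomain; \<open>\<rho>_canonical\<close> takes \<open>K = 1\<close> to guarantee a
    nonempty context.\<close>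
  define \<phi> where "\<phi> v = (if v \<in> set j then w ! idx v else N + v)" for v
  have "inj_on \<phi> {..<m}"
  proof (rule inj_onI)
    fix u v assume uv: "u \<in> {..<m}" "v \<in> {..<m}" "\<phi> u = \<phi> v"
    have "w ! idx x < N" if "x \<in> set j" for x
      using idxv[OF that] by (intro inj_maps_nth[OF w]) simp
    moreover have "u = v" if "u \<in> set j" "v \<in> set j" "w ! idx u = w ! idx v"
    proof -
      have "idx u = idx v"
        using that(3) idxv[OF that(1)] idxv[OF that(2)] w
          nth_eq_iff_index_eq[of w "idx u" "idx v"] by (auto simp only: inj_maps_def mem_Collect_eq)
      then show ?thesis using idxv that by metis
    qed
    ultimately show "u = v"
      using uv(3) unfolding \<phi>_def by (smt (verit) add_left_cancel not_add_less1)
  qed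
  moreover have "\<phi> ` {..<m} \<subseteq> {..<N + m + K}"
  proof -
    have "w ! idx v < N + m + K" if "v \<in> set j" for v
      using inj_maps_nth[OF w, of "idx v"] idxv[OF that] by simp
    then show ?thesis by (auto simp: \<phi>_def)
  qed
  ultimately have "map \<phi> [0..<m] \<in> inj_maps m (N + m + K)"
    by (rule map_inj_maps)
  moreover have "map ((!) (map \<phi> [0..<m])) j = w"
    using j w idx inj_maps_nth[OF j] by (intro nth_equalityI) (auto simp: \<phi>_def inj_maps_def)
  ultimately show thesis by (rule that)
qed

text \<open>The first leg is the inclusion of \<open>m\<close> into \<open>m + m'\<close>, the
  second extends \<open>j\<close> along \<open>j'\<close>. This property of \<open>Inj\<close> is
  what makes being related at a common stage transitive.\<close>

lemma inj_amalgam: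
  assumes j: "j \<in> inj_maps n m" and j': "j' \<in> inj_maps n m'"
  obtains M p q where "p \<in> inj_maps m M" "q \<in> inj_maps m' M" "map ((!) p) j = map ((!) q) j'"
proof -
  obtain q where q: "q \<in> inj_maps m' (m + m' + 0)" "map ((!) q) j' = j"
    using inj_extend[OF j' j] by blast
  have "[0..<m] \<in> inj_maps m (m + m' + 0)" by (rule upt_inj_maps) simp
  moreover have "map ((!) [0..<m]) j = j"
    using inj_maps_set[OF j] by (rule map_nth_upt_id)
  ultimately show thesis using that q by metis
qed

section \<open>Extension of arrows by fresh variables\<close>

lemma ext_in_L:
  assumes "f \<in> L \<Sigma> n m"
  shows "f @ map Var [n..<n + k] \<in> L \<Sigma> (n + k) (m + k)"
  using assms by (fastforce simp: L_def intro: terms.intros)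

text \<open>A component of \<open>g\<close> contains only variables below \<open>m\<close>, so the
  appended variables do not interfere with it, and they themselves are passed on one by one.
  Together with \<open>id_ext\<close> this is the functoriality behind the action on the
  colimit.\<close>

lemma lcomp_ext:
  assumes f: "f \<in> L \<Sigma> n m" and g: "g \<in> L \<Sigma> m p"
  shows "lcomp (g @ map Var [m..<m + k]) (f @ map Var [n..<n + k]) = lcomp g f @ map Var [n..<n + k]"
proof (rule nth_equalityI)
  fix i assume i: "i < length (lcomp (g @ map Var [m..<m + k]) (f @ map Var [n..<n + k]))"
  have [simp]: "length f = m" "length g = p" using f g by (auto simp: L_length)
  show "lcomp (g @ map Var [m..<m + k]) (f @ map Var [n..<n + k]) ! i = (lcomp g f @ map Var [n..<n + k]) ! i"
  proof (cases "i < p")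
    case True
    then have "tvars (g ! i) \<subseteq> {..<m}" using g by (auto simp: L_iff)
    then have "tsubst (tuple_subst (f @ map Var [n..<n + k])) (g ! i) = tsubst (tuple_subst f) (g ! i)"
      by (intro tsubst_cong) (auto simp: tuple_subst_def nth_append)
    with True i show ?thesis by (simp add: nth_lcomp nth_append)
  next
    case False
    with i show ?thesis by (auto simp: nth_lcomp nth_append tuple_subst_def)
  qed
qed simp

lemma id_ext: "map Var [0..<n] @ map Var [n..<n + k] = map Var [0..<n + k]"
  by (simp add: upt_add_eq_append[of 0 n k] flip: map_append)

text \<open>Needed to pass strictness along injections to the colimit functor, whose action on
  \<open>J i\<close> uses the extension of \<open>J i\<close> by \<open>k\<close> variables.\<close>

lemma J_ext:
  assumes "i \<in> inj_maps n m"
  shows "J i @ map Var [m..<m + k] = J (i @ [m..<m + k])" "i @ [m..<m + k] \<in> inj_maps (n + k) (m + k)"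
  using assms by (auto simp: J_def inj_maps_def)


section \<open>The colimit over injections\<close>

lemma preorder_onD:
  assumes "preorder_on A r"
  shows "(x, y) \<in> r \<Longrightarrow> x \<in> A" "(x, y) \<in> r \<Longrightarrow> y \<in> A"
    "x \<in> A \<Longrightarrow> (x, x) \<in> r" "(x, y) \<in> r \<Longrightarrow> (y, z) \<in> r \<Longrightarrow> (x, z) \<in> r"
  using assms by (auto simp: preorder_on_def refl_on_def dest: transD)

lemma preorder_onI:
  assumes "\<And>x y. (x, y) \<in> r \<Longrightarrow> x \<in> A \<and> y \<in> A" "\<And>x. x \<in> A \<Longrightarrow> (x, x) \<in> r"
    "\<And>x y z. (x, y) \<in> r \<Longrightarrow> (y, z) \<in> r \<Longrightarrow> (x, z) \<in> r"
  shows "preorder_on A r"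
  unfolding preorder_on_def refl_on_def trans_def
  using assms(1,2) by (auto intro: assms(3))

lemma monotone_mapsD:
  assumes "g \<in> monotone_maps X Y"
  shows "x \<in> Car X \<Longrightarrow> g x \<in> Car Y" "(x, y) \<in> Le X \<Longrightarrow> (g x, g y) \<in> Le Y"
  using assms by (auto simp: monotone_maps_def)

lemma monotone_mapsI:
  assumes "\<And>x. x \<in> Car X \<Longrightarrow> g x \<in> Car Y" "\<And>x y. (x, y) \<in> Le X \<Longrightarrow> (g x, g y) \<in> Le Y"
  shows "g \<in> monotone_maps X Y"
  using assms by (auto simp: monotone_maps_def)

lemma is_funcD:
  assumes "is_func \<Sigma> H"
  shows "preorder_on (Car (fob H n)) (Le (fob H n))"
    "f \<in> L \<Sigma> n m \<Longrightarrow> fmap H n f \<in> monotone_maps (fob H m) (fob H n)"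
    "f \<in> L \<Sigma> n m \<Longrightarrow> x \<in> Car (fob H m) \<Longrightarrow> fmap H n f x \<in> Car (fob H n)"
    "f \<in> L \<Sigma> n m \<Longrightarrow> (x, y) \<in> Le (fob H m) \<Longrightarrow> (fmap H n f x, fmap H n f y) \<in> Le (fob H n)"
    "x \<in> Car (fob H n) \<Longrightarrow> fmap H n (map Var [0..<n]) x = x"
    "f \<in> L \<Sigma> n m \<Longrightarrow> g \<in> L \<Sigma> m l \<Longrightarrow> z \<in> Car (fob H l) \<Longrightarrow>
       fmap H n f (fmap H m g z) = fmap H n (lcomp g f) z"
    "i \<in> inj_maps n m \<Longrightarrow> x \<in> Car (fob H n) \<Longrightarrow> fmap H m (J i) x \<in> Car (fob H m)"
    "i \<in> inj_maps n m \<Longrightarrow> k \<in> inj_maps m p \<Longrightarrow> x \<in> Car (fob H n) \<Longrightarrow>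
       fmap H p (J k) (fmap H m (J i) x) = fmap H p (J (map ((!) k) i)) x"
proof -
  show *: "preorder_on (Car (fob H n)) (Le (fob H n))"
    "f \<in> L \<Sigma> n m \<Longrightarrow> fmap H n f \<in> monotone_maps (fob H m) (fob H n)"
    "x \<in> Car (fob H n) \<Longrightarrow> fmap H n (map Var [0..<n]) x = x"
    "f \<in> L \<Sigma> n m \<Longrightarrow> g \<in> L \<Sigma> m l \<Longrightarrow> z \<in> Car (fob H l) \<Longrightarrow>
       fmap H n f (fmap H m g z) = fmap H n (lcomp g f) z" for n m l x z f g
    using assms by (auto simp: is_func_def)
  show **: "f \<in> L \<Sigma> n m \<Longrightarrow> x \<in> Car (fob H m) \<Longrightarrow> fmap H n f x \<in> Car (fob H n)"
    "f \<in> L \<Sigma> n m \<Longrightarrow> (x, y) \<in> Le (fob H m) \<Longrightarrow> (fmap H n f x, fmap H n f y) \<in> Le (fob H n)"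
    for n m f x y
    using monotone_mapsD[OF *(2)] by blast+
  show "i \<in> inj_maps n m \<Longrightarrow> x \<in> Car (fob H n) \<Longrightarrow> fmap H m (J i) x \<in> Car (fob H m)"
    by (rule **(1)[OF J_inj_in_L])
  show "i \<in> inj_maps n m \<Longrightarrow> k \<in> inj_maps m p \<Longrightarrow> x \<in> Car (fob H n) \<Longrightarrow>
       fmap H p (J k) (fmap H m (J i) x) = fmap H p (J (map ((!) k) i)) x"
    using *(4)[OF J_inj_in_L J_inj_in_L, of k m p i n x] by (simp add: J_comp)
qed

lemma map_nth_map: "set j \<subseteq> {..<length p} \<Longrightarrow> map ((!) (map \<phi> p)) j = map \<phi> (map ((!) p) j)"
  by auto

lemma map_nth_comp:
  assumes "j \<in> inj_maps n m" "p \<in> inj_maps m M"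
  shows "map ((!) (map \<phi> p)) j = map \<phi> (map ((!) p) j)"
  using assms by (intro map_nth_map) (auto simp: inj_maps_def)

text \<open>
  With equality this is the identification of the colimit over \<open>n/Inj\<close>, with the orders of the
  \<open>H(m)\<close> it is the order of the colimit.
\<close>

definition amalg ::
    "('f, ('f, 'p, 'u) univ) func \<Rightarrow> (nat \<Rightarrow> ('f, 'p, 'u) univ \<Rightarrow> ('f, 'p, 'u) univ \<Rightarrow> bool)
       \<Rightarrow> nat \<Rightarrow> ('f, 'p, 'u) univ \<Rightarrow> ('f, 'p, 'u) univ \<Rightarrow> bool" where
  "amalg H r n a b \<longleftrightarrow> (\<exists>m j x m' j' x' M p q. a = URep m j x \<and> b = URep m' j' x' \<and>
     j \<in> inj_maps n m \<and> j' \<in> inj_maps n m' \<and> x \<in> Car (fob H m) \<and> x' \<in> Car (fob H m') \<and>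
     p \<in> inj_maps m M \<and> q \<in> inj_maps m' M \<and> map ((!) p) j = map ((!) q) j' \<and>
     r M (fmap H M (J p) x) (fmap H M (J q) x'))"

text \<open>Captures what equality and the orders of a functor share, so that identification and
  order in the colimit are handled by the same proofs. Invariance is along all arrows of
  \<open>L\<close>, because \<open>amalg_bounded\<close> applies a renaming that need not be
  injective.\<close>

definition stable_rel ::
    "('f \<times> nat) set \<Rightarrow> ('f, 'a) func \<Rightarrow> (nat \<Rightarrow> 'a \<Rightarrow> 'a \<Rightarrow> bool) \<Rightarrow> bool" where
  "stable_rel \<Sigma> H r \<longleftrightarrow>
     (\<forall>n. \<forall>x\<in>Car (fob H n). r n x x) \<and>
     (\<forall>n x y z. r n x y \<longrightarrow> r n y z \<longrightarrow> r n x z) \<and>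
     (\<forall>n m. \<forall>f\<in>L \<Sigma> n m. \<forall>x\<in>Car (fob H m). \<forall>y\<in>Car (fob H m).
        r m x y \<longrightarrow> r n (fmap H n f x) (fmap H n f y))"

lemma stable_relD:
  assumes "stable_rel \<Sigma> H r"
  shows "x \<in> Car (fob H n) \<Longrightarrow> r n x x" "r n x y \<Longrightarrow> r n y z \<Longrightarrow> r n x z"
    "f \<in> L \<Sigma> n m \<Longrightarrow> x \<in> Car (fob H m) \<Longrightarrow> y \<in> Car (fob H m) \<Longrightarrow> r m x y \<Longrightarrow>
      r n (fmap H n f x) (fmap H n f y)"
  using assms unfolding stable_rel_def by blast+

lemma stable_rel_eq: "stable_rel \<Sigma> H (\<lambda>n. (=))"
  by (auto simp: stable_rel_def)

lemma stable_rel_Le: "is_func \<Sigma> H \<Longrightarrow> stable_rel \<Sigma> H (\<lambda>n x y. (x, y) \<in> Le (fob H n))"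
  by (auto simp: stable_rel_def is_funcD preorder_onD(3)[OF is_funcD(1)]
           intro: preorder_onD(4)[OF is_funcD(1)])

lemma amalgI:
  assumes "j \<in> inj_maps n m" "j' \<in> inj_maps n m'" "x \<in> Car (fob H m)" "x' \<in> Car (fob H m')"
    "p \<in> inj_maps m M" "q \<in> inj_maps m' M" "map ((!) p) j = map ((!) q) j'"
    "r M (fmap H M (J p) x) (fmap H M (J q) x')"
  shows "amalg H r n (URep m j x) (URep m' j' x')"
  unfolding amalg_def using assms by blast

text \<open>The middle representative has been pushed along \<open>q\<close> to \<open>M\<close> and
  along \<open>p'\<close> to \<open>M'\<close>. Amalgamating these two over \<open>m'\<close> makes
  its images coincide at one stage \<open>N\<close>, and the two relations, moved to
  \<open>N\<close>, compose there.\<close>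

lemma amalg_trans:
  assumes H: "is_func \<Sigma> H" and r: "stable_rel \<Sigma> H r"
    and ab: "amalg H r n a b" and bc: "amalg H r n b c"
  shows "amalg H r n a c"
proof -
  from ab obtain m j x m' j' x' M p q where 1: "a = URep m j x" "b = URep m' j' x'"
     "j \<in> inj_maps n m" "j' \<in> inj_maps n m'" "x \<in> Car (fob H m)" "x' \<in> Car (fob H m')"
     "p \<in> inj_maps m M" "q \<in> inj_maps m' M" "map ((!) p) j = map ((!) q) j'"
     "r M (fmap H M (J p) x) (fmap H M (J q) x')"
    unfolding amalg_def by blast
  from bc 1(2) obtain m'' j'' x'' M' p' q' where 2: "c = URep m'' j'' x''"
     "j'' \<in> inj_maps n m''" "x'' \<in> Car (fob H m'')"
     "p' \<in> inj_maps m' M'" "q' \<in> inj_maps m'' M'" "map ((!) p') j' = map ((!) q') j''"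
     "r M' (fmap H M' (J p') x') (fmap H M' (J q') x'')"
    unfolding amalg_def by auto
  obtain N e e' where e: "e \<in> inj_maps M N" "e' \<in> inj_maps M' N" "map ((!) e) q = map ((!) e') p'"
    using inj_amalgam[OF 1(8) 2(4)] by blast
  have *: "r N (fmap H N (J e) (fmap H M (J p) x)) (fmap H N (J e) (fmap H M (J q) x'))"
    by (rule stable_relD(3)[OF r J_inj_in_L[OF e(1)] is_funcD(7)[OF H 1(7,5)] is_funcD(7)[OF H 1(8,6)] 1(10)])
  have **: "r N (fmap H N (J e') (fmap H M' (J p') x')) (fmap H N (J e') (fmap H M' (J q') x''))"
    by (rule stable_relD(3)[OF r J_inj_in_L[OF e(2)] is_funcD(7)[OF H 2(4) 1(6)] is_funcD(7)[OF H 2(5,3)] 2(7)])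
  have "r N (fmap H N (J (map ((!) e) p)) x) (fmap H N (J (map ((!) e') q')) x'')"
  proof -
    have "fmap H N (J e) (fmap H M (J q) x') = fmap H N (J e') (fmap H M' (J p') x')"
      using e(3) by (simp add: is_funcD(8)[OF H 1(8) e(1) 1(6)] is_funcD(8)[OF H 2(4) e(2) 1(6)])
    with * ** have "r N (fmap H N (J e) (fmap H M (J p) x)) (fmap H N (J e') (fmap H M' (J q') x''))"
      by (simp only: stable_relD(2)[OF r])
    then show ?thesis
      by (simp add: is_funcD(8)[OF H 1(7) e(1) 1(5)] is_funcD(8)[OF H 2(5) e(2) 2(3)])
  qed
  moreover have "map ((!) (map ((!) e) p)) j = map ((!) (map ((!) e') q')) j''"
  proof -
    have "map ((!) (map ((!) e) p)) j = map ((!) e) (map ((!) q) j')"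
      unfolding 1(9)[symmetric] by (rule map_nth_comp[OF 1(3,7)])
    also have "\<dots> = map ((!) (map ((!) e) q)) j'"
      by (rule map_nth_comp[OF 1(4,8), symmetric])
    also have "\<dots> = map ((!) e') (map ((!) p') j')"
      unfolding e(3) by (rule map_nth_comp[OF 1(4) 2(4)])
    also have "\<dots> = map ((!) (map ((!) e') q')) j''"
      unfolding 2(6) by (rule map_nth_comp[OF 2(2,5), symmetric])
    finally show ?thesis .
  qed
  ultimately show ?thesis
    unfolding 1(1) 2(1)
    by (intro amalgI[where r = r, OF 1(3) 2(2) 1(5) 2(3) inj_maps_comp[OF 1(7) e(1)] inj_maps_comp[OF 2(5) e(2)]])
qed

text \<open>The cospan consists of \<open>k\<close> and the identity of \<open>m'\<close>.\<close>

lemma amalg_push: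
  assumes H: "is_func \<Sigma> H" and r: "stable_rel \<Sigma> H r"
    and "j \<in> inj_maps n m" "k \<in> inj_maps m m'" "x \<in> Car (fob H m)"
  shows "amalg H r n (URep m j x) (URep m' (map ((!) k) j) (fmap H m' (J k) x))"
    "amalg H r n (URep m' (map ((!) k) j) (fmap H m' (J k) x)) (URep m j x)"
proof -
  have id: "[0..<m'] \<in> inj_maps m' m'" by (rule upt_inj_maps) simp
  have "r m' (fmap H m' (J k) x) (fmap H m' (J k) x)"
    by (rule stable_relD(1)[OF r is_funcD(7)[OF H assms(4,5)]])
  then have *: "r m' (fmap H m' (J k) x) (fmap H m' (J [0..<m']) (fmap H m' (J k) x))"
    "r m' (fmap H m' (J [0..<m']) (fmap H m' (J k) x)) (fmap H m' (J k) x)"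
    using assms by (auto simp: J_def[of "[0..<m']"] is_funcD[OF H])
  have c: "map ((!) k) j = map ((!) [0..<m']) (map ((!) k) j)"
    using inj_maps_set[OF inj_maps_comp] assms by (metis map_nth_upt_id)
  show "amalg H r n (URep m j x) (URep m' (map ((!) k) j) (fmap H m' (J k) x))"
    by (rule amalgI[where p = k and q = "[0..<m']"]) (use assms * c id is_funcD(7)[OF H] inj_maps_comp in auto)
  show "amalg H r n (URep m' (map ((!) k) j) (fmap H m' (J k) x)) (URep m j x)"
    by (rule amalgI[where q = k and p = "[0..<m']"]) (use assms * c[symmetric] id is_funcD(7)[OF H] inj_maps_comp in auto)
qed

lemma amalg_self:
  assumes H: "is_func \<Sigma> H" and j: "j \<in> inj_maps n m"
    and x: "x \<in> Car (fob H m)" "y \<in> Car (fob H m)" and r: "r m x y"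
  shows "amalg H r n (URep m j x) (URep m j y)"
proof -
  have id: "[0..<m] \<in> inj_maps m m" by (rule upt_inj_maps) simp
  have "r m (fmap H m (J [0..<m]) x) (fmap H m (J [0..<m]) y)"
    using r x by (auto simp: J_def is_funcD[OF H])
  then show ?thesis using amalgI[OF j j x id id, of r] by simp
qed

text \<open>A zigzag of generating identifications shrinks to a single cospan: the generators are
  cospans, and \<open>amalg_trans\<close> composes them. Conversely, the two legs of a cospan are
  two generating steps.\<close>

lemma colim_eq_iff_amalg:
  assumes H: "is_func \<Sigma> H"
  shows "colim_eq H n a b \<longleftrightarrow> amalg H (\<lambda>n. (=)) n a b"
proof
  assume "colim_eq H n a b"
  then show "amalg H (\<lambda>n. (=)) n a b"
  proof induction
    case (push j m k m' x)
    then show ?case by (intro amalg_push(1)[OF H stable_rel_eq])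
  next
    case (refl j m x)
    then show ?case by (intro amalg_self[OF H]) auto
  next
    case (sym a b)
    then show ?case unfolding amalg_def by metis
  next
    case (trans a b c)
    then show ?case using amalg_trans[OF H stable_rel_eq] by blast
  qed
next
  assume "amalg H (\<lambda>n. (=)) n a b"
  then obtain m j x m' j' x' M p q where 1: "a = URep m j x" "b = URep m' j' x'"
     "j \<in> inj_maps n m" "j' \<in> inj_maps n m'" "x \<in> Car (fob H m)" "x' \<in> Car (fob H m')"
     "p \<in> inj_maps m M" "q \<in> inj_maps m' M" "map ((!) p) j = map ((!) q) j'"
     "fmap H M (J p) x = fmap H M (J q) x'"
    unfolding amalg_def by blast
  have "colim_eq H n a (URep M (map ((!) p) j) (fmap H M (J p) x))"
    using colim_eq.push[OF 1(3,7,5)] 1(1) by simp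
  moreover have "colim_eq H n b (URep M (map ((!) p) j) (fmap H M (J p) x))"
    using colim_eq.push[OF 1(4,8,6)] 1(2,9,10) by simp
  ultimately show "colim_eq H n a b" by (metis colim_eq.sym colim_eq.trans)
qed

lemma colim_le_iff_amalg:
  assumes H: "is_func \<Sigma> H"
  shows "colim_le H n a b \<longleftrightarrow> amalg H (\<lambda>n x y. (x, y) \<in> Le (fob H n)) n a b"
proof
  assume "colim_le H n a b"
  then show "amalg H (\<lambda>n x y. (x, y) \<in> Le (fob H n)) n a b"
  proof induction
    case (eq a b)
    then show ?case
    proof induction
      case (push j m k m' x)
      then show ?case by (intro amalg_push(1)[OF H stable_rel_Le[OF H]])
    next
      case (refl j m x)
      then show ?case by (intro amalg_self[OF H] preorder_onD(3)[OF is_funcD(1)[OF H]])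
    next
      \<comment> \<open>The induction hypothesis for the order cannot be turned around. The
        underlying identification can, and equality at a stage gives the order there by
        reflexivity.\<close>
      case (sym a b)
      then have "amalg H (\<lambda>n. (=)) n b a" by (simp flip: colim_eq_iff_amalg[OF H] add: colim_eq.sym)
      then show ?case unfolding amalg_def
        by (metis preorder_onD(3)[OF is_funcD(1)[OF H]] is_funcD(7)[OF H])
    next
      case (trans a b c)
      then show ?case using amalg_trans[OF H stable_rel_Le[OF H]] by blast
    qed
  next
    case (le j m x y)
    then show ?case using preorder_onD[OF is_funcD(1)[OF H]] by (intro amalg_self[OF H]) auto
  next
    case (trans a b c)
    then show ?case using amalg_trans[OF H stable_rel_Le[OF H]] by blast
  qed
next
  assume "amalg H (\<lambda>n x y. (x, y) \<in> Le (fob H n)) n a b"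
  then obtain m j x m' j' x' M p q where 1: "a = URep m j x" "b = URep m' j' x'"
     "j \<in> inj_maps n m" "j' \<in> inj_maps n m'" "x \<in> Car (fob H m)" "x' \<in> Car (fob H m')"
     "p \<in> inj_maps m M" "q \<in> inj_maps m' M" "map ((!) p) j = map ((!) q) j'"
     "(fmap H M (J p) x, fmap H M (J q) x') \<in> Le (fob H M)"
    unfolding amalg_def by blast
  have "colim_le H n a (URep M (map ((!) p) j) (fmap H M (J p) x))"
    using colim_eq.push[OF 1(3,7,5)] 1(1) by (simp add: colim_le.eq)
  also have "colim_le H n \<dots> (URep M (map ((!) p) j) (fmap H M (J q) x'))"
    by (rule colim_le.le[OF inj_maps_comp[OF 1(3,7)] 1(10)])
  also (colim_le.trans) have "colim_le H n \<dots> b"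
    using colim_eq.push[OF 1(4,8,6)] 1(2,9) by (auto intro: colim_le.eq colim_eq.sym)
  finally (colim_le.trans) show "colim_le H n a b" .
qed

text \<open>Compactness for a decreasing predicate on a finite set: if every element failed
  somewhere, all of them would fail at the largest of the failure indices.\<close>

lemma eventually_constant_witness:
  assumes "finite S" "\<And>i::nat. \<exists>s\<in>S. P i s" "\<And>i s. s \<in> S \<Longrightarrow> P (Suc i) s \<Longrightarrow> P i s"
  shows "\<exists>s\<in>S. \<forall>i. P i s"
proof (rule ccontr)
  assume "\<not> (\<exists>s\<in>S. \<forall>i. P i s)"
  then obtain h where h: "\<And>s. s \<in> S \<Longrightarrow> \<not> P (h s) s" by metis
  have down: "P i s" if "s \<in> S" "P j s" "i \<le> j" for i j s
    using that(3,2) by (induction rule: inc_induct) (auto intro: assms(3)[OF that(1)])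
  obtain s where "s \<in> S" "P (Max (h ` S)) s" using assms(2) by blast
  then show False using down[of s "Max (h ` S)" "h s"] h assms(1) by auto
qed

text \<open>
  The common stage can be taken small: a renaming that is injective on the images of \<open>p\<close> and \<open>q\<close>,
  though perhaps not elsewhere, is an arrow of \<open>L\<close>.  It has to send the remaining variables
  somewhere, which is impossible in the empty context.
\<close>

lemma amalg_bounded:
  assumes H: "is_func \<Sigma> H" and r: "stable_rel \<Sigma> H r"
    and am: "amalg H r n (URep m j x) (URep m' j' x')" and "0 < m"
  shows "\<exists>p\<in>inj_maps m (m + m'). \<exists>q\<in>inj_maps m' (m + m'). map ((!) p) j = map ((!) q) j' \<and>
     r (m + m') (fmap H (m + m') (J p) x) (fmap H (m + m') (J q) x')"
proof -
  from am obtain M p q where 1: 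
     "j \<in> inj_maps n m" "j' \<in> inj_maps n m'" "x \<in> Car (fob H m)" "x' \<in> Car (fob H m')"
     "p \<in> inj_maps m M" "q \<in> inj_maps m' M" "map ((!) p) j = map ((!) q) j'"
     "r M (fmap H M (J p) x) (fmap H M (J q) x')"
    unfolding amalg_def by auto
  \<comment> \<open>\<open>M\<close> may be arbitrarily large, but only the images of
    \<open>p\<close> and \<open>q\<close> matter. They contain at most \<open>m + m'\<close>
    variables, and \<open>s\<close> packs these into the smaller context.\<close>
  have "card (set p \<union> set q) \<le> m + m'"
    using 1(5,6) by (intro order.trans[OF card_Un_le]) (auto simp: inj_maps_def distinct_card)
  then obtain s where s: "inj_on s (set p \<union> set q)" "s ` (set p \<union> set q) \<subseteq> {..<m + m'}"
    using card_le_inj[of "set p \<union> set q" "{..<m + m'}"] by auto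
  \<comment> \<open>The default \<open>0\<close> is a legal variable because \<open>0 < m\<close>.
    Collisions at \<open>0\<close> are harmless: \<open>g\<close> has to be an arrow of
    \<open>L\<close> only, while its composites with \<open>p\<close> and \<open>q\<close> stay
    injective.\<close>
  define t where "t v = (if v \<in> set p \<union> set q then s v else 0)" for v
  define g :: "'a trm list" where "g = J (map t [0..<M])"
  have g: "g \<in> L \<Sigma> (m + m') M"
    using J_in_L[of "map t [0..<M]" "m + m'" \<Sigma>] s \<open>0 < m\<close> by (fastforce simp: g_def t_def)
  have ps: "set p \<subseteq> {..<M}" "set q \<subseteq> {..<M}" using 1 by (auto simp: inj_maps_def)
  have c: "lcomp (J p) g = J (map t p)" "lcomp (J q) g = J (map t q)"
    using ps by (auto simp: g_def lcomp_J_J map_nth_map map_nth_upt_id)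
  have inj: "map t p \<in> inj_maps m (m + m')" "map t q \<in> inj_maps m' (m + m')"
    using 1(5,6) s by (auto simp: inj_maps_def distinct_map t_def inj_on_def)
  have "r (m + m') (fmap H (m + m') g (fmap H M (J p) x)) (fmap H (m + m') g (fmap H M (J q) x'))"
    by (rule stable_relD(3)[OF r g is_funcD(7)[OF H 1(5,3)] is_funcD(7)[OF H 1(6,4)] 1(8)])
  then have "r (m + m') (fmap H (m + m') (J (map t p)) x) (fmap H (m + m') (J (map t q)) x')"
    using g 1 by (simp add: is_funcD(6)[OF H g J_inj_in_L] c)
  moreover have "map ((!) (map t p)) j = map ((!) (map t q)) j'"
    using 1 by (simp only: map_nth_comp)
  ultimately show ?thesis using inj by blast
qed

text \<open>The codomain \<open>m + m'\<close> given by \<open>amalg_bounded\<close> does not depend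
  on \<open>i\<close>, so the candidate cospans form one finite set for all stages. By
  \<open>dec\<close> the set of working cospans shrinks with \<open>i\<close>, and
  \<open>lim\<close> transfers a cospan that works everywhere to \<open>Z\<close>.\<close>

lemma amalg_limit:
  assumes Z: "is_func \<Sigma> Z" and H: "\<And>i. is_func \<Sigma> (H i)" "\<And>i. stable_rel \<Sigma> (H i) (r i)"
    and nat: "\<And>i n m k x. k \<in> inj_maps n m \<Longrightarrow> x \<in> Car (fob Z n) \<Longrightarrow>
      fmap (H i) m (J k) (\<pi> i n x) = \<pi> i m (fmap Z m (J k) x)"
    and dec: "\<And>i n x y. x \<in> Car (fob Z n) \<Longrightarrow> y \<in> Car (fob Z n) \<Longrightarrow>
      r (Suc i) n (\<pi> (Suc i) n x) (\<pi> (Suc i) n y) \<Longrightarrow> r i n (\<pi> i n x) (\<pi> i n y)"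
    and lim: "\<And>n x y. x \<in> Car (fob Z n) \<Longrightarrow> y \<in> Car (fob Z n) \<Longrightarrow>
      (\<And>i. r i n (\<pi> i n x) (\<pi> i n y)) \<Longrightarrow> rZ n x y"
    and x: "x \<in> Car (fob Z m)" "x' \<in> Car (fob Z m')" "j \<in> inj_maps n m" "j' \<in> inj_maps n m'"
    and "0 < m"
    and am: "\<And>i. amalg (H i) (r i) n (URep m j (\<pi> i m x)) (URep m' j' (\<pi> i m' x'))"
  shows "amalg Z rZ n (URep m j x) (URep m' j' x')"
proof -
  let ?M = "m + m'"
  let ?S = "{(p, q). p \<in> inj_maps m ?M \<and> q \<in> inj_maps m' ?M \<and> map ((!) p) j = map ((!) q) j'}"
  let ?P = "\<lambda>i (p, q). r i ?M (\<pi> i ?M (fmap Z ?M (J p) x)) (\<pi> i ?M (fmap Z ?M (J q) x'))"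
  have "finite (inj_maps m ?M \<times> inj_maps m' ?M)"
    using finite_inj_maps by blast
  then have "finite ?S" by (rule rev_finite_subset) auto
  moreover have "\<exists>s\<in>?S. ?P i s" for i
    using amalg_bounded[OF H am \<open>0 < m\<close>, of i] by (auto simp: nat x)
  moreover have "?P i s" if "s \<in> ?S" "?P (Suc i) s" for i s
    using that by (auto intro!: dec is_funcD(7)[OF Z] x)
  ultimately have "\<exists>s\<in>?S. \<forall>i. ?P i s" by (rule eventually_constant_witness)
  then obtain p q where pq: "p \<in> inj_maps m ?M" "q \<in> inj_maps m' ?M" "map ((!) p) j = map ((!) q) j'"
    "\<And>i. r i ?M (\<pi> i ?M (fmap Z ?M (J p) x)) (\<pi> i ?M (fmap Z ?M (J q) x'))"
    by auto
  then have "rZ ?M (fmap Z ?M (J p) x) (fmap Z ?M (J q) x')"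
    using lim[OF is_funcD(7)[OF Z pq(1) x(1)] is_funcD(7)[OF Z pq(2) x(2)]] by blast
  with pq x show ?thesis by (intro amalgI)
qed

section \<open>Colimit injections and maps out of the colimit\<close>

lemma colim_eq_\<rho>:
  "j \<in> inj_maps n m \<Longrightarrow> x \<in> Car (fob H m) \<Longrightarrow> colim_eq H n (URep m j x) (\<rho> H n m j x)"
  unfolding \<rho>_def by (rule someI[of "colim_eq H n (URep m j x)"]) (rule colim_eq.refl)

text \<open>Equivalent representatives have the same equivalence class as a predicate, so
  \<open>SOME\<close> is applied to the same predicate.\<close>

lemma \<rho>_eqI: "colim_eq H n (URep m j x) (URep m' j' x') \<Longrightarrow> \<rho> H n m j x = \<rho> H n m' j' x'"
proof -
  assume *: "colim_eq H n (URep m j x) (URep m' j' x')"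
  have "colim_eq H n (URep m j x) = colim_eq H n (URep m' j' x')"
  proof
    fix a show "colim_eq H n (URep m j x) a = colim_eq H n (URep m' j' x') a"
      using colim_eq.trans[OF *] colim_eq.trans[OF colim_eq.sym[OF *]] by blast
  qed
  then show ?thesis by (simp add: \<rho>_def)
qed

lemma \<rho>_eq_iff:
  assumes "j \<in> inj_maps n m" "j' \<in> inj_maps n m'" "x \<in> Car (fob H m)" "x' \<in> Car (fob H m')"
  shows "\<rho> H n m j x = \<rho> H n m' j' x' \<longleftrightarrow> colim_eq H n (URep m j x) (URep m' j' x')"
proof
  assume eq: "\<rho> H n m j x = \<rho> H n m' j' x'"
  show "colim_eq H n (URep m j x) (URep m' j' x')"
    using colim_eq_\<rho>[OF assms(1,3)] colim_eq_\<rho>[OF assms(2,4)]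
    unfolding eq by (rule colim_eq.trans[OF _ colim_eq.sym])
qed (rule \<rho>_eqI)

lemma \<rho>_push:
  assumes "j \<in> inj_maps n m" "k \<in> inj_maps m m'" "x \<in> Car (fob H m)"
  shows "\<rho> H n m' (map ((!) k) j) (fmap H m' (J k) x) = \<rho> H n m j x"
  by (rule \<rho>_eqI[OF colim_eq.sym[OF colim_eq.push[OF assms]]])

lemma \<rho>_in_int: "j \<in> inj_maps n m \<Longrightarrow> x \<in> Car (fob H m) \<Longrightarrow> \<rho> H n m j x \<in> Car (int_ob H n)"
  by (auto simp: int_ob_def Let_def)

text \<open>The order is defined on chosen representatives; these are equivalent to the given ones,
  so the choice cancels on both sides.\<close>

lemma int_Le_iff:
  assumes "j \<in> inj_maps n m" "j' \<in> inj_maps n m'" "x \<in> Car (fob H m)" "x' \<in> Car (fob H m')"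
  shows "(\<rho> H n m j x, \<rho> H n m' j' x') \<in> Le (int_ob H n) \<longleftrightarrow>
    colim_le H n (URep m j x) (URep m' j' x')"
proof -
  have "colim_le H n (URep m j x) (URep m' j' x')" if "colim_le H n (\<rho> H n m j x) (\<rho> H n m' j' x')"
    using colim_le.trans[OF colim_le.eq[OF colim_eq_\<rho>[OF assms(1,3)]]
        colim_le.trans[OF that colim_le.eq[OF colim_eq.sym[OF colim_eq_\<rho>[OF assms(2,4)]]]]] .
  moreover have "colim_le H n (\<rho> H n m j x) (\<rho> H n m' j' x')" if "colim_le H n (URep m j x) (URep m' j' x')"
    using colim_le.trans[OF colim_le.eq[OF colim_eq.sym[OF colim_eq_\<rho>[OF assms(1,3)]]]
        colim_le.trans[OF that colim_le.eq[OF colim_eq_\<rho>[OF assms(2,4)]]]] .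
  ultimately show ?thesis
    using \<rho>_in_int[OF assms(1,3)] \<rho>_in_int[OF assms(2,4)] by (auto simp: int_ob_def Let_def)
qed

lemma \<rho>_mono:
  assumes "is_func \<Sigma> H" "j \<in> inj_maps n m" "(x, y) \<in> Le (fob H m)"
  shows "(\<rho> H n m j x, \<rho> H n m j y) \<in> Le (int_ob H n)"
  using assms preorder_onD[OF is_funcD(1)[OF assms(1)]] by (simp add: int_Le_iff colim_le.le)

text \<open>Relabelling the stage moves the image of \<open>j\<close> onto the initial segment. The
  summand \<open>m\<close> leaves room for the elements outside that image, and the \<open>1\<close>
  is a spare variable that keeps the context nonempty.\<close>

lemma \<rho>_canonical:
  assumes H: "is_func \<Sigma> H" and j: "j \<in> inj_maps n m" and x: "x \<in> Car (fob H m)"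
  obtains k y where "k \<in> inj_maps m (n + m + 1)" "map ((!) k) j = [0..<n]"
    "\<rho> H n m j x = \<rho> H n (n + (m + 1)) [0..<n] (fmap H (n + (m + 1)) (J k) x)"
proof -
  obtain k where k: "k \<in> inj_maps m (n + m + 1)" "map ((!) k) j = [0..<n]"
    using inj_extend[OF j upt_inj_maps[of n n]] by blast
  show thesis
    using that[OF k] \<rho>_push[OF j k(1) x] k(2) by (simp add: add.assoc)
qed

text \<open>\<open>int_map\<close> and \<open>int_comp\<close> are defined through canonical
  injections, so every element must have such a representative. That \<open>k\<close> can be
  positive supplies the nonempty context demanded by \<open>amalg_limit\<close>, even at
  \<open>n = 0\<close>.\<close>

lemma int_cases:
  assumes H: "is_func \<Sigma> H" and a: "a \<in> Car (int_ob H n)"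
  obtains k x where "0 < k" "x \<in> Car (fob H (n + k))" "a = \<rho> H n (n + k) [0..<n] x"
proof -
  from a obtain m j x where *: "j \<in> inj_maps n m" "x \<in> Car (fob H m)" "a = \<rho> H n m j x"
    by (auto simp: int_ob_def Let_def)
  obtain k where k: "k \<in> inj_maps m (n + m + 1)"
    "\<rho> H n m j x = \<rho> H n (n + (m + 1)) [0..<n] (fmap H (n + (m + 1)) (J k) x)"
    using \<rho>_canonical[OF H *(1,2)] by blast
  show thesis
    using that[of "m + 1"] is_funcD(7)[OF H k(1) *(2)] k(2) *(3) by (simp add: add.assoc)
qed

text \<open>The universal property of the colimit for a cocone \<open>\<phi>\<close>: two
  representatives of one element become equal along some cospan, and \<open>push\<close> reads this
  equality back on both sides.\<close>

lemma \<rho>_descend: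
  assumes H: "is_func \<Sigma> H"
    and "j \<in> inj_maps n m" "j' \<in> inj_maps n m'" "x \<in> Car (fob H m)" "x' \<in> Car (fob H m')"
    and "\<rho> H n m j x = \<rho> H n m' j' x'"
    and push: "\<And>m j k m' x. j \<in> inj_maps n m \<Longrightarrow> k \<in> inj_maps m m' \<Longrightarrow> x \<in> Car (fob H m) \<Longrightarrow>
      \<phi> m' (map ((!) k) j) (fmap H m' (J k) x) = \<phi> m j x"
  shows "\<phi> m j x = \<phi> m' j' x'"
proof -
  have "amalg H (\<lambda>n. (=)) n (URep m j x) (URep m' j' x')"
    using assms(2-6) by (simp add: \<rho>_eq_iff colim_eq_iff_amalg[OF H])
  then obtain M p q where "p \<in> inj_maps m M" "q \<in> inj_maps m' M" "map ((!) p) j = map ((!) q) j'"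
    "fmap H M (J p) x = fmap H M (J q) x'"
    by (auto simp: amalg_def)
  then show ?thesis using push assms(2-5) by metis
qed

lemma int_le_descend:
  assumes H: "is_func \<Sigma> H"
    and "j \<in> inj_maps n m" "j' \<in> inj_maps n m'" "x \<in> Car (fob H m)" "x' \<in> Car (fob H m')"
    and "(\<rho> H n m j x, \<rho> H n m' j' x') \<in> Le (int_ob H n)"
    and push: "\<And>m j k m' x. j \<in> inj_maps n m \<Longrightarrow> k \<in> inj_maps m m' \<Longrightarrow> x \<in> Car (fob H m) \<Longrightarrow>
      \<phi> m' (map ((!) k) j) (fmap H m' (J k) x) = \<phi> m j x"
    and le: "\<And>m j x y. j \<in> inj_maps n m \<Longrightarrow> (x, y) \<in> Le (fob H m) \<Longrightarrow> (\<phi> m j x, \<phi> m j y) \<in> r"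
  shows "(\<phi> m j x, \<phi> m' j' x') \<in> r"
proof -
  have "amalg H (\<lambda>n x y. (x, y) \<in> Le (fob H n)) n (URep m j x) (URep m' j' x')"
    using assms(2-6) by (simp add: int_Le_iff colim_le_iff_amalg[OF H])
  then obtain M p q where pq: "p \<in> inj_maps m M" "q \<in> inj_maps m' M" "map ((!) p) j = map ((!) q) j'"
    "(fmap H M (J p) x, fmap H M (J q) x') \<in> Le (fob H M)"
    by (auto simp: amalg_def)
  have "(\<phi> M (map ((!) p) j) (fmap H M (J p) x), \<phi> M (map ((!) p) j) (fmap H M (J q) x')) \<in> r"
    by (rule le[OF inj_maps_comp[OF assms(2) pq(1)] pq(4)])
  then show ?thesis
    using push[OF assms(2) pq(1) assms(4)] push[OF assms(3) pq(2) assms(5)] pq(3) by simp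
qed

text \<open>The extension of an arrow by fresh variables refers to canonical injections, so the legs
  of a cospan have to fix the first \<open>m\<close> variables. An arbitrary cospan is brought into
  this shape by relabelling its apex.\<close>

lemma amalg_canonical:
  assumes H: "is_func \<Sigma> H" and r: "stable_rel \<Sigma> H r"
    and am: "amalg H r m (URep (m + k) [0..<m] x) (URep (m + l) [0..<m] y)"
  obtains N p q where "p \<in> inj_maps (m + k) (m + N)" "q \<in> inj_maps (m + l) (m + N)"
    "take m p = [0..<m]" "take m q = [0..<m]"
    "r (m + N) (fmap H (m + N) (J p) x) (fmap H (m + N) (J q) y)"
proof -
  from am obtain M p q where *: "x \<in> Car (fob H (m + k))" "y \<in> Car (fob H (m + l))"
    "p \<in> inj_maps (m + k) M" "q \<in> inj_maps (m + l) M"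
    "map ((!) p) [0..<m] = map ((!) q) [0..<m]" "r M (fmap H M (J p) x) (fmap H M (J q) y)"
    by (auto simp: amalg_def)
  have "take m s = map ((!) s) [0..<m]" if "length s = m + i" for s :: "nat list" and i
    using that by (intro nth_equalityI) auto
  then have tk: "take m p = map ((!) p) [0..<m]" "take m q = map ((!) p) [0..<m]"
    using inj_maps_length[OF *(3)] inj_maps_length[OF *(4)] *(5) by metis+
  have w: "map ((!) p) [0..<m] \<in> inj_maps m M"
    by (rule inj_maps_comp[OF upt_inj_maps *(3)]) simp
  \<comment> \<open>\<open>p\<close> and \<open>q\<close> agree on the first \<open>m\<close>
    variables; \<open>e\<close> moves their common image back to the initial segment.\<close>
  obtain e where e: "e \<in> inj_maps M (m + M + 0)" "map ((!) e) (map ((!) p) [0..<m]) = [0..<m]"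
    using inj_extend[OF w upt_inj_maps[of m m]] by blast
  have e': "e \<in> inj_maps M (m + M)" using e(1) by simp
  show thesis
  proof (rule that[of "map ((!) e) p" M "map ((!) e) q"])
    show "map ((!) e) p \<in> inj_maps (m + k) (m + M)" "map ((!) e) q \<in> inj_maps (m + l) (m + M)"
      using inj_maps_comp[OF *(3) e'] inj_maps_comp[OF *(4) e'] by auto
    show "take m (map ((!) e) p) = [0..<m]" "take m (map ((!) e) q) = [0..<m]"
      unfolding take_map tk by (rule e(2))+
    show "r (m + M) (fmap H (m + M) (J (map ((!) e) p)) x) (fmap H (m + M) (J (map ((!) e) q)) y)"
      using stable_relD(3)[OF r J_inj_in_L[OF e'] is_funcD(7)[OF H *(3,1)] is_funcD(7)[OF H *(4,2)] *(6)]
      by (simp add: is_funcD(8)[OF H *(3) e' *(1)] is_funcD(8)[OF H *(4) e' *(2)])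
  qed
qed

text \<open>\<open>p\<close> moves only the fresh variables and \<open>f\<close> instantiates only
  the first \<open>m\<close>, so the two commute once \<open>p\<close> is copied to the fresh
  variables of the context \<open>n\<close>. The copy \<open>q\<close> is then absorbed by the
  colimit.\<close>

lemma \<rho>_ext_push:
  assumes H: "is_func \<Sigma> H" and f: "f \<in> L \<Sigma> n m" and x: "x \<in> Car (fob H (m + k))"
    and p: "p \<in> inj_maps (m + k) (m + N)" and tk: "take m p = [0..<m]"
  shows "\<rho> H n (n + N) [0..<n] (fmap H (n + N) (f @ map Var [n..<n + N]) (fmap H (m + N) (J p) x)) =
    \<rho> H n (n + k) [0..<n] (fmap H (n + k) (f @ map Var [n..<n + k]) x)"
proof -
  have [simp]: "length p = m + k" "length f = m" using p f by (auto simp: inj_maps_length L_length)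
  have plo: "p ! i = i" if "i < m" for i
    using that tk by (metis add.left_neutral nth_take nth_upt)
  \<comment> \<open>A fresh position cannot be sent below \<open>m\<close>: that value is already
    taken by the position that \<open>p\<close> fixes.\<close>
  have phi: "m \<le> p ! i \<and> p ! i < m + N" if "m \<le> i" "i < m + k" for i
  proof -
    have "p ! i \<noteq> p ! (p ! i)" if "p ! i < m"
      using plo[OF that] p \<open>m \<le> i\<close> \<open>i < m + k\<close> that
        nth_eq_iff_index_eq[of p i "p ! i"] by (auto simp: inj_maps_def)
    then show ?thesis using plo[of "p ! i"] inj_maps_nth[OF p that(2)] by (cases "p ! i < m") auto
  qed
  \<comment> \<open>The fresh variable \<open>n + u\<close> is moved as \<open>p\<close> moves
    \<open>m + u\<close>. Subtracting \<open>m\<close> is exact, since by \<open>phi\<close> the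
    value of \<open>p\<close> is at least \<open>m\<close> there.\<close>
  define \<phi> where "\<phi> i = (if i < n then i else n + p ! (m + (i - n)) - m)" for i
  define q where "q = map \<phi> [0..<n + k]"
  have q: "q \<in> inj_maps (n + k) (n + N)" unfolding q_def
  proof (rule map_inj_maps)
    have lt: "n \<le> \<phi> i \<and> \<phi> i < n + N" if "n \<le> i" "i < n + k" for i
    proof -
      have "m + (i - n) < m + k" using that by simp
      from phi[OF le_add1 this] show ?thesis using that by (auto simp: \<phi>_def)
    qed
    then show "\<phi> ` {..<n + k} \<subseteq> {..<n + N}" by (force simp: \<phi>_def)
    show "inj_on \<phi> {..<n + k}"
    proof (rule inj_onI)
      fix i i' assume i: "i \<in> {..<n + k}" "i' \<in> {..<n + k}" "\<phi> i = \<phi> i'"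
      have lo: "\<phi> i = i" if "i < n" for i using that by (simp add: \<phi>_def)
      have "i = i'" if ii: "n \<le> i" "n \<le> i'"
      proof -
        have "m + (i - n) < m + k" "m + (i' - n) < m + k" using i ii by auto
        note ph = this[THEN phi[OF le_add1]]
        have cancel: "a = b" if "n + a - m = n + b - m" "m \<le> a" "m \<le> b" for a b :: nat
          using that by arith
        have "p ! (m + (i - n)) = p ! (m + (i' - n))"
          by (rule cancel) (use i(3) ii ph in \<open>simp_all add: \<phi>_def\<close>)
        moreover have "distinct p" using p by (simp add: inj_maps_def)
        moreover have "m + (i - n) < length p" "m + (i' - n) < length p" using i ii by auto
        ultimately have "m + (i - n) = m + (i' - n)" by (metis nth_eq_iff_index_eq)
        then show ?thesis using ii by simp
      qed
      moreover have "v < n \<longleftrightarrow> \<phi> v < n" if "v < n + k" for v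
        using lo[of v] lt[OF _ that] by (cases "v < n") auto
      then have "i < n \<longleftrightarrow> i' < n" using i by (simp only: lessThan_iff)
      moreover have "i = i'" if "i < n" "i' < n"
        using i(3) unfolding lo[OF that(1)] lo[OF that(2)] .
      ultimately show "i = i'" by (meson not_le)
    qed
  qed
  have "lcomp (J p) (f @ map Var [n..<n + N]) = lcomp (f @ map Var [n..<n + k]) (J q)"
  proof (rule nth_equalityI)
    fix i assume "i < length (lcomp (J p) (f @ map Var [n..<n + N]))"
    then have i: "i < m + k" by simp
    show "lcomp (J p) (f @ map Var [n..<n + N]) ! i = lcomp (f @ map Var [n..<n + k]) (J q) ! i"
    proof (cases "i < m")
      case True
      then have "tvars (f ! i) \<subseteq> {..<n}" using f by (auto simp: L_iff)
      then have "tsubst (tuple_subst (J q)) (f ! i) = tsubst Var (f ! i)"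
        by (intro tsubst_cong) (auto simp: tuple_subst_def q_def \<phi>_def)
      then show ?thesis using True i by (simp add: nth_lcomp plo tuple_subst_def nth_append)
    next
      case False
      then show ?thesis using i phi[of i]
        by (auto simp: nth_lcomp tuple_subst_def nth_append q_def \<phi>_def)
    qed
  qed simp
  then have "fmap H (n + N) (f @ map Var [n..<n + N]) (fmap H (m + N) (J p) x) =
      fmap H (n + N) (J q) (fmap H (n + k) (f @ map Var [n..<n + k]) x)"
    using is_funcD(6)[OF H ext_in_L[OF f] J_inj_in_L[OF p] x]
      is_funcD(6)[OF H J_inj_in_L[OF q] ext_in_L[OF f] x] by simp
  moreover have "map ((!) q) [0..<n] = [0..<n]"
    by (rule map_idI) (auto simp: q_def \<phi>_def)
  ultimately show ?thesis
    using \<rho>_push[OF upt_inj_maps q is_funcD(3)[OF H ext_in_L[OF f] x], of n] by simp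
qed

text \<open>Shows that the description in \<open>int_map\<close> is definite: two canonical
  representatives of one element meet along legs that fix the first \<open>m\<close> variables, and
  \<open>\<rho>_ext_push\<close> applies to both legs.\<close>

lemma int_map_\<rho>:
  assumes H: "is_func \<Sigma> H" and f: "f \<in> L \<Sigma> n m" and x: "x \<in> Car (fob H (m + k))"
  shows "int_map H n f (\<rho> H m (m + k) [0..<m] x) =
    \<rho> H n (n + k) [0..<n] (fmap H (n + k) (f @ map Var [n..<n + k]) x)"
proof -
  have [simp]: "length f = m" using f by (rule L_length)
  have *: "\<rho> H n (n + l) [0..<n] (fmap H (n + l) (f @ map Var [n..<n + l]) y) =
      \<rho> H n (n + k) [0..<n] (fmap H (n + k) (f @ map Var [n..<n + k]) x)"
    if y: "y \<in> Car (fob H (m + l))" and eq: "\<rho> H m (m + k) [0..<m] x = \<rho> H m (m + l) [0..<m] y"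
    for l y
  proof -
    have up: "[0..<m] \<in> inj_maps m (m + k)" "[0..<m] \<in> inj_maps m (m + l)"
      by (auto intro: upt_inj_maps)
    have "amalg H (\<lambda>n. (=)) m (URep (m + k) [0..<m] x) (URep (m + l) [0..<m] y)"
      using eq by (simp add: \<rho>_eq_iff[OF up x y] colim_eq_iff_amalg[OF H])
    then obtain N p q where pq: "p \<in> inj_maps (m + k) (m + N)" "q \<in> inj_maps (m + l) (m + N)"
      "take m p = [0..<m]" "take m q = [0..<m]"
      "fmap H (m + N) (J p) x = fmap H (m + N) (J q) y"
      by (rule amalg_canonical[OF H stable_rel_eq])
    then show ?thesis
      using \<rho>_ext_push[OF H f x pq(1,3)] \<rho>_ext_push[OF H f y pq(2,4)] by simp
  qed
  show ?thesis
    unfolding int_map_def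
  proof (rule the_equality)
    show "\<exists>l y. y \<in> Car (fob H (length f + l)) \<and>
        \<rho> H m (m + k) [0..<m] x = \<rho> H (length f) (length f + l) [0..<length f] y \<and>
        \<rho> H n (n + k) [0..<n] (fmap H (n + k) (f @ map Var [n..<n + k]) x) =
        \<rho> H n (n + l) [0..<n] (fmap H (n + l) (f @ map Var [n..<n + l]) y)"
      by (rule exI[of _ k], rule exI[of _ x]) (simp add: x)
  next
    fix b
    assume "\<exists>l y. y \<in> Car (fob H (length f + l)) \<and>
        \<rho> H m (m + k) [0..<m] x = \<rho> H (length f) (length f + l) [0..<length f] y \<and>
        b = \<rho> H n (n + l) [0..<n] (fmap H (n + l) (f @ map Var [n..<n + l]) y)"
    then obtain l y where "y \<in> Car (fob H (m + l))" "\<rho> H m (m + k) [0..<m] x = \<rho> H m (m + l) [0..<m] y"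
      "b = \<rho> H n (n + l) [0..<n] (fmap H (n + l) (f @ map Var [n..<n + l]) y)"
      by auto
    with * show "b = \<rho> H n (n + k) [0..<n] (fmap H (n + k) (f @ map Var [n..<n + k]) x)" by simp
  qed
qed

lemma int_map_in:
  assumes H: "is_func \<Sigma> H" and f: "f \<in> L \<Sigma> n m" and a: "a \<in> Car (int_ob H m)"
  shows "int_map H n f a \<in> Car (int_ob H n)"
proof -
  obtain k x where x: "x \<in> Car (fob H (m + k))" "a = \<rho> H m (m + k) [0..<m] x"
    using int_cases[OF H a] by metis
  show ?thesis
    unfolding x(2) int_map_\<rho>[OF H f x(1)]
    by (intro \<rho>_in_int upt_inj_maps is_funcD(3)[OF H ext_in_L[OF f] x(1)]) simp
qed

lemma int_map_mono:
  assumes H: "is_func \<Sigma> H" and f: "f \<in> L \<Sigma> n m" and ab: "(a, b) \<in> Le (int_ob H m)"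
  shows "(int_map H n f a, int_map H n f b) \<in> Le (int_ob H n)"
proof -
  have "a \<in> Car (int_ob H m)" "b \<in> Car (int_ob H m)" using ab by (auto simp: int_ob_def Let_def)
  then obtain k x l y where x: "x \<in> Car (fob H (m + k))" "a = \<rho> H m (m + k) [0..<m] x"
    and y: "y \<in> Car (fob H (m + l))" "b = \<rho> H m (m + l) [0..<m] y"
    using int_cases[OF H] by metis
  have up: "[0..<m] \<in> inj_maps m (m + k)" "[0..<m] \<in> inj_maps m (m + l)"
    by (auto intro: upt_inj_maps)
  have "amalg H (\<lambda>n x y. (x, y) \<in> Le (fob H n)) m (URep (m + k) [0..<m] x) (URep (m + l) [0..<m] y)"
    using ab unfolding x y by (simp add: int_Le_iff[OF up x(1) y(1)] colim_le_iff_amalg[OF H])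
  then obtain N p q where pq: "p \<in> inj_maps (m + k) (m + N)" "q \<in> inj_maps (m + l) (m + N)"
      "take m p = [0..<m]" "take m q = [0..<m]"
      "(fmap H (m + N) (J p) x, fmap H (m + N) (J q) y) \<in> Le (fob H (m + N))"
    by (rule amalg_canonical[OF H stable_rel_Le[OF H]])
  have "[0..<n] \<in> inj_maps n (n + N)" by (rule upt_inj_maps) simp
  from \<rho>_mono[OF H this is_funcD(4)[OF H ext_in_L[OF f] pq(5)]]
  show ?thesis
    unfolding x(2) y(2) int_map_\<rho>[OF H f x(1)] int_map_\<rho>[OF H f y(1)]
    by (simp add: \<rho>_ext_push[OF H f x(1) pq(1,3)] \<rho>_ext_push[OF H f y(1) pq(2,4)])
qed

lemma int_ob_preorder:
  assumes H: "is_func \<Sigma> H"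
  shows "preorder_on (Car (int_ob H n)) (Le (int_ob H n))"
proof (rule preorder_onI)
  fix x assume x: "x \<in> Car (int_ob H n)"
  then obtain k y where "y \<in> Car (fob H (n + k))" "x = \<rho> H n (n + k) [0..<n] y"
    using int_cases[OF H x] by metis
  then show "(x, x) \<in> Le (int_ob H n)"
    by (auto intro!: \<rho>_mono[OF H upt_inj_maps] preorder_onD(3)[OF is_funcD(1)[OF H]])
qed (auto simp: int_ob_def Let_def intro: colim_le.trans)

lemma is_func_Integral:
  assumes H: "is_func \<Sigma> H"
  shows "is_func \<Sigma> (Integral H)"
  unfolding is_func_def Integral_def func.simps
proof (intro conjI allI ballI)
  fix n show "preorder_on (Car (int_ob H n)) (Le (int_ob H n))" by (rule int_ob_preorder[OF H])
next
  fix n m f assume "f \<in> L \<Sigma> n m"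
  then show "int_map H n f \<in> monotone_maps (int_ob H m) (int_ob H n)"
    by (intro monotone_mapsI int_map_in[OF H] int_map_mono[OF H])
next
  fix n x assume "x \<in> Car (int_ob H n)"
  then obtain k y where y: "y \<in> Car (fob H (n + k))" "x = \<rho> H n (n + k) [0..<n] y"
    using int_cases[OF H] by metis
  show "int_map H n (map Var [0..<n]) x = x"
    unfolding y(2) int_map_\<rho>[OF H id_in_L y(1)] id_ext is_funcD(5)[OF H y(1)] ..
next
  fix n m k f g x assume f: "f \<in> L \<Sigma> n m" and g: "g \<in> L \<Sigma> m k" and "x \<in> Car (int_ob H k)"
  then obtain l y where y: "y \<in> Car (fob H (k + l))" "x = \<rho> H k (k + l) [0..<k] y"
    using int_cases[OF H] by metis
  show "int_map H n (lcomp g f) x = int_map H n f (int_map H m g x)"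
    unfolding y(2) int_map_\<rho>[OF H g y(1)] int_map_\<rho>[OF H lcomp_in_L[OF f g] y(1)]
      int_map_\<rho>[OF H f is_funcD(3)[OF H ext_in_L[OF g] y(1)]]
      is_funcD(6)[OF H ext_in_L[OF f] ext_in_L[OF g] y(1)] lcomp_ext[OF f g] ..
qed

lemma fob_Integral [simp]: "fob (Integral H) = int_ob H"
  by (simp add: Integral_def)


section \<open>The category of lax transformations\<close>

text \<open>The conditions of \<open>is_lax\<close> on bare components. Families need not be
  extensional here, so they can be written as plain functions; \<open>lax_of\<close> restricts them
  afterwards.\<close>

definition lax_family ::
    "('f \<times> nat) set \<Rightarrow> ('f, 'a) func \<Rightarrow> ('f, 'a) func \<Rightarrow> (nat \<Rightarrow> 'a \<Rightarrow> 'a) \<Rightarrow> bool" where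
  "lax_family \<Sigma> H K g \<longleftrightarrow>
     (\<forall>n. g n \<in> monotone_maps (fob H n) (fob K n)) \<and>
     (\<forall>n m. \<forall>f\<in>L \<Sigma> n m. \<forall>x\<in>Car (fob H m). (fmap K n f (g m x), g n (fmap H n f x)) \<in> Le (fob K n)) \<and>
     (\<forall>n m. \<forall>i\<in>inj_maps n m. \<forall>x\<in>Car (fob H n). fmap K m (J i) (g n x) = g m (fmap H m (J i) x))"

lemma lax_familyD:
  assumes "lax_family \<Sigma> H K g"
  shows "g n \<in> monotone_maps (fob H n) (fob K n)"
    "x \<in> Car (fob H n) \<Longrightarrow> g n x \<in> Car (fob K n)"
    "(x, y) \<in> Le (fob H n) \<Longrightarrow> (g n x, g n y) \<in> Le (fob K n)"
    "f \<in> L \<Sigma> n m \<Longrightarrow> z \<in> Car (fob H m) \<Longrightarrow> (fmap K n f (g m z), g n (fmap H n f z)) \<in> Le (fob K n)"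
    "i \<in> inj_maps n m \<Longrightarrow> x \<in> Car (fob H n) \<Longrightarrow> fmap K m (J i) (g n x) = g m (fmap H m (J i) x)"
proof -
  show *: "g n \<in> monotone_maps (fob H n) (fob K n)" for n
    using assms by (simp add: lax_family_def)
  show "x \<in> Car (fob H n) \<Longrightarrow> g n x \<in> Car (fob K n)"
    "(x, y) \<in> Le (fob H n) \<Longrightarrow> (g n x, g n y) \<in> Le (fob K n)"
    using monotone_mapsD[OF *] by blast+
qed (use assms in \<open>simp_all add: lax_family_def\<close>)

lemma lax_familyI:
  assumes "\<And>n x. x \<in> Car (fob H n) \<Longrightarrow> g n x \<in> Car (fob K n)"
    "\<And>n x y. (x, y) \<in> Le (fob H n) \<Longrightarrow> (g n x, g n y) \<in> Le (fob K n)"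
    "\<And>n m f x. f \<in> L \<Sigma> n m \<Longrightarrow> x \<in> Car (fob H m) \<Longrightarrow> (fmap K n f (g m x), g n (fmap H n f x)) \<in> Le (fob K n)"
    "\<And>n m i x. i \<in> inj_maps n m \<Longrightarrow> x \<in> Car (fob H n) \<Longrightarrow> fmap K m (J i) (g n x) = g m (fmap H m (J i) x)"
  shows "lax_family \<Sigma> H K g"
  using assms unfolding lax_family_def by (auto intro: monotone_mapsI)

text \<open>Equality of the two sides gives the lax inequality by reflexivity, and it covers the
  injections because \<open>J i\<close> is an arrow of \<open>L\<close>.\<close>

lemma lax_family_strictI:
  assumes K: "is_func \<Sigma> K"
    and "\<And>n x. x \<in> Car (fob H n) \<Longrightarrow> g n x \<in> Car (fob K n)"
    "\<And>n x y. (x, y) \<in> Le (fob H n) \<Longrightarrow> (g n x, g n y) \<in> Le (fob K n)"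
    "\<And>n m f x. f \<in> L \<Sigma> n m \<Longrightarrow> x \<in> Car (fob H m) \<Longrightarrow> fmap K n f (g m x) = g n (fmap H n f x)"
  shows "lax_family \<Sigma> H K g"
proof (rule lax_familyI)
  fix n m f x assume *: "f \<in> L \<Sigma> n m" "x \<in> Car (fob H m)"
  then have "fmap K n f (g m x) \<in> Car (fob K n)" using is_funcD(3)[OF K] assms(2) by blast
  then show "(fmap K n f (g m x), g n (fmap H n f x)) \<in> Le (fob K n)"
    using assms(4)[OF *] preorder_onD(3)[OF is_funcD(1)[OF K]] by metis
qed (use assms J_inj_in_L in blast)+

abbreviation lax_of :: "('f, 'a) func \<Rightarrow> ('f, 'a) func \<Rightarrow> (nat \<Rightarrow> 'a \<Rightarrow> 'a) \<Rightarrow> ('f, 'a) lax" where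
  "lax_of H K g \<equiv> \<lparr>src = H, trg = K, cmpt = (\<lambda>n. restrict (g n) (Car (fob H n)))\<rparr>"

lemma lax_family_cong:
  assumes "lax_family \<Sigma> H K g" "is_func \<Sigma> H" "\<And>n x. x \<in> Car (fob H n) \<Longrightarrow> g n x = g' n x"
  shows "lax_family \<Sigma> H K g'"
proof (rule lax_familyI)
  fix n x y assume "(x, y) \<in> Le (fob H n)"
  then show "(g' n x, g' n y) \<in> Le (fob K n)"
    using lax_familyD(3)[OF assms(1)] assms(3) preorder_onD(1,2)[OF is_funcD(1)[OF assms(2)]] by metis
next
  fix n m f x assume "f \<in> L \<Sigma> n m" "x \<in> Car (fob H m)"
  then show "(fmap K n f (g' m x), g' n (fmap H n f x)) \<in> Le (fob K n)"
    using lax_familyD(4)[OF assms(1)] assms(3) is_funcD(3)[OF assms(2)] by metis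
next
  fix n m i x assume "i \<in> inj_maps n m" "x \<in> Car (fob H n)"
  then show "fmap K m (J i) (g' n x) = g' m (fmap H m (J i) x)"
    using lax_familyD(5)[OF assms(1)] assms(3) is_funcD(7)[OF assms(2)] by metis
qed (use lax_familyD(2)[OF assms(1)] assms(3) in metis)

lemma is_lax_iff:
  "is_lax \<Sigma> \<alpha> \<longleftrightarrow> is_func \<Sigma> (src \<alpha>) \<and> is_func \<Sigma> (trg \<alpha>) \<and>
     (\<forall>n. cmpt \<alpha> n \<in> extensional (Car (fob (src \<alpha>) n))) \<and> lax_family \<Sigma> (src \<alpha>) (trg \<alpha>) (cmpt \<alpha>)"
  unfolding is_lax_def lax_family_def by auto

lemma is_lax_lax_of:
  assumes "is_func \<Sigma> H" "is_func \<Sigma> K" "lax_family \<Sigma> H K g"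
  shows "is_lax \<Sigma> (lax_of H K g)"
  using assms lax_family_cong[OF assms(3,1), of "\<lambda>n. restrict (g n) (Car (fob H n))"]
  by (simp add: is_lax_iff)

section \<open>Arrows, composition and identities\<close>

lemma Lax_Inj_simps [simp]:
  "Ob (Lax_Inj \<Sigma>) = {H. is_func \<Sigma> H}" "Ar (Lax_Inj \<Sigma>) = {\<alpha>. is_lax \<Sigma> \<alpha>}"
  "Dom (Lax_Inj \<Sigma>) = src" "Cod (Lax_Inj \<Sigma>) = trg"
  by (simp_all add: Lax_Inj_def)

lemma Lax_Inj_Ide_Cmp:
  "Ide (Lax_Inj \<Sigma>) H = lax_of H H (\<lambda>n. id)"
  "Cmp (Lax_Inj \<Sigma>) \<beta> \<alpha> = lax_of (src \<alpha>) (trg \<beta>) (\<lambda>n. cmpt \<beta> n \<circ> cmpt \<alpha> n)"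
  by (simp_all add: Lax_Inj_def)

lemma hom_Lax_Inj: "\<alpha> \<in> hom (Lax_Inj \<Sigma>) H K \<longleftrightarrow> is_lax \<Sigma> \<alpha> \<and> src \<alpha> = H \<and> trg \<alpha> = K"
  by (auto simp: hom_def)

lemma hom_LaxD:
  assumes "\<alpha> \<in> hom (Lax_Inj \<Sigma>) H K"
  shows "is_func \<Sigma> H" "is_func \<Sigma> K" "src \<alpha> = H" "trg \<alpha> = K" "lax_family \<Sigma> H K (cmpt \<alpha>)"
    "cmpt \<alpha> n \<in> extensional (Car (fob H n))"
  using assms by (auto simp: hom_Lax_Inj is_lax_iff)

lemma lax_of_hom:
  assumes "is_func \<Sigma> H" "is_func \<Sigma> K" "lax_family \<Sigma> H K g"
  shows "lax_of H K g \<in> hom (Lax_Inj \<Sigma>) H K"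
  using is_lax_lax_of[OF assms] by (simp add: hom_Lax_Inj)

lemma lax_eqI:
  assumes "\<alpha> \<in> hom (Lax_Inj \<Sigma>) H K" "\<beta> \<in> hom (Lax_Inj \<Sigma>) H K"
    "\<And>n x. x \<in> Car (fob H n) \<Longrightarrow> cmpt \<alpha> n x = cmpt \<beta> n x"
  shows "\<alpha> = \<beta>"
proof -
  have "cmpt \<alpha> n = cmpt \<beta> n" for n
    by (rule extensionalityI[OF hom_LaxD(6)[OF assms(1)] hom_LaxD(6)[OF assms(2)] assms(3)])
  then have "cmpt \<alpha> = cmpt \<beta>" by blast
  then show ?thesis using hom_LaxD(3,4)[OF assms(1)] hom_LaxD(3,4)[OF assms(2)] by simp
qed

lemma cmpt_Cmp:
  assumes "\<alpha> \<in> hom (Lax_Inj \<Sigma>) H K" "x \<in> Car (fob H n)"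
  shows "cmpt (Cmp (Lax_Inj \<Sigma>) \<beta> \<alpha>) n x = cmpt \<beta> n (cmpt \<alpha> n x)"
  using assms by (simp add: hom_LaxD Lax_Inj_Ide_Cmp)

lemma cmpt_Ide: "x \<in> Car (fob H n) \<Longrightarrow> cmpt (Ide (Lax_Inj \<Sigma>) H) n x = x"
  by (simp add: Lax_Inj_Ide_Cmp)

text \<open>The two lax squares paste: that of \<open>h\<close> is used as it stands, that of
  \<open>g\<close> after applying the monotone \<open>h\<close>.\<close>

lemma lax_family_comp:
  assumes M: "is_func \<Sigma> M" and g: "lax_family \<Sigma> H K g" and h: "lax_family \<Sigma> K M h" and H: "is_func \<Sigma> H"
  shows "lax_family \<Sigma> H M (\<lambda>n. h n \<circ> g n)"
proof (rule lax_familyI)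
  fix n m f x assume f: "f \<in> L \<Sigma> n m" and x: "x \<in> Car (fob H m)"
  have "(fmap M n f (h m (g m x)), h n (fmap K n f (g m x))) \<in> Le (fob M n)"
    by (rule lax_familyD(4)[OF h f lax_familyD(2)[OF g x]])
  moreover have "(h n (fmap K n f (g m x)), h n (g n (fmap H n f x))) \<in> Le (fob M n)"
    by (rule lax_familyD(3)[OF h lax_familyD(4)[OF g f x]])
  ultimately show "(fmap M n f ((h m \<circ> g m) x), (h n \<circ> g n) (fmap H n f x)) \<in> Le (fob M n)"
    using preorder_onD(4)[OF is_funcD(1)[OF M]] by simp
next
  fix n m i x assume i: "i \<in> inj_maps n m" and x: "x \<in> Car (fob H n)"
  show "fmap M m (J i) ((h n \<circ> g n) x) = (h m \<circ> g m) (fmap H m (J i) x)"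
    by (simp add: lax_familyD(5)[OF g i x] lax_familyD(5)[OF h i lax_familyD(2)[OF g x]])
qed (simp_all add: lax_familyD[OF g] lax_familyD[OF h])

lemma Cmp_hom:
  assumes a: "\<alpha> \<in> hom (Lax_Inj \<Sigma>) H K" and b: "\<beta> \<in> hom (Lax_Inj \<Sigma>) K M"
  shows "Cmp (Lax_Inj \<Sigma>) \<beta> \<alpha> \<in> hom (Lax_Inj \<Sigma>) H M"
  using lax_of_hom[OF hom_LaxD(1)[OF a] hom_LaxD(2)[OF b]
      lax_family_comp[OF hom_LaxD(2)[OF b] hom_LaxD(5)[OF a] hom_LaxD(5)[OF b] hom_LaxD(1)[OF a]]]
  by (simp add: hom_LaxD[OF a] hom_LaxD[OF b] Lax_Inj_Ide_Cmp)

lemma Ide_hom: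
  assumes "is_func \<Sigma> H"
  shows "Ide (Lax_Inj \<Sigma>) H \<in> hom (Lax_Inj \<Sigma>) H H"
  unfolding Lax_Inj_Ide_Cmp
  by (intro lax_of_hom lax_family_strictI assms) (auto simp: is_funcD[OF assms])

lemma is_category_Lax_Inj: "is_category (Lax_Inj \<Sigma>)"
  unfolding is_category_def
proof (intro conjI allI impI ballI)
  fix f assume "f \<in> Ar (Lax_Inj \<Sigma>)"
  then show "Dom (Lax_Inj \<Sigma>) f \<in> Ob (Lax_Inj \<Sigma>)" "Cod (Lax_Inj \<Sigma>) f \<in> Ob (Lax_Inj \<Sigma>)"
    by (auto simp: is_lax_iff)
next
  fix x assume "x \<in> Ob (Lax_Inj \<Sigma>)"
  then show "Ide (Lax_Inj \<Sigma>) x \<in> hom (Lax_Inj \<Sigma>) x x" by (intro Ide_hom) simp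
next
  fix x y z f g assume "f \<in> hom (Lax_Inj \<Sigma>) x y" "g \<in> hom (Lax_Inj \<Sigma>) y z"
  then show "Cmp (Lax_Inj \<Sigma>) g f \<in> hom (Lax_Inj \<Sigma>) x z" by (rule Cmp_hom)
next
  fix x y f assume f: "f \<in> hom (Lax_Inj \<Sigma>) x y"
  note i = Ide_hom[OF hom_LaxD(1)[OF f]] Ide_hom[OF hom_LaxD(2)[OF f]]
  show "Cmp (Lax_Inj \<Sigma>) f (Ide (Lax_Inj \<Sigma>) x) = f"
    by (rule lax_eqI[OF Cmp_hom[OF i(1) f] f], subst cmpt_Cmp[OF i(1)]) (auto simp: cmpt_Ide)
  show "Cmp (Lax_Inj \<Sigma>) (Ide (Lax_Inj \<Sigma>) y) f = f"
    by (rule lax_eqI[OF Cmp_hom[OF f i(2)] f], subst cmpt_Cmp[OF f])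
      (auto simp: cmpt_Ide lax_familyD(2)[OF hom_LaxD(5)[OF f]])
next
  fix w x y z f g h
  assume f: "f \<in> hom (Lax_Inj \<Sigma>) w x" and g: "g \<in> hom (Lax_Inj \<Sigma>) x y" and h: "h \<in> hom (Lax_Inj \<Sigma>) y z"
  show "Cmp (Lax_Inj \<Sigma>) h (Cmp (Lax_Inj \<Sigma>) g f) = Cmp (Lax_Inj \<Sigma>) (Cmp (Lax_Inj \<Sigma>) h g) f"
  proof (rule lax_eqI[OF Cmp_hom[OF Cmp_hom[OF f g] h] Cmp_hom[OF f Cmp_hom[OF g h]]])
    fix n a assume a: "a \<in> Car (fob w n)"
    show "cmpt (Cmp (Lax_Inj \<Sigma>) h (Cmp (Lax_Inj \<Sigma>) g f)) n a =
        cmpt (Cmp (Lax_Inj \<Sigma>) (Cmp (Lax_Inj \<Sigma>) h g) f) n a"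
      using a lax_familyD(2)[OF hom_LaxD(5)[OF f] a]
      by (simp only: cmpt_Cmp[OF Cmp_hom[OF f g]] cmpt_Cmp[OF f] cmpt_Cmp[OF g])
  qed
qed

text \<open>Strictness of \<open>\<alpha>\<close> along injections is exactly the cocone condition
  \<open>push\<close>, which makes the description in \<open>int_comp\<close> definite. The formula
  is obtained for every \<open>j\<close>, not just for canonical injections.\<close>

lemma int_comp_\<rho>_lax:
  assumes a: "\<alpha> \<in> hom (Lax_Inj \<Sigma>) H K" and j: "j \<in> inj_maps n m" and x: "x \<in> Car (fob H m)"
  shows "int_comp \<alpha> n (\<rho> H n m j x) = \<rho> K n m j (cmpt \<alpha> m x)"
proof -
  note H = hom_LaxD(1)[OF a] and K = hom_LaxD(2)[OF a] and st = hom_LaxD(3,4)[OF a]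
    and fam = hom_LaxD(5)[OF a]
  have push: "\<rho> K n m' (map ((!) k) j) (cmpt \<alpha> m' (fmap H m' (J k) x)) = \<rho> K n m j (cmpt \<alpha> m x)"
    if "j \<in> inj_maps n m" "k \<in> inj_maps m m'" "x \<in> Car (fob H m)" for m j k m' x
    using \<rho>_push[OF that(1,2) lax_familyD(2)[OF fam that(3)]] lax_familyD(5)[OF fam that(2,3)] by simp
  have up: "[0..<n] \<in> inj_maps n (n + l)" for l by (rule upt_inj_maps) simp
  show ?thesis
    unfolding int_comp_def st
  proof (rule the_equality)
    obtain k where k: "k \<in> inj_maps m (n + m + 1)" "map ((!) k) j = [0..<n]"
      "\<rho> H n m j x = \<rho> H n (n + (m + 1)) [0..<n] (fmap H (n + (m + 1)) (J k) x)"
      using \<rho>_canonical[OF H j x] by blast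
    have "\<rho> K n m j (cmpt \<alpha> m x) = \<rho> K n (n + (m + 1)) [0..<n] (cmpt \<alpha> (n + (m + 1)) (fmap H (n + (m + 1)) (J k) x))"
      using push[OF j k(1) x] k(2) by (simp add: add.assoc)
    then show "\<exists>k y. y \<in> Car (fob H (n + k)) \<and> \<rho> H n m j x = \<rho> H n (n + k) [0..<n] y \<and>
        \<rho> K n m j (cmpt \<alpha> m x) = \<rho> K n (n + k) [0..<n] (cmpt \<alpha> (n + k) y)"
      using k(3) is_funcD(7)[OF H k(1) x] by (auto simp: add.assoc intro!: exI[of _ "m + 1"])
  next
    fix b assume "\<exists>k y. y \<in> Car (fob H (n + k)) \<and> \<rho> H n m j x = \<rho> H n (n + k) [0..<n] y \<and>
        b = \<rho> K n (n + k) [0..<n] (cmpt \<alpha> (n + k) y)"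
    then obtain k y where y: "y \<in> Car (fob H (n + k))" "\<rho> H n m j x = \<rho> H n (n + k) [0..<n] y"
        "b = \<rho> K n (n + k) [0..<n] (cmpt \<alpha> (n + k) y)" by blast
    show "b = \<rho> K n m j (cmpt \<alpha> m x)"
      unfolding y(3)
      by (rule \<rho>_descend[OF H j up x y(1,2), where \<phi> = "\<lambda>m j x. \<rho> K n m j (cmpt \<alpha> m x)", symmetric])
        (rule push)
  qed
qed

lemma int_comp_mono:
  assumes a: "\<alpha> \<in> hom (Lax_Inj \<Sigma>) H K" and xy: "(x, y) \<in> Le (int_ob H n)"
  shows "(int_comp \<alpha> n x, int_comp \<alpha> n y) \<in> Le (int_ob K n)"
proof -
  note H = hom_LaxD(1)[OF a] and K = hom_LaxD(2)[OF a] and fam = hom_LaxD(5)[OF a]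
  have up: "[0..<n] \<in> inj_maps n (n + l)" for l by (rule upt_inj_maps) simp
  have "x \<in> Car (int_ob H n)" "y \<in> Car (int_ob H n)" using xy by (auto simp: int_ob_def Let_def)
  then obtain k u l v where u: "u \<in> Car (fob H (n + k))" "x = \<rho> H n (n + k) [0..<n] u"
    and v: "v \<in> Car (fob H (n + l))" "y = \<rho> H n (n + l) [0..<n] v"
    using int_cases[OF H] by metis
  show ?thesis
    unfolding u(2) v(2) int_comp_\<rho>_lax[OF a up u(1)] int_comp_\<rho>_lax[OF a up v(1)]
  proof (rule int_le_descend[OF H up up u(1) v(1) xy[unfolded u(2) v(2)],
        where \<phi> = "\<lambda>m j x. \<rho> K n m j (cmpt \<alpha> m x)"])
    show "\<rho> K n m' (map ((!) k) j) (cmpt \<alpha> m' (fmap H m' (J k) x)) = \<rho> K n m j (cmpt \<alpha> m x)"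
      if "j \<in> inj_maps n m" "k \<in> inj_maps m m'" "x \<in> Car (fob H m)" for m j k m' x
      using \<rho>_push[OF that(1,2) lax_familyD(2)[OF fam that(3)]] lax_familyD(5)[OF fam that(2,3)] by simp
    show "(\<rho> K n m j (cmpt \<alpha> m x), \<rho> K n m j (cmpt \<alpha> m y)) \<in> Le (int_ob K n)"
      if "j \<in> inj_maps n m" "(x, y) \<in> Le (fob H m)" for m j x y
      by (rule \<rho>_mono[OF K that(1) lax_familyD(3)[OF fam that(2)]])
  qed
qed

text \<open>Both ways round the square are computed on one representative, where they differ only by
  the naturality square of \<open>\<alpha>\<close> at \<open>f\<close> extended by \<open>k\<close>
  variables. The lax, the strict and the injective case are all read off from these two
  formulas.\<close>

lemma int_comp_natural:
  assumes a: "\<alpha> \<in> hom (Lax_Inj \<Sigma>) H K" and f: "f \<in> L \<Sigma> n m" and x: "x \<in> Car (fob H (m + k))"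
  shows "int_map K n f (int_comp \<alpha> m (\<rho> H m (m + k) [0..<m] x)) =
      \<rho> K n (n + k) [0..<n] (fmap K (n + k) (f @ map Var [n..<n + k]) (cmpt \<alpha> (m + k) x))"
    "int_comp \<alpha> n (int_map H n f (\<rho> H m (m + k) [0..<m] x)) =
      \<rho> K n (n + k) [0..<n] (cmpt \<alpha> (n + k) (fmap H (n + k) (f @ map Var [n..<n + k]) x))"
proof -
  note H = hom_LaxD(1)[OF a] and K = hom_LaxD(2)[OF a] and fam = hom_LaxD(5)[OF a]
  have up: "[0..<n] \<in> inj_maps n (n + l)" for n l :: nat by (rule upt_inj_maps) simp
  show "int_map K n f (int_comp \<alpha> m (\<rho> H m (m + k) [0..<m] x)) =
      \<rho> K n (n + k) [0..<n] (fmap K (n + k) (f @ map Var [n..<n + k]) (cmpt \<alpha> (m + k) x))"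
    unfolding int_comp_\<rho>_lax[OF a up x] int_map_\<rho>[OF K f lax_familyD(2)[OF fam x]] ..
  show "int_comp \<alpha> n (int_map H n f (\<rho> H m (m + k) [0..<m] x)) =
      \<rho> K n (n + k) [0..<n] (cmpt \<alpha> (n + k) (fmap H (n + k) (f @ map Var [n..<n + k]) x))"
    unfolding int_map_\<rho>[OF H f x] int_comp_\<rho>_lax[OF a up is_funcD(3)[OF H ext_in_L[OF f] x]] ..
qed

lemma int_comp_family:
  assumes a: "\<alpha> \<in> hom (Lax_Inj \<Sigma>) H K"
  shows "lax_family \<Sigma> (Integral H) (Integral K) (int_comp \<alpha>)"
proof (rule lax_familyI)
  note H = hom_LaxD(1)[OF a] and K = hom_LaxD(2)[OF a] and fam = hom_LaxD(5)[OF a]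
  fix n x assume "x \<in> Car (fob (Integral H) n)"
  then obtain k u where u: "u \<in> Car (fob H (n + k))" "x = \<rho> H n (n + k) [0..<n] u"
    using int_cases[OF H] by (metis fob_Integral)
  have up: "[0..<n] \<in> inj_maps n (n + k)" by (rule upt_inj_maps) simp
  show "int_comp \<alpha> n x \<in> Car (fob (Integral K) n)"
    unfolding u(2) int_comp_\<rho>_lax[OF a up u(1)] by (simp add: \<rho>_in_int up lax_familyD(2)[OF fam u(1)])
next
  note H = hom_LaxD(1)[OF a] and K = hom_LaxD(2)[OF a] and fam = hom_LaxD(5)[OF a]
  fix n m f x assume f: "f \<in> L \<Sigma> n m" and "x \<in> Car (fob (Integral H) m)"
  then obtain k u where u: "u \<in> Car (fob H (m + k))" "x = \<rho> H m (m + k) [0..<m] u"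
    using int_cases[OF H] by (metis fob_Integral)
  have up: "[0..<n] \<in> inj_maps n (n + k)" by (rule upt_inj_maps) simp
  show "(fmap (Integral K) n f (int_comp \<alpha> m x), int_comp \<alpha> n (fmap (Integral H) n f x)) \<in> Le (fob (Integral K) n)"
    unfolding u(2) Integral_def func.simps int_comp_natural[OF a f u(1)]
    by (rule \<rho>_mono[OF K up lax_familyD(4)[OF fam ext_in_L[OF f] u(1)]])
next
  note H = hom_LaxD(1)[OF a] and K = hom_LaxD(2)[OF a] and fam = hom_LaxD(5)[OF a]
  fix n m i x assume i: "i \<in> inj_maps n m" and "x \<in> Car (fob (Integral H) n)"
  then obtain k u where u: "u \<in> Car (fob H (n + k))" "x = \<rho> H n (n + k) [0..<n] u"
    using int_cases[OF H] by (metis fob_Integral)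
  show "fmap (Integral K) m (J i) (int_comp \<alpha> n x) = int_comp \<alpha> m (fmap (Integral H) m (J i) x)"
    unfolding u(2) Integral_def func.simps int_comp_natural[OF a J_inj_in_L[OF i] u(1)] J_ext[OF i]
      lax_familyD(5)[OF fam J_ext(2)[OF i] u(1)] ..
qed (simp add: int_comp_mono[OF a])

text \<open>Meant for the projections of the cofree coalgebra, which are strict along all arrows; it
  yields strict naturality of the structure map.\<close>

lemma int_comp_strict:
  assumes a: "\<alpha> \<in> hom (Lax_Inj \<Sigma>) H K"
    and strict: "\<And>n m f x. f \<in> L \<Sigma> n m \<Longrightarrow> x \<in> Car (fob H m) \<Longrightarrow> fmap K n f (cmpt \<alpha> m x) = cmpt \<alpha> n (fmap H n f x)"
    and f: "f \<in> L \<Sigma> n m" and x: "x \<in> Car (int_ob H m)"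
  shows "int_map K n f (int_comp \<alpha> m x) = int_comp \<alpha> n (int_map H n f x)"
proof -
  obtain k u where u: "u \<in> Car (fob H (m + k))" "x = \<rho> H m (m + k) [0..<m] u"
    using int_cases[OF hom_LaxD(1)[OF a] x] by metis
  show ?thesis
    unfolding u(2) int_comp_natural[OF a f u(1)] strict[OF ext_in_L[OF f] u(1)] ..
qed


section \<open>The endofunctor and the chain of stages\<close>

text \<open>Splits the endofunctor into the colimit functor and two applications of one powerset
  functor, so that each fact about finite powersets is proved once.\<close>

definition Pf_func :: "('f, ('f, 'p, 'u) univ) func \<Rightarrow> ('f, ('f, 'p, 'u) univ) func" where
  "Pf_func K = \<lparr>fob = (\<lambda>n. Pf (fob K n)), fmap = (\<lambda>n f. uimage (fmap K n f))\<rparr>"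

lemma Pf_func_simps [simp]:
  "fob (Pf_func K) n = Pf (fob K n)" "fmap (Pf_func K) n f = uimage (fmap K n f)"
  by (simp_all add: Pf_func_def)

lemma PfPfInt_ob_Pf_func: "PfPfInt_ob H = Pf_func (Pf_func (Integral H))"
  by (simp add: PfPfInt_ob_def Pf_func_def)

lemma Pf_Car_iff [simp]: "USet S \<in> Car (Pf X) \<longleftrightarrow> fset S \<subseteq> Car X"
  by (auto simp: Pf_def)

lemma Pf_Le_iff [simp]: "(USet S, USet T) \<in> Le (Pf X) \<longleftrightarrow>
    fset S \<subseteq> Car X \<and> fset T \<subseteq> Car X \<and> (\<forall>a\<in>fset S. \<exists>b\<in>fset T. (a, b) \<in> Le X)"
  by (auto simp: Pf_def)

lemma Pf_cases:
  assumes "a \<in> Car (Pf X)"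
  obtains S where "a = USet S" "fset S \<subseteq> Car X"
  using assms by (auto simp: Pf_def)

lemma Pf_Le_cases:
  assumes "(a, b) \<in> Le (Pf X)"
  obtains S T where "a = USet S" "b = USet T" "fset S \<subseteq> Car X" "fset T \<subseteq> Car X"
    "\<And>x. x \<in> fset S \<Longrightarrow> \<exists>y\<in>fset T. (x, y) \<in> Le X"
proof -
  obtain S T where *: "a = USet S" "b = USet T" using assms by (auto simp: Pf_def)
  show thesis by (rule that[OF *]) (use assms in \<open>simp_all add: *\<close>)
qed

lemma uimage_uimage: "uimage g (uimage h a) = uimage (\<lambda>x. g (h x)) a"
  by (cases a) (auto simp: fset.map_comp comp_def)

lemma uimage_cong:
  assumes "a \<in> Car (Pf X)" "\<And>x. x \<in> Car X \<Longrightarrow> g x = h x"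
  shows "uimage g a = uimage h a"
  using assms by (elim Pf_cases) (auto intro!: fset.map_cong0)

lemma uimage_id:
  assumes "a \<in> Car (Pf X)" "\<And>x. x \<in> Car X \<Longrightarrow> g x = x"
  shows "uimage g a = a"
proof -
  have "uimage g a = uimage (\<lambda>x. x) a" by (rule uimage_cong[OF assms])
  then show ?thesis using assms(1) by (elim Pf_cases) simp
qed

lemma uimage_in:
  assumes "a \<in> Car (Pf X)" "\<And>x. x \<in> Car X \<Longrightarrow> g x \<in> Car Y"
  shows "uimage g a \<in> Car (Pf Y)"
  using assms by (elim Pf_cases) auto

lemma uimage_le:
  assumes "a \<in> Car (Pf X)" "\<And>x. x \<in> Car X \<Longrightarrow> g x \<in> Car Y" "\<And>x. x \<in> Car X \<Longrightarrow> h x \<in> Car Y"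
    "\<And>x. x \<in> Car X \<Longrightarrow> (g x, h x) \<in> Le Y"
  shows "(uimage g a, uimage h a) \<in> Le (Pf Y)"
  using assms(1)
proof (rule Pf_cases)
  fix S assume "a = USet S" "fset S \<subseteq> Car X"
  then show ?thesis using assms(2-4) by (fastforce simp: image_subset_iff subset_iff)
qed

lemma uimage_mono:
  assumes "(a, b) \<in> Le (Pf X)" "\<And>x. x \<in> Car X \<Longrightarrow> g x \<in> Car Y"
    "\<And>x y. (x, y) \<in> Le X \<Longrightarrow> (g x, g y) \<in> Le Y"
  shows "(uimage g a, uimage g b) \<in> Le (Pf Y)"
  using assms(1)
proof (rule Pf_Le_cases)
  fix S T assume "a = USet S" "b = USet T" "fset S \<subseteq> Car X" "fset T \<subseteq> Car X"
    and *: "\<And>x. x \<in> fset S \<Longrightarrow> \<exists>y\<in>fset T. (x, y) \<in> Le X"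
  moreover have "\<exists>y\<in>g ` fset T. (g x, y) \<in> Le Y" if "x \<in> fset S" for x
    using *[OF that] assms(3) by blast
  ultimately show ?thesis using assms(2) by (auto simp: image_subset_iff subset_iff)
qed

lemma Pf_preorder:
  assumes "preorder_on (Car X) (Le X)"
  shows "preorder_on (Car (Pf X)) (Le (Pf X))"
proof (rule preorder_onI)
  fix x assume "x \<in> Car (Pf X)"
  then show "(x, x) \<in> Le (Pf X)"
    using preorder_onD(3)[OF assms] by (elim Pf_cases) auto
next
  fix x y z assume xy: "(x, y) \<in> Le (Pf X)" and yz: "(y, z) \<in> Le (Pf X)"
  obtain S T where ST: "x = USet S" "y = USet T" using xy by (rule Pf_Le_cases)
  obtain U where U: "z = USet U" using yz by (rule Pf_Le_cases)
  have "\<exists>c\<in>fset U. (a, c) \<in> Le X" if a: "a \<in> fset S" for a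
  proof -
    obtain b where b: "b \<in> fset T" "(a, b) \<in> Le X"
      using a xy unfolding ST Pf_Le_iff by blast
    then obtain c where "c \<in> fset U" "(b, c) \<in> Le X"
      using yz unfolding ST U Pf_Le_iff by blast
    with b(2) show ?thesis using preorder_onD(4)[OF assms] by blast
  qed
  then show "(x, z) \<in> Le (Pf X)"
    using xy yz unfolding ST U Pf_Le_iff by blast
qed (auto elim!: Pf_Le_cases)

lemma is_func_Pf_func:
  assumes K: "is_func \<Sigma> K"
  shows "is_func \<Sigma> (Pf_func K)"
  unfolding is_func_def Pf_func_simps
proof (intro conjI allI ballI)
  fix n show "preorder_on (Car (Pf (fob K n))) (Le (Pf (fob K n)))"
    by (rule Pf_preorder[OF is_funcD(1)[OF K]])
next
  fix n m f assume f: "f \<in> L \<Sigma> n m"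
  show "uimage (fmap K n f) \<in> monotone_maps (Pf (fob K m)) (Pf (fob K n))"
    using is_funcD(3,4)[OF K f] by (auto intro!: monotone_mapsI intro: uimage_in uimage_mono)
next
  fix n x assume "x \<in> Car (Pf (fob K n))"
  then show "uimage (fmap K n (map Var [0..<n])) x = x"
    by (rule uimage_id) (rule is_funcD(5)[OF K])
next
  fix n m k f g x assume f: "f \<in> L \<Sigma> n m" and g: "g \<in> L \<Sigma> m k" and x: "x \<in> Car (Pf (fob K k))"
  show "uimage (fmap K n (lcomp g f)) x = uimage (fmap K n f) (uimage (fmap K m g) x)"
    unfolding uimage_uimage by (rule uimage_cong[OF x]) (rule is_funcD(6)[OF K f g, symmetric])
qed

lemma lax_family_Pf_func:
  assumes H: "is_func \<Sigma> H" and K: "is_func \<Sigma> K" and g: "lax_family \<Sigma> H K g"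
  shows "lax_family \<Sigma> (Pf_func H) (Pf_func K) (\<lambda>n. uimage (g n))"
proof (rule lax_familyI; unfold Pf_func_simps)
  fix n x assume "x \<in> Car (Pf (fob H n))"
  then show "uimage (g n) x \<in> Car (Pf (fob K n))" by (rule uimage_in) (rule lax_familyD(2)[OF g])
next
  fix n x y assume "(x, y) \<in> Le (Pf (fob H n))"
  then show "(uimage (g n) x, uimage (g n) y) \<in> Le (Pf (fob K n))"
    by (rule uimage_mono) (auto intro: lax_familyD(2,3)[OF g])
next
  fix n m f x assume f: "f \<in> L \<Sigma> n m" and x: "x \<in> Car (Pf (fob H m))"
  show "(uimage (fmap K n f) (uimage (g m) x), uimage (g n) (uimage (fmap H n f) x)) \<in> Le (Pf (fob K n))"
    unfolding uimage_uimage using x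
    by (rule uimage_le) (intro is_funcD(3)[OF K f] is_funcD(3)[OF H f] lax_familyD(2)[OF g] lax_familyD(4)[OF g f]; assumption)+
next
  fix n m i x assume i: "i \<in> inj_maps n m" and x: "x \<in> Car (Pf (fob H n))"
  show "uimage (fmap K m (J i)) (uimage (g n) x) = uimage (g m) (uimage (fmap H m (J i)) x)"
    unfolding uimage_uimage by (rule uimage_cong[OF x]) (rule lax_familyD(5)[OF g i])
qed

section \<open>Functoriality of the composite endofunctor\<close>

lemma Fo_PfPfInt [simp]: "Fo PfPfInt = PfPfInt_ob"
  by (simp add: PfPfInt_def)

lemma is_func_PfPfInt: "is_func \<Sigma> H \<Longrightarrow> is_func \<Sigma> (PfPfInt_ob H)"
  by (simp add: PfPfInt_ob_Pf_func is_func_Pf_func is_func_Integral)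

lemma Fa_hom:
  assumes a: "\<alpha> \<in> hom (Lax_Inj \<Sigma>) H K"
  shows "Fa PfPfInt \<alpha> \<in> hom (Lax_Inj \<Sigma>) (PfPfInt_ob H) (PfPfInt_ob K)"
proof -
  note H = hom_LaxD(1)[OF a] and K = hom_LaxD(2)[OF a]
  note I = is_func_Integral[OF H] is_func_Integral[OF K]
  have "lax_family \<Sigma> (PfPfInt_ob H) (PfPfInt_ob K) (\<lambda>n. uimage (uimage (int_comp \<alpha> n)))"
    unfolding PfPfInt_ob_Pf_func
    by (intro lax_family_Pf_func is_func_Pf_func I int_comp_family[OF a])
  then show ?thesis
    using lax_of_hom[OF is_func_PfPfInt[OF H] is_func_PfPfInt[OF K]]
    by (simp add: PfPfInt_def hom_LaxD(3,4)[OF a])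
qed

lemma cmpt_Fa:
  assumes "\<alpha> \<in> hom (Lax_Inj \<Sigma>) H K" "x \<in> Car (fob (PfPfInt_ob H) n)"
  shows "cmpt (Fa PfPfInt \<alpha>) n x = uimage (uimage (int_comp \<alpha> n)) x"
  using assms(2) by (simp add: PfPfInt_def hom_LaxD(3,4)[OF assms(1)])

lemma PfPfInt_Car: "Car (fob (PfPfInt_ob H) n) = Car (Pf (Pf (int_ob H n)))"
  by (simp add: PfPfInt_ob_Pf_func)

lemma PfPfInt_Le: "Le (fob (PfPfInt_ob H) n) = Le (Pf (Pf (int_ob H n)))"
  by (simp add: PfPfInt_ob_Pf_func)

lemma fmap_PfPfInt: "fmap (PfPfInt_ob H) n f = uimage (uimage (int_map H n f))"
  by (simp add: PfPfInt_ob_Pf_func Integral_def)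

lemma uimage2_cong:
  assumes "a \<in> Car (Pf (Pf X))" "\<And>x. x \<in> Car X \<Longrightarrow> g x = h x"
  shows "uimage (uimage g) a = uimage (uimage h) a"
  by (rule uimage_cong[OF assms(1)]) (rule uimage_cong[OF _ assms(2)])

lemma uimage2_uimage2: "uimage (uimage g) (uimage (uimage h) a) = uimage (uimage (\<lambda>x. g (h x))) a"
  by (simp add: uimage_uimage)

lemma int_comp_Cmp:
  assumes a: "\<alpha> \<in> hom (Lax_Inj \<Sigma>) H K" and b: "\<beta> \<in> hom (Lax_Inj \<Sigma>) K M" and x: "x \<in> Car (int_ob H n)"
  shows "int_comp (Cmp (Lax_Inj \<Sigma>) \<beta> \<alpha>) n x = int_comp \<beta> n (int_comp \<alpha> n x)"
proof -
  obtain k u where u: "u \<in> Car (fob H (n + k))" "x = \<rho> H n (n + k) [0..<n] u"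
    using int_cases[OF hom_LaxD(1)[OF a] x] by metis
  have up: "[0..<n] \<in> inj_maps n (n + k)" by (rule upt_inj_maps) simp
  show ?thesis
    unfolding u(2) int_comp_\<rho>_lax[OF Cmp_hom[OF a b] up u(1)] int_comp_\<rho>_lax[OF a up u(1)]
      int_comp_\<rho>_lax[OF b up lax_familyD(2)[OF hom_LaxD(5)[OF a] u(1)]] cmpt_Cmp[OF a u(1)] ..
qed

lemma int_comp_Ide:
  assumes H: "is_func \<Sigma> H" and x: "x \<in> Car (int_ob H n)"
  shows "int_comp (Ide (Lax_Inj \<Sigma>) H) n x = x"
proof -
  obtain k u where u: "u \<in> Car (fob H (n + k))" "x = \<rho> H n (n + k) [0..<n] u"
    using int_cases[OF H x] by metis
  have up: "[0..<n] \<in> inj_maps n (n + k)" by (rule upt_inj_maps) simp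
  show ?thesis
    unfolding u(2) int_comp_\<rho>_lax[OF Ide_hom[OF H] up u(1)] cmpt_Ide[OF u(1)] ..
qed

lemma Fa_Cmp:
  assumes a: "\<alpha> \<in> hom (Lax_Inj \<Sigma>) H K" and b: "\<beta> \<in> hom (Lax_Inj \<Sigma>) K M"
  shows "Fa PfPfInt (Cmp (Lax_Inj \<Sigma>) \<beta> \<alpha>) = Cmp (Lax_Inj \<Sigma>) (Fa PfPfInt \<beta>) (Fa PfPfInt \<alpha>)"
proof (rule lax_eqI[OF Fa_hom[OF Cmp_hom[OF a b]] Cmp_hom[OF Fa_hom[OF a] Fa_hom[OF b]]])
  fix n x assume x: "x \<in> Car (fob (PfPfInt_ob H) n)"
  show "cmpt (Fa PfPfInt (Cmp (Lax_Inj \<Sigma>) \<beta> \<alpha>)) n x =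
      cmpt (Cmp (Lax_Inj \<Sigma>) (Fa PfPfInt \<beta>) (Fa PfPfInt \<alpha>)) n x"
    unfolding cmpt_Fa[OF Cmp_hom[OF a b] x] cmpt_Cmp[OF Fa_hom[OF a] x]
      cmpt_Fa[OF b lax_familyD(2)[OF hom_LaxD(5)[OF Fa_hom[OF a]] x]]
    unfolding cmpt_Fa[OF a x] uimage2_uimage2
    using x[unfolded PfPfInt_Car] by (rule uimage2_cong) (rule int_comp_Cmp[OF a b])
qed

lemma Fa_Ide:
  assumes H: "is_func \<Sigma> H"
  shows "Fa PfPfInt (Ide (Lax_Inj \<Sigma>) H) = Ide (Lax_Inj \<Sigma>) (PfPfInt_ob H)"
proof (rule lax_eqI[OF Fa_hom[OF Ide_hom[OF H]] Ide_hom[OF is_func_PfPfInt[OF H]]])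
  fix n x assume x: "x \<in> Car (fob (PfPfInt_ob H) n)"
  show "cmpt (Fa PfPfInt (Ide (Lax_Inj \<Sigma>) H)) n x = cmpt (Ide (Lax_Inj \<Sigma>) (PfPfInt_ob H)) n x"
    unfolding cmpt_Fa[OF Ide_hom[OF H] x] cmpt_Ide[OF x] using x[unfolded PfPfInt_Car]
    by (rule uimage_id) (rule uimage_id, assumption, rule int_comp_Ide[OF H])
qed

lemma is_endofunctor_PfPfInt: "is_endofunctor (Lax_Inj \<Sigma>) PfPfInt"
  unfolding is_endofunctor_def Fo_PfPfInt
  using is_func_PfPfInt Fa_hom Fa_Ide Fa_Cmp by (metis Lax_Inj_simps(1) mem_Collect_eq)

section \<open>Products, pairing and projections\<close>

lemma prod_func_simps [simp]:
  "UPair x y \<in> Car (fob (prod_func H K) n) \<longleftrightarrow> x \<in> Car (fob H n) \<and> y \<in> Car (fob K n)"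
  "(UPair x y, UPair x' y') \<in> Le (fob (prod_func H K) n) \<longleftrightarrow>
     (x, x') \<in> Le (fob H n) \<and> (y, y') \<in> Le (fob K n)"
  "fmap (prod_func H K) n f (UPair x y) = UPair (fmap H n f x) (fmap K n f y)"
  by (auto simp: prod_func_def)

lemma prod_func_cases:
  assumes "a \<in> Car (fob (prod_func H K) n)"
  obtains x y where "a = UPair x y" "x \<in> Car (fob H n)" "y \<in> Car (fob K n)"
  using assms by (auto simp: prod_func_def)

lemma prod_func_Le_cases:
  assumes "(a, b) \<in> Le (fob (prod_func H K) n)"
  obtains x y x' y' where "a = UPair x y" "b = UPair x' y'" "(x, x') \<in> Le (fob H n)" "(y, y') \<in> Le (fob K n)"
  using assms by (auto simp: prod_func_def)

lemma is_func_prod_func: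
  assumes H: "is_func \<Sigma> H" and K: "is_func \<Sigma> K"
  shows "is_func \<Sigma> (prod_func H K)"
  unfolding is_func_def
proof (intro conjI allI ballI)
  fix n
  note h = preorder_onD[OF is_funcD(1)[OF H]] and k = preorder_onD[OF is_funcD(1)[OF K]]
  show "preorder_on (Car (fob (prod_func H K) n)) (Le (fob (prod_func H K) n))"
    by (rule preorder_onI)
      (auto elim!: prod_func_Le_cases prod_func_cases intro: h(1,2,3) k(1,2,3) h(4) k(4))
next
  fix n m f assume f: "f \<in> L \<Sigma> n m"
  show "fmap (prod_func H K) n f \<in> monotone_maps (fob (prod_func H K) m) (fob (prod_func H K) n)"
    by (rule monotone_mapsI)
      (auto elim!: prod_func_Le_cases prod_func_cases intro: is_funcD(3,4)[OF H f] is_funcD(3,4)[OF K f])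
next
  fix n x assume "x \<in> Car (fob (prod_func H K) n)"
  then show "fmap (prod_func H K) n (map Var [0..<n]) x = x"
    by (auto elim!: prod_func_cases simp: is_funcD(5)[OF H] is_funcD(5)[OF K])
next
  fix n m k f g x assume f: "f \<in> L \<Sigma> n m" and g: "g \<in> L \<Sigma> m k" and "x \<in> Car (fob (prod_func H K) k)"
  then show "fmap (prod_func H K) n (lcomp g f) x = fmap (prod_func H K) n f (fmap (prod_func H K) m g x)"
    by (auto elim!: prod_func_cases simp: is_funcD(6)[OF H f g] is_funcD(6)[OF K f g])
qed

lemma pairing_hom:
  assumes a: "\<alpha> \<in> hom (Lax_Inj \<Sigma>) X H" and b: "\<beta> \<in> hom (Lax_Inj \<Sigma>) X K"
  shows "pairing \<alpha> \<beta> \<in> hom (Lax_Inj \<Sigma>) X (prod_func H K)"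
proof -
  note fa = lax_familyD[OF hom_LaxD(5)[OF a]] and fb = lax_familyD[OF hom_LaxD(5)[OF b]]
  have "lax_family \<Sigma> X (prod_func H K) (\<lambda>n a. UPair (cmpt \<alpha> n a) (cmpt \<beta> n a))"
    by (rule lax_familyI) (auto intro: fa(2-4) fb(2-4) simp: fa(5) fb(5))
  then show ?thesis
    using lax_of_hom[OF hom_LaxD(1)[OF a] is_func_prod_func[OF hom_LaxD(2)[OF a] hom_LaxD(2)[OF b]]]
    by (simp add: pairing_def hom_LaxD(3,4)[OF a] hom_LaxD(3,4)[OF b])
qed

lemma cmpt_pairing:
  assumes "\<alpha> \<in> hom (Lax_Inj \<Sigma>) X H" "x \<in> Car (fob X n)"
  shows "cmpt (pairing \<alpha> \<beta>) n x = UPair (cmpt \<alpha> n x) (cmpt \<beta> n x)"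
  using assms(2) by (simp add: pairing_def hom_LaxD(3)[OF assms(1)])

lemma pairing_Cmp:
  assumes a: "\<alpha> \<in> hom (Lax_Inj \<Sigma>) X H" and b: "\<beta> \<in> hom (Lax_Inj \<Sigma>) X K" and m: "\<mu> \<in> hom (Lax_Inj \<Sigma>) Y X"
  shows "Cmp (Lax_Inj \<Sigma>) (pairing \<alpha> \<beta>) \<mu> = pairing (Cmp (Lax_Inj \<Sigma>) \<alpha> \<mu>) (Cmp (Lax_Inj \<Sigma>) \<beta> \<mu>)"
proof (rule lax_eqI[OF Cmp_hom[OF m pairing_hom[OF a b]] pairing_hom[OF Cmp_hom[OF m a] Cmp_hom[OF m b]]])
  fix n x assume x: "x \<in> Car (fob Y n)"
  show "cmpt (Cmp (Lax_Inj \<Sigma>) (pairing \<alpha> \<beta>) \<mu>) n x =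
      cmpt (pairing (Cmp (Lax_Inj \<Sigma>) \<alpha> \<mu>) (Cmp (Lax_Inj \<Sigma>) \<beta> \<mu>)) n x"
    unfolding cmpt_pairing[OF Cmp_hom[OF m a] x] cmpt_Cmp[OF m x]
      cmpt_pairing[OF a lax_familyD(2)[OF hom_LaxD(5)[OF m] x]] ..
qed

definition fst_lax :: "('f, ('f, 'p, 'u) univ) func \<Rightarrow> ('f, ('f, 'p, 'u) univ) func \<Rightarrow> ('f, ('f, 'p, 'u) univ) lax"
  where "fst_lax H K = lax_of (prod_func H K) H (\<lambda>n a. case a of UPair x y \<Rightarrow> x | _ \<Rightarrow> a)"

definition snd_lax :: "('f, ('f, 'p, 'u) univ) func \<Rightarrow> ('f, ('f, 'p, 'u) univ) func \<Rightarrow> ('f, ('f, 'p, 'u) univ) lax"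
  where "snd_lax H K = lax_of (prod_func H K) K (\<lambda>n a. case a of UPair x y \<Rightarrow> y | _ \<Rightarrow> a)"

lemma fst_lax_hom:
  assumes H: "is_func \<Sigma> H" and K: "is_func \<Sigma> K"
  shows "fst_lax H K \<in> hom (Lax_Inj \<Sigma>) (prod_func H K) H"
  unfolding fst_lax_def
  by (rule lax_of_hom[OF is_func_prod_func[OF assms] H], rule lax_family_strictI[OF H])
    (auto elim!: prod_func_Le_cases prod_func_cases)

lemma snd_lax_hom:
  assumes H: "is_func \<Sigma> H" and K: "is_func \<Sigma> K"
  shows "snd_lax H K \<in> hom (Lax_Inj \<Sigma>) (prod_func H K) K"
  unfolding snd_lax_def
  by (rule lax_of_hom[OF is_func_prod_func[OF assms] K], rule lax_family_strictI[OF K])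
    (auto elim!: prod_func_Le_cases prod_func_cases)

lemma cmpt_fst_snd_lax:
  assumes "x \<in> Car (fob H n)" "y \<in> Car (fob K n)"
  shows "cmpt (fst_lax H K) n (UPair x y) = x" "cmpt (snd_lax H K) n (UPair x y) = y"
  using assms by (auto simp: fst_lax_def snd_lax_def)

section \<open>Stages of the chain and approximations\<close>

lemma is_func_stage: "is_func \<Sigma> H \<Longrightarrow> is_func \<Sigma> (stage H i)"
  by (induction i) (auto simp: is_func_prod_func is_func_PfPfInt)

text \<open>\<open>cone\<close> for an arbitrary coalgebra \<open>c\<close> and arrow \<open>h\<close> from its carrier.\<close>

primrec approx ::
    "('f \<times> nat) set \<Rightarrow> ('f, ('f, 'p, 'u) univ) lax \<Rightarrow> ('f, ('f, 'p, 'u) univ) lax \<Rightarrow> nat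
       \<Rightarrow> ('f, ('f, 'p, 'u) univ) lax" where
  "approx \<Sigma> c h 0 = h"
| "approx \<Sigma> c h (Suc i) = pairing h (Cmp (Lax_Inj \<Sigma>) (Fa PfPfInt (approx \<Sigma> c h i)) c)"

lemma approx_hom:
  assumes c: "c \<in> hom (Lax_Inj \<Sigma>) X (PfPfInt_ob X)" and h: "h \<in> hom (Lax_Inj \<Sigma>) X H"
  shows "approx \<Sigma> c h i \<in> hom (Lax_Inj \<Sigma>) X (stage H i)"
  by (induction i) (auto intro!: h c pairing_hom Cmp_hom Fa_hom)

text \<open>\<open>eq\<close> says that \<open>\<mu>\<close> is a coalgebra map from
  \<open>d\<close> to \<open>c\<close>, and approximations are natural in coalgebra maps. With
  \<open>c\<close> the cofree coalgebra this gives uniqueness of unfoldings; with \<open>c\<close>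
  the coalgebra underlying an arbitrary cofree comonad it evaluates the cone.\<close>

lemma approx_Cmp:
  assumes c: "c \<in> hom (Lax_Inj \<Sigma>) X (PfPfInt_ob X)" and h: "h \<in> hom (Lax_Inj \<Sigma>) X H"
    and d: "d \<in> hom (Lax_Inj \<Sigma>) Y (PfPfInt_ob Y)" and m: "\<mu> \<in> hom (Lax_Inj \<Sigma>) Y X"
    and eq: "Cmp (Lax_Inj \<Sigma>) c \<mu> = Cmp (Lax_Inj \<Sigma>) (Fa PfPfInt \<mu>) d"
  shows "Cmp (Lax_Inj \<Sigma>) (approx \<Sigma> c h i) \<mu> = approx \<Sigma> d (Cmp (Lax_Inj \<Sigma>) h \<mu>) i"
proof (induction i)
  case (Suc i)
  note ah = approx_hom[OF c h, of i]
  note assoc = is_category_Lax_Inj[unfolded is_category_def, THEN conjunct2, THEN conjunct2, THEN conjunct2,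
      THEN conjunct2, rule_format]
  have "Cmp (Lax_Inj \<Sigma>) (Cmp (Lax_Inj \<Sigma>) (Fa PfPfInt (approx \<Sigma> c h i)) c) \<mu> =
      Cmp (Lax_Inj \<Sigma>) (Fa PfPfInt (approx \<Sigma> c h i)) (Cmp (Lax_Inj \<Sigma>) c \<mu>)"
    by (rule assoc[OF m c Fa_hom[OF ah], symmetric])
  also have "\<dots> = Cmp (Lax_Inj \<Sigma>) (Cmp (Lax_Inj \<Sigma>) (Fa PfPfInt (approx \<Sigma> c h i)) (Fa PfPfInt \<mu>)) d"
    unfolding eq by (rule assoc[OF d Fa_hom[OF m] Fa_hom[OF ah]])
  also have "\<dots> = Cmp (Lax_Inj \<Sigma>) (Fa PfPfInt (approx \<Sigma> d (Cmp (Lax_Inj \<Sigma>) h \<mu>) i)) d"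
    unfolding Suc.IH[symmetric] Fa_Cmp[OF m ah] ..
  finally show ?case
    unfolding approx.simps by (simp only: pairing_Cmp[OF h Cmp_hom[OF c Fa_hom[OF ah]] m])
qed simp

text \<open>The connecting arrow from \<open>stage H (Suc i)\<close> to \<open>stage H i\<close>,
  forgetting the deepest level. It serves to bring a relation between two elements down from one
  stage to the previous one.\<close>

primrec chain :: "('f \<times> nat) set \<Rightarrow> ('f, ('f, 'p, 'u) univ) func \<Rightarrow> nat \<Rightarrow> ('f, ('f, 'p, 'u) univ) lax" where
  "chain \<Sigma> H 0 = fst_lax H (PfPfInt_ob H)"
| "chain \<Sigma> H (Suc i) = pairing (fst_lax H (PfPfInt_ob (stage H (Suc i))))
     (Cmp (Lax_Inj \<Sigma>) (Fa PfPfInt (chain \<Sigma> H i)) (snd_lax H (PfPfInt_ob (stage H (Suc i)))))"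

lemma chain_hom:
  assumes H: "is_func \<Sigma> H"
  shows "chain \<Sigma> H i \<in> hom (Lax_Inj \<Sigma>) (stage H (Suc i)) (stage H i)"
proof (induction i)
  case 0
  show ?case using fst_lax_hom[OF H is_func_PfPfInt[OF H]] by simp
next
  case (Suc i)
  note P = is_func_PfPfInt[OF is_func_stage[OF H, of "Suc i"]]
  show ?case
    unfolding chain.simps stage.simps(2)[of H "Suc i"] stage.simps(2)[of H i] Fo_PfPfInt
    using pairing_hom[OF fst_lax_hom[OF H P] Cmp_hom[OF snd_lax_hom[OF H P] Fa_hom[OF Suc]]] by simp
qed


section \<open>The cofree coalgebra\<close>

text \<open>
  Elements of \<open>PfPfInt_ob G\<close> at \<open>n\<close>, presented by chosen representatives \<open>g (n + k) z\<close> in the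
  contexts \<open>n + k\<close>.
\<close>

definition node ::
    "('f, ('f, 'p, 'u) univ) func \<Rightarrow> nat \<Rightarrow> (nat \<Rightarrow> 'z \<Rightarrow> ('f, 'p, 'u) univ) \<Rightarrow> (nat \<times> 'z) fset fset
       \<Rightarrow> ('f, 'p, 'u) univ" where
  "node G n g W = USet ((\<lambda>V. USet ((\<lambda>(k, z). \<rho> G n (n + k) [0..<n] (g (n + k) z)) |`| V)) |`| W)"

lemma node_in:
  assumes "\<And>V k z. V \<in> fset W \<Longrightarrow> (k, z) \<in> fset V \<Longrightarrow> g (n + k) z \<in> Car (fob G (n + k))"
  shows "node G n g W \<in> Car (fob (PfPfInt_ob G) n)"
  using assms by (auto simp: node_def PfPfInt_Car intro!: \<rho>_in_int upt_inj_maps)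

text \<open>Membership in \<open>beh\<close> asks for an explicit finite family of representatives.
  Such a family is obtained by choosing a canonical representative for every member of every inner
  set.\<close>

lemma node_surj:
  assumes G: "is_func \<Sigma> G" and a: "a \<in> Car (fob (PfPfInt_ob G) n)"
  obtains W where "a = node G n (\<lambda>_ z. z) W"
    "\<And>V k z. V \<in> fset W \<Longrightarrow> (k, z) \<in> fset V \<Longrightarrow> z \<in> Car (fob G (n + k))"
proof -
  have "\<exists>p. case p of (k, z) \<Rightarrow> z \<in> Car (fob G (n + k)) \<and> x = \<rho> G n (n + k) [0..<n] z"
    if x: "x \<in> Car (int_ob G n)" for x
  proof -
    obtain k z where "z \<in> Car (fob G (n + k))" "x = \<rho> G n (n + k) [0..<n] z"
      using int_cases[OF G x] by metis
    then show ?thesis by (intro exI[of _ "(k, z)"]) simp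
  qed
  note ex = someI_ex[OF this]
  define rep where "rep x = (SOME p. case p of (k, z) \<Rightarrow>
      z \<in> Car (fob G (n + k)) \<and> x = \<rho> G n (n + k) [0..<n] z)" for x
  have rep: "case rep x of (k, z) \<Rightarrow> z \<in> Car (fob G (n + k)) \<and> x = \<rho> G n (n + k) [0..<n] z"
    if "x \<in> Car (int_ob G n)" for x
    unfolding rep_def by (rule ex[OF that])
  obtain S where S: "a = USet S" "fset S \<subseteq> Car (Pf (int_ob G n))"
    using a unfolding PfPfInt_Car by (rule Pf_cases)
  \<comment> \<open>All members of \<open>S\<close> are codes of sets; the empty family is a default
    for the other codes.\<close>
  define \<phi> where "\<phi> v = (case v of USet V \<Rightarrow> rep |`| V | _ \<Rightarrow> {||})" for v
  have *: "USet ((\<lambda>(k, z). \<rho> G n (n + k) [0..<n] z) |`| \<phi> v) = v"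
    "\<And>k z. (k, z) \<in> fset (\<phi> v) \<Longrightarrow> z \<in> Car (fob G (n + k))" if "v \<in> fset S" for v
  proof -
    have "v \<in> Car (Pf (int_ob G n))" using that S(2) by blast
    then obtain V where V: "v = USet V" "fset V \<subseteq> Car (int_ob G n)" by (rule Pf_cases)
    have "(\<lambda>x. case rep x of (k, z) \<Rightarrow> \<rho> G n (n + k) [0..<n] z) |`| V = (\<lambda>x. x) |`| V"
      using V(2) rep by (intro fset.map_cong0) (fastforce split: prod.splits)
    then show "USet ((\<lambda>(k, z). \<rho> G n (n + k) [0..<n] z) |`| \<phi> v) = v"
      by (simp add: V(1) \<phi>_def fset.map_comp comp_def)
    show "z \<in> Car (fob G (n + k))" if "(k, z) \<in> fset (\<phi> v)" for k z
      using that V(2) rep by (fastforce simp: V(1) \<phi>_def)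
  qed
  show thesis
  proof (rule that[of "\<phi> |`| S"])
    have "(\<lambda>v. USet ((\<lambda>(k, z). \<rho> G n (n + k) [0..<n] z) |`| \<phi> v)) |`| S = (\<lambda>v. v) |`| S"
      by (intro fset.map_cong0 *(1))
    then show "a = node G n (\<lambda>_ z. z) (\<phi> |`| S)"
      by (simp add: S(1) node_def fset.map_comp comp_def)
    show "z \<in> Car (fob G (n + k))" if "V \<in> fset (\<phi> |`| S)" "(k, z) \<in> fset V" for V k z
      using that *(2) by auto
  qed
qed

text \<open>A map between colimits is followed on representatives by \<open>\<phi>\<close>; the
  number \<open>k\<close> of fresh variables of each child is kept.\<close>

lemma uimage_node:
  assumes "\<And>V k z. V \<in> fset W \<Longrightarrow> (k, z) \<in> fset V \<Longrightarrow>
    \<psi> (\<rho> G m (m + k) [0..<m] (g (m + k) z)) = \<rho> K n (n + k) [0..<n] (h (n + k) (\<phi> k z))"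
  shows "uimage (uimage \<psi>) (node G m g W) = node K n h ((\<lambda>V. (\<lambda>(k, z). (k, \<phi> k z)) |`| V) |`| W)"
  unfolding node_def using assms
  by (auto simp: fset.map_comp comp_def split_beta intro!: fset.map_cong0)

lemma uimage_node_same:
  assumes "\<And>V k z. V \<in> fset W \<Longrightarrow> (k, z) \<in> fset V \<Longrightarrow>
    \<psi> (\<rho> G n (n + k) [0..<n] (g (n + k) z)) = \<rho> K n (n + k) [0..<n] (h (n + k) z)"
  shows "uimage (uimage \<psi>) (node G n g W) = node K n h W"
  using uimage_node[of W \<psi> G n g K n h "\<lambda>k z. z"] assms by simp

text \<open>
  A sequence is the image of an element of the cofree coalgebra only if the elements of
  its tails lie in the image as well: the limit of the chain contains more sequences,
  because finite powersets do not preserve it.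
\<close>

coinductive beh ::
    "('f, ('f, 'p, 'u) univ) func \<Rightarrow> nat \<Rightarrow> (nat \<Rightarrow> ('f, 'p, 'u) univ) \<Rightarrow> bool" for H where
  "\<lbrakk>\<forall>i. s i \<in> Car (fob (stage H i) n);
    \<forall>i. s (Suc i) = UPair (s 0) (node (stage H i) n (\<lambda>_ z. z i) W);
    \<forall>V k z. V \<in> fset W \<longrightarrow> (k, z) \<in> fset V \<longrightarrow> beh H (n + k) z\<rbrakk> \<Longrightarrow> beh H n s"

lemma beh_Car: "beh H n s \<Longrightarrow> s i \<in> Car (fob (stage H i) n)"
  by (auto elim: beh.cases)

text \<open>Keeps the witness \<open>W\<close> explicit and asks the children to lie in
  \<open>X\<close> itself, the form in which coinduction is applied below.\<close>

lemma beh_coinduct: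
  assumes "X n s"
    and "\<And>n s. X n s \<Longrightarrow> \<exists>W. (\<forall>i. s i \<in> Car (fob (stage H i) n)) \<and>
      (\<forall>i. s (Suc i) = UPair (s 0) (node (stage H i) n (\<lambda>_ z. z i) W)) \<and>
      (\<forall>V k z. V \<in> fset W \<longrightarrow> (k, z) \<in> fset V \<longrightarrow> X (n + k) z)"
  shows "beh H n s"
proof (rule beh.coinduct[of X, OF assms(1)])
  fix n s assume "X n s"
  from assms(2)[OF this] obtain W where "\<forall>i. s i \<in> Car (fob (stage H i) n)"
    "\<forall>i. s (Suc i) = UPair (s 0) (node (stage H i) n (\<lambda>_ z. z i) W)"
    "\<forall>V k z. V \<in> fset W \<longrightarrow> (k, z) \<in> fset V \<longrightarrow> X (n + k) z" by blast
  then show "\<exists>s' n' W. n = n' \<and> s = s' \<and> (\<forall>i. s' i \<in> Car (fob (stage H i) n')) \<and>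
      (\<forall>i. s' (Suc i) = UPair (s' 0) (node (stage H i) n' (\<lambda>_ z. z i) W)) \<and>
      (\<forall>V k z. V \<in> fset W \<longrightarrow> (k, z) \<in> fset V \<longrightarrow> X (n' + k) z \<or> beh H (n' + k) z)"
    by (intro exI[of _ s] exI[of _ n] exI[of _ W]) simp
qed

text \<open>By coinduction on all images of such sequences at once: a child in the context
  \<open>m + k\<close> goes to its image under \<open>f\<close> extended by \<open>k\<close>
  variables, which is an image of the same kind.\<close>

lemma beh_subst:
  assumes H: "is_func \<Sigma> H" and "f \<in> L \<Sigma> n m" "beh H m s"
  shows "beh H n (\<lambda>i. fmap (stage H i) n f (s i))"
proof -
  show ?thesis
  proof (rule beh_coinduct[where X = "\<lambda>n s. \<exists>m f t. f \<in> L \<Sigma> n m \<and> beh H m t \<and>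
      s = (\<lambda>i. fmap (stage H i) n f (t i))"])
    show "\<exists>m g t. g \<in> L \<Sigma> n m \<and> beh H m t \<and>
      (\<lambda>i. fmap (stage H i) n f (s i)) = (\<lambda>i. fmap (stage H i) n g (t i))"
      using assms(2,3) by blast
  next
    fix n s
    assume "\<exists>m f t. f \<in> L \<Sigma> n m \<and> beh H m t \<and> s = (\<lambda>i. fmap (stage H i) n f (t i))"
    then obtain m f t where f: "f \<in> L \<Sigma> n m" and t: "beh H m t"
      and s: "s = (\<lambda>i. fmap (stage H i) n f (t i))" by blast
    from t obtain W where W: "\<And>i. t (Suc i) = UPair (t 0) (node (stage H i) m (\<lambda>_ z. z i) W)"
      "\<And>V k z. V \<in> fset W \<Longrightarrow> (k, z) \<in> fset V \<Longrightarrow> beh H (m + k) z"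
      by (auto elim: beh.cases)
    note S = is_func_stage[OF H]
    let ?\<phi> = "\<lambda>k z i. fmap (stage H i) (n + k) (f @ map Var [n..<n + k]) (z i)"
    let ?W = "(\<lambda>V. (\<lambda>(k, z). (k, ?\<phi> k z)) |`| V) |`| W"
    have "s i \<in> Car (fob (stage H i) n)" for i
      unfolding s by (rule is_funcD(3)[OF S f beh_Car[OF t]])
    moreover have "s (Suc i) = UPair (s 0) (node (stage H i) n (\<lambda>_ z. z i) ?W)" for i
    proof -
      have "uimage (uimage (int_map (stage H i) n f)) (node (stage H i) m (\<lambda>_ z. z i) W) =
          node (stage H i) n (\<lambda>_ z. z i) ?W"
        by (rule uimage_node) (rule int_map_\<rho>[OF S f beh_Car[OF W(2)]])
      then show ?thesis unfolding s by (simp add: W(1) fmap_PfPfInt)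
    qed
    moreover have "\<exists>m f t. f \<in> L \<Sigma> (n + k) m \<and> beh H m t \<and>
        z = (\<lambda>i. fmap (stage H i) (n + k) f (t i))"
      if V: "V \<in> fset ?W" "(k, z) \<in> fset V" for V k z
    proof -
      obtain V' z' where "V' \<in> fset W" "(k, z') \<in> fset V'" "z = ?\<phi> k z'" using V by auto
      then show ?thesis using W(2) ext_in_L[OF f] by blast
    qed
    ultimately show "\<exists>W. (\<forall>i. s i \<in> Car (fob (stage H i) n)) \<and>
        (\<forall>i. s (Suc i) = UPair (s 0) (node (stage H i) n (\<lambda>_ z. z i) W)) \<and>
        (\<forall>V k z. V \<in> fset W \<longrightarrow> (k, z) \<in> fset V \<longrightarrow>
          (\<exists>m f t. f \<in> L \<Sigma> (n + k) m \<and> beh H m t \<and> z = (\<lambda>i. fmap (stage H i) (n + k) f (t i))))"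
      by blast
  qed
qed

section \<open>The functor of behaviours and its projections\<close>

definition cofree :: "('f, ('f, 'p, 'u) univ) func \<Rightarrow> ('f, ('f, 'p, 'u) univ) func" where
  "cofree H = \<lparr>
     fob = (\<lambda>n. \<lparr>Car = {USeq s | s. beh H n s},
                 Le = {(USeq s, USeq t) | s t. beh H n s \<and> beh H n t \<and>
                         (\<forall>i. (s i, t i) \<in> Le (fob (stage H i) n))}\<rparr>),
     fmap = (\<lambda>n f a. case a of USeq s \<Rightarrow> USeq (\<lambda>i. fmap (stage H i) n f (s i)) | _ \<Rightarrow> a)\<rparr>"

lemma cofree_simps [simp]:
  "USeq s \<in> Car (fob (cofree H) n) \<longleftrightarrow> beh H n s"
  "(USeq s, USeq t) \<in> Le (fob (cofree H) n) \<longleftrightarrow>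
     beh H n s \<and> beh H n t \<and> (\<forall>i. (s i, t i) \<in> Le (fob (stage H i) n))"
  "fmap (cofree H) n f (USeq s) = USeq (\<lambda>i. fmap (stage H i) n f (s i))"
  by (auto simp: cofree_def)

lemma cofree_cases:
  assumes "a \<in> Car (fob (cofree H) n)"
  obtains s where "a = USeq s" "beh H n s"
  using assms by (auto simp: cofree_def)

lemma cofree_Le_cases:
  assumes "(a, b) \<in> Le (fob (cofree H) n)"
  obtains s t where "a = USeq s" "b = USeq t" "beh H n s" "beh H n t"
    "\<And>i. (s i, t i) \<in> Le (fob (stage H i) n)"
  using assms by (auto simp: cofree_def)

lemma is_func_cofree:
  assumes H: "is_func \<Sigma> H"
  shows "is_func \<Sigma> (cofree H)"
  unfolding is_func_def
proof (intro conjI allI ballI)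
  note S = is_func_stage[OF H]
  fix n
  show "preorder_on (Car (fob (cofree H) n)) (Le (fob (cofree H) n))"
  proof (rule preorder_onI)
    fix x assume "x \<in> Car (fob (cofree H) n)"
    then show "(x, x) \<in> Le (fob (cofree H) n)"
      by (auto elim!: cofree_cases simp: preorder_onD(3)[OF is_funcD(1)[OF S] beh_Car])
  next
    fix x y z assume "(x, y) \<in> Le (fob (cofree H) n)" "(y, z) \<in> Le (fob (cofree H) n)"
    then show "(x, z) \<in> Le (fob (cofree H) n)"
      by (elim cofree_Le_cases) (auto intro: preorder_onD(4)[OF is_funcD(1)[OF S]])
  qed (auto elim!: cofree_Le_cases)
next
  note S = is_func_stage[OF H]
  fix n m f assume f: "f \<in> L \<Sigma> n m"
  show "fmap (cofree H) n f \<in> monotone_maps (fob (cofree H) m) (fob (cofree H) n)"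
    by (rule monotone_mapsI)
      (auto elim!: cofree_Le_cases cofree_cases simp: beh_subst[OF H f] is_funcD(4)[OF S f])
next
  note S = is_func_stage[OF H]
  fix n x assume "x \<in> Car (fob (cofree H) n)"
  then show "fmap (cofree H) n (map Var [0..<n]) x = x"
    by (auto elim!: cofree_cases simp: is_funcD(5)[OF S beh_Car])
next
  note S = is_func_stage[OF H]
  fix n m k f g x assume f: "f \<in> L \<Sigma> n m" and g: "g \<in> L \<Sigma> m k" and "x \<in> Car (fob (cofree H) k)"
  then show "fmap (cofree H) n (lcomp g f) x = fmap (cofree H) n f (fmap (cofree H) m g x)"
    by (auto elim!: cofree_cases simp: is_funcD(6)[OF S f g beh_Car])
qed

definition proj :: "('f, ('f, 'p, 'u) univ) func \<Rightarrow> nat \<Rightarrow> ('f, ('f, 'p, 'u) univ) lax" where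
  "proj H i = lax_of (cofree H) (stage H i) (\<lambda>n a. case a of USeq s \<Rightarrow> s i | _ \<Rightarrow> a)"

lemma cmpt_proj [simp]: "beh H n s \<Longrightarrow> cmpt (proj H i) n (USeq s) = s i"
  by (simp add: proj_def)

lemma proj_hom:
  assumes H: "is_func \<Sigma> H"
  shows "proj H i \<in> hom (Lax_Inj \<Sigma>) (cofree H) (stage H i)"
  unfolding proj_def
  by (rule lax_of_hom[OF is_func_cofree[OF H] is_func_stage[OF H]],
      rule lax_family_strictI[OF is_func_stage[OF H]])
    (auto elim!: cofree_cases cofree_Le_cases intro: beh_Car)

lemma proj_strict:
  assumes H: "is_func \<Sigma> H" and "f \<in> L \<Sigma> n m" "x \<in> Car (fob (cofree H) m)"
  shows "fmap (stage H i) n f (cmpt (proj H i) m x) = cmpt (proj H i) n (fmap (cofree H) n f x)"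
  using assms by (auto elim!: cofree_cases simp: beh_subst)

lemma int_comp_proj_node:
  assumes H: "is_func \<Sigma> H" and "\<And>V k z. V \<in> fset W \<Longrightarrow> (k, z) \<in> fset V \<Longrightarrow> beh H (n + k) z"
  shows "uimage (uimage (int_comp (proj H i) n)) (node (cofree H) n (\<lambda>_ z. USeq z) W) =
    node (stage H i) n (\<lambda>_ z. z i) W"
proof (rule uimage_node_same)
  fix V k z assume "V \<in> fset W" "(k, z) \<in> fset V"
  then have "beh H (n + k) z" by (rule assms(2))
  then show "int_comp (proj H i) n (\<rho> (cofree H) n (n + k) [0..<n] (USeq z)) =
      \<rho> (stage H i) n (n + k) [0..<n] (z i)"
    using int_comp_\<rho>_lax[OF proj_hom[OF H] upt_inj_maps[of n "n + k"], of "USeq z"] by simp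
qed

text \<open>\<open>beh\<close> does not mention the connecting arrows. Compatibility with them
  follows by induction on \<open>i\<close>, since all entries of \<open>s\<close> are read off one
  family \<open>W\<close> whose members are again such sequences.\<close>

lemma chain_beh:
  assumes H: "is_func \<Sigma> H" and "beh H n s"
  shows "cmpt (chain \<Sigma> H i) n (s (Suc i)) = s i"
  using assms(2)
proof (induction i arbitrary: n s)
  case 0
  obtain w where w: "s (Suc 0) = UPair (s 0) w" using 0 by (auto elim: beh.cases)
  have "UPair (s 0) w \<in> Car (fob (prod_func H (PfPfInt_ob H)) n)"
    using beh_Car[OF 0, of "Suc 0"] by (simp add: w)
  then show ?case by (simp add: w cmpt_fst_snd_lax)
next
  case (Suc i)
  obtain W where W: "\<And>i. s (Suc i) = UPair (s 0) (node (stage H i) n (\<lambda>_ z. z i) W)"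
    "\<And>V k z. V \<in> fset W \<Longrightarrow> (k, z) \<in> fset V \<Longrightarrow> beh H (n + k) z"
    using Suc.prems by (auto elim: beh.cases)
  note P = is_func_PfPfInt[OF is_func_stage[OF H, of "Suc i"]]
  let ?w = "node (stage H (Suc i)) n (\<lambda>_ z. z (Suc i)) W"
  have "UPair (s 0) ?w \<in> Car (fob (prod_func H (PfPfInt_ob (stage H (Suc i)))) n)"
    using beh_Car[OF Suc.prems, of "Suc (Suc i)"] unfolding W(1) by simp
  then have x: "UPair (s 0) ?w \<in> Car (fob (prod_func H (PfPfInt_ob (stage H (Suc i)))) n)"
    "s 0 \<in> Car (fob H n)" "?w \<in> Car (fob (PfPfInt_ob (stage H (Suc i))) n)"
    unfolding prod_func_simps by blast+
  have "uimage (uimage (int_comp (chain \<Sigma> H i) n)) ?w = node (stage H i) n (\<lambda>_ z. z i) W"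
  proof (rule uimage_node_same)
    fix V k z assume "V \<in> fset W" "(k, z) \<in> fset V"
    then have z: "beh H (n + k) z" by (rule W(2))
    show "int_comp (chain \<Sigma> H i) n (\<rho> (stage H (Suc i)) n (n + k) [0..<n] (z (Suc i))) =
        \<rho> (stage H i) n (n + k) [0..<n] (z i)"
      using int_comp_\<rho>_lax[OF chain_hom[OF H] upt_inj_maps[of n "n + k"] beh_Car[OF z]] Suc.IH[OF z]
      by simp
  qed
  then show ?case
    unfolding W(1) chain.simps cmpt_pairing[OF fst_lax_hom[OF H P] x(1)] cmpt_Cmp[OF snd_lax_hom[OF H P] x(1)]
      cmpt_fst_snd_lax[OF x(2,3)] cmpt_Fa[OF chain_hom[OF H] x(3)] by simp
qed

lemma chain_proj:
  assumes H: "is_func \<Sigma> H"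
  shows "Cmp (Lax_Inj \<Sigma>) (chain \<Sigma> H i) (proj H (Suc i)) = proj H i"
  by (rule lax_eqI[OF Cmp_hom[OF proj_hom[OF H] chain_hom[OF H]] proj_hom[OF H]],
      subst cmpt_Cmp[OF proj_hom[OF H]], assumption)
    (auto elim!: cofree_cases simp: chain_beh[OF H])

lemma fset_limit:
  assumes "\<And>i. \<forall>x\<in>fset S. \<exists>y\<in>fset T. Q i x y"
    "\<And>i x y. x \<in> fset S \<Longrightarrow> y \<in> fset T \<Longrightarrow> Q (Suc i) x y \<Longrightarrow> Q i x y"
  shows "\<forall>x\<in>fset S. \<exists>y\<in>fset T. \<forall>i. Q i x y"
  using eventually_constant_witness[of "fset T" "\<lambda>i. Q i _"] assms by (meson finite_fset)

text \<open>The \<open>g i\<close> jointly reflect order and equality, and relatedness is inherited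
  from \<open>i + 1\<close> to \<open>i\<close>. Thus \<open>X\<close> sits inside a limit of the
  \<open>Y i\<close> without having to be all of it; in this weak form the property survives finite
  powersets and, for the cofree coalgebra, the colimit.\<close>

definition limit_cone :: "'a oset \<Rightarrow> (nat \<Rightarrow> 'a oset) \<Rightarrow> (nat \<Rightarrow> 'a \<Rightarrow> 'a) \<Rightarrow> bool" where
  "limit_cone X Y g \<longleftrightarrow>
     (\<forall>i. \<forall>x\<in>Car X. \<forall>y\<in>Car X. (g (Suc i) x, g (Suc i) y) \<in> Le (Y (Suc i)) \<longrightarrow> (g i x, g i y) \<in> Le (Y i)) \<and>
     (\<forall>i. \<forall>x\<in>Car X. \<forall>y\<in>Car X. g (Suc i) x = g (Suc i) y \<longrightarrow> g i x = g i y) \<and>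
     (\<forall>x\<in>Car X. \<forall>y\<in>Car X. (\<forall>i. (g i x, g i y) \<in> Le (Y i)) \<longrightarrow> (x, y) \<in> Le X) \<and>
     (\<forall>x\<in>Car X. \<forall>y\<in>Car X. (\<forall>i. g i x = g i y) \<longrightarrow> x = y)"

lemma limit_coneD:
  assumes "limit_cone X Y g" "x \<in> Car X" "y \<in> Car X"
  shows "(g (Suc i) x, g (Suc i) y) \<in> Le (Y (Suc i)) \<Longrightarrow> (g i x, g i y) \<in> Le (Y i)"
    "g (Suc i) x = g (Suc i) y \<Longrightarrow> g i x = g i y"
    "(\<And>i. (g i x, g i y) \<in> Le (Y i)) \<Longrightarrow> (x, y) \<in> Le X"
    "(\<And>i. g i x = g i y) \<Longrightarrow> x = y"
  using assms unfolding limit_cone_def by blast+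

lemma fimage_eq_iff:
  "g |`| S = g |`| T \<longleftrightarrow> (\<forall>x\<in>fset S. \<exists>y\<in>fset T. g x = g y) \<and> (\<forall>y\<in>fset T. \<exists>x\<in>fset S. g y = g x)"
proof -
  have "g |`| S = g |`| T \<longleftrightarrow> g ` fset S = g ` fset T"
    by (metis fimage.rep_eq fset_inverse)
  also have "\<dots> \<longleftrightarrow> (\<forall>x\<in>fset S. g x \<in> g ` fset T) \<and> (\<forall>y\<in>fset T. g y \<in> g ` fset S)"
    by (simp only: set_eq_subset image_subset_iff)
  finally show ?thesis by (simp only: image_iff)
qed

text \<open>For a fixed member of the one set, the partners in the other that work at stage
  \<open>i\<close> form a decreasing sequence of nonempty finite sets, so some partner works at
  every stage.\<close>

lemma limit_cone_Pf:
  assumes g: "limit_cone X Y g" and g_in: "\<And>i x. x \<in> Car X \<Longrightarrow> g i x \<in> Car (Y i)"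
  shows "limit_cone (Pf X) (\<lambda>i. Pf (Y i)) (\<lambda>i. uimage (g i))"
proof -
  have le: "(uimage (g i) (USet S), uimage (g i) (USet T)) \<in> Le (Pf (Y i)) \<longleftrightarrow>
      (\<forall>x\<in>fset S. \<exists>y\<in>fset T. (g i x, g i y) \<in> Le (Y i))"
    if "fset S \<subseteq> Car X" "fset T \<subseteq> Car X" for i S T
    using that g_in by (auto simp: image_subset_iff subset_iff)
  have eq: "uimage (g i) (USet S) = uimage (g i) (USet T) \<longleftrightarrow>
      (\<forall>x\<in>fset S. \<exists>y\<in>fset T. g i x = g i y) \<and> (\<forall>y\<in>fset T. \<exists>x\<in>fset S. g i y = g i x)" for i S T
    using fimage_eq_iff[of "g i" S T] by simp
  \<comment> \<open>The order on finite sets is not antisymmetric in general, so equality does not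
    follow from it; inclusions are shown instead.\<close>
  have lim_eq: "fset S \<subseteq> fset T"
    if S: "fset S \<subseteq> Car X" and T: "fset T \<subseteq> Car X" and i: "\<And>i. \<forall>x\<in>fset S. \<exists>y\<in>fset T. g i x = g i y" for S T
  proof
    fix x assume x: "x \<in> fset S"
    have "\<forall>x\<in>fset S. \<exists>y\<in>fset T. \<forall>i. g i x = g i y"
      using i by (rule fset_limit) (meson S T subsetD limit_coneD(2)[OF g])
    then obtain y where y: "y \<in> fset T" "\<And>i. g i x = g i y" using x by blast
    have "x = y"
      by (rule limit_coneD(4)[OF g subsetD[OF S x] subsetD[OF T y(1)] y(2)])
    then show "x \<in> fset T" using y by simp
  qed
  show ?thesis
    unfolding limit_cone_def
  proof (intro conjI ballI allI impI)
    fix i a b assume "a \<in> Car (Pf X)" "b \<in> Car (Pf X)"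
    then obtain S T where a: "a = USet S" and S: "fset S \<subseteq> Car X" and b: "b = USet T" and T: "fset T \<subseteq> Car X"
      by (elim Pf_cases) blast
    {
      assume "(uimage (g (Suc i)) a, uimage (g (Suc i)) b) \<in> Le (Pf (Y (Suc i)))"
      then show "(uimage (g i) a, uimage (g i) b) \<in> Le (Pf (Y i))"
        unfolding a b le[OF S T] by (meson S T subsetD limit_coneD(1)[OF g])
    next
      assume "uimage (g (Suc i)) a = uimage (g (Suc i)) b"
      then show "uimage (g i) a = uimage (g i) b"
        unfolding a b eq by (meson S T subsetD limit_coneD(2)[OF g])
    }
  next
    fix a b assume "a \<in> Car (Pf X)" "b \<in> Car (Pf X)"
    then obtain S T where a: "a = USet S" and S: "fset S \<subseteq> Car X" and b: "b = USet T" and T: "fset T \<subseteq> Car X"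
      by (elim Pf_cases) blast
    {
      assume "\<forall>i. (uimage (g i) a, uimage (g i) b) \<in> Le (Pf (Y i))"
      then have i: "\<forall>x\<in>fset S. \<exists>y\<in>fset T. (g i x, g i y) \<in> Le (Y i)" for i
        unfolding a b le[OF S T] by blast
      have "\<forall>x\<in>fset S. \<exists>y\<in>fset T. \<forall>i. (g i x, g i y) \<in> Le (Y i)"
        using i by (rule fset_limit) (meson S T subsetD limit_coneD(1)[OF g])
      then have "\<forall>x\<in>fset S. \<exists>y\<in>fset T. (x, y) \<in> Le X"
        by (meson S T subsetD limit_coneD(3)[OF g])
      then show "(a, b) \<in> Le (Pf X)" unfolding a b Pf_Le_iff using S T by blast
    next
      assume "\<forall>i. uimage (g i) a = uimage (g i) b"
      then have "(\<forall>x\<in>fset S. \<exists>y\<in>fset T. g i x = g i y) \<and> (\<forall>y\<in>fset T. \<exists>x\<in>fset S. g i y = g i x)" for i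
        unfolding a b eq by (rule spec)
      note i = this[THEN conjunct1] this[THEN conjunct2]
      have "fset S = fset T"
        using lim_eq[OF S T i(1)] lim_eq[OF T S i(2)] by (rule equalityI)
      then show "a = b" unfolding a b by (simp add: fset_inject)
    }
  qed
qed

text \<open>\<open>amalg_limit\<close>, applied once to the orders and once to equality. Inheritance
  from one stage to the previous one is supplied by the connecting arrows, through which the
  projections factor.\<close>

lemma limit_cone_int:
  assumes H: "is_func \<Sigma> H"
  shows "limit_cone (int_ob (cofree H) n) (\<lambda>i. int_ob (stage H i) n) (\<lambda>i. int_comp (proj H i) n)"
proof -
  note Z = is_func_cofree[OF H] and S = is_func_stage[OF H]
  have down: "int_comp (proj H i) n x = int_comp (chain \<Sigma> H i) n (int_comp (proj H (Suc i)) n x)"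
    if "x \<in> Car (int_ob (cofree H) n)" for i x
    by (rule int_comp_Cmp[OF proj_hom[OF H] chain_hom[OF H] that, unfolded chain_proj[OF H]])
  have nat: "fmap (stage H i) m (J k) (cmpt (proj H i) n x) = cmpt (proj H i) m (fmap (cofree H) m (J k) x)"
    if "k \<in> inj_maps n m" "x \<in> Car (fob (cofree H) n)" for i n m k x
    by (rule proj_strict[OF H J_inj_in_L[OF that(1)] that(2)])
  have pdown: "cmpt (chain \<Sigma> H i) n (cmpt (proj H (Suc i)) n x) = cmpt (proj H i) n x"
    if "x \<in> Car (fob (cofree H) n)" for i n x
    using that chain_beh[OF H] by (auto elim!: cofree_cases)
  show ?thesis
    unfolding limit_cone_def
  proof (intro conjI ballI allI impI)
    fix i x y assume xy: "x \<in> Car (int_ob (cofree H) n)" "y \<in> Car (int_ob (cofree H) n)"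
    {
      assume "(int_comp (proj H (Suc i)) n x, int_comp (proj H (Suc i)) n y) \<in> Le (int_ob (stage H (Suc i)) n)"
      then show "(int_comp (proj H i) n x, int_comp (proj H i) n y) \<in> Le (int_ob (stage H i) n)"
        unfolding down[OF xy(1), of i] down[OF xy(2), of i] by (rule int_comp_mono[OF chain_hom[OF H]])
    next
      assume "int_comp (proj H (Suc i)) n x = int_comp (proj H (Suc i)) n y"
      then show "int_comp (proj H i) n x = int_comp (proj H i) n y"
        unfolding down[OF xy(1), of i] down[OF xy(2), of i] by simp
    }
  next
    fix x y assume "x \<in> Car (int_ob (cofree H) n)" "y \<in> Car (int_ob (cofree H) n)"
    then obtain k u l v where u: "0 < k" "u \<in> Car (fob (cofree H) (n + k))" "x = \<rho> (cofree H) n (n + k) [0..<n] u"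
      and v: "v \<in> Car (fob (cofree H) (n + l))" "y = \<rho> (cofree H) n (n + l) [0..<n] v"
      using int_cases[OF Z] by metis
    \<comment> \<open>\<open>int_cases\<close> provides a representative of \<open>x\<close> with at
      least one fresh variable, so this context is positive even for \<open>n = 0\<close>.\<close>
    have pos: "0 < n + k" using u(1) by simp
    have up: "[0..<n] \<in> inj_maps n (n + l)" for l by (rule upt_inj_maps) simp
    have pu: "cmpt (proj H i) m w \<in> Car (fob (stage H i) m)" if "w \<in> Car (fob (cofree H) m)" for i m w
      by (rule lax_familyD(2)[OF hom_LaxD(5)[OF proj_hom[OF H]] that])
    {
      assume "\<forall>i. (int_comp (proj H i) n x, int_comp (proj H i) n y) \<in> Le (int_ob (stage H i) n)"
      then have am: "amalg (stage H i) (\<lambda>m x y. (x, y) \<in> Le (fob (stage H i) m)) n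
          (URep (n + k) [0..<n] (cmpt (proj H i) (n + k) u)) (URep (n + l) [0..<n] (cmpt (proj H i) (n + l) v))" for i
        unfolding u(3) v(2) int_comp_\<rho>_lax[OF proj_hom[OF H] up u(2)] int_comp_\<rho>_lax[OF proj_hom[OF H] up v(1)]
          int_Le_iff[OF up up pu[OF u(2)] pu[OF v(1)]] colim_le_iff_amalg[OF S] by blast
      have "amalg (cofree H) (\<lambda>m x y. (x, y) \<in> Le (fob (cofree H) m)) n (URep (n + k) [0..<n] u) (URep (n + l) [0..<n] v)"
      proof (rule amalg_limit[OF Z S stable_rel_Le[OF S] nat _ _ u(2) v(1) up up pos am])
        fix i n x y
        assume xy: "x \<in> Car (fob (cofree H) n)" "y \<in> Car (fob (cofree H) n)"
          "(cmpt (proj H (Suc i)) n x, cmpt (proj H (Suc i)) n y) \<in> Le (fob (stage H (Suc i)) n)"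
        show "(cmpt (proj H i) n x, cmpt (proj H i) n y) \<in> Le (fob (stage H i) n)"
          using lax_familyD(3)[OF hom_LaxD(5)[OF chain_hom[OF H]] xy(3)] unfolding pdown[OF xy(1)] pdown[OF xy(2)] .
      qed (auto elim!: cofree_cases)
      then show "(x, y) \<in> Le (int_ob (cofree H) n)"
        unfolding u(3) v(2) int_Le_iff[OF up up u(2) v(1)] colim_le_iff_amalg[OF Z] .
    next
      assume "\<forall>i. int_comp (proj H i) n x = int_comp (proj H i) n y"
      then have am: "amalg (stage H i) (\<lambda>m. (=)) n
          (URep (n + k) [0..<n] (cmpt (proj H i) (n + k) u)) (URep (n + l) [0..<n] (cmpt (proj H i) (n + l) v))" for i
        unfolding u(3) v(2) int_comp_\<rho>_lax[OF proj_hom[OF H] up u(2)] int_comp_\<rho>_lax[OF proj_hom[OF H] up v(1)]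
          \<rho>_eq_iff[OF up up pu[OF u(2)] pu[OF v(1)]] colim_eq_iff_amalg[OF S] by blast
      have "amalg (cofree H) (\<lambda>m. (=)) n (URep (n + k) [0..<n] u) (URep (n + l) [0..<n] v)"
      proof (rule amalg_limit[OF Z S stable_rel_eq nat _ _ u(2) v(1) up up pos am])
        fix i n x y
        assume xy: "x \<in> Car (fob (cofree H) n)" "y \<in> Car (fob (cofree H) n)"
          "cmpt (proj H (Suc i)) n x = cmpt (proj H (Suc i)) n y"
        show "cmpt (proj H i) n x = cmpt (proj H i) n y"
          unfolding pdown[OF xy(1), of i, symmetric] pdown[OF xy(2), of i, symmetric] xy(3) ..
      qed (auto elim!: cofree_cases)
      then show "x = y"
        unfolding u(3) v(2) \<rho>_eq_iff[OF up up u(2) v(1)] colim_eq_iff_amalg[OF Z] .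
    }
  qed
qed

lemma limit_cone_PfPfInt:
  assumes H: "is_func \<Sigma> H"
  shows "limit_cone (fob (PfPfInt_ob (cofree H)) n) (\<lambda>i. fob (PfPfInt_ob (stage H i)) n)
    (\<lambda>i. uimage (uimage (int_comp (proj H i) n)))"
proof -
  have *: "int_comp (proj H i) n x \<in> Car (int_ob (stage H i) n)" if "x \<in> Car (int_ob (cofree H) n)" for i x
    using lax_familyD(2)[OF int_comp_family[OF proj_hom[OF H]], of x n] that by simp
  have "limit_cone (Pf (Pf (int_ob (cofree H) n))) (\<lambda>i. Pf (Pf (int_ob (stage H i) n)))
      (\<lambda>i. uimage (uimage (int_comp (proj H i) n)))"
    by (intro limit_cone_Pf limit_cone_int[OF H] *) (auto intro: uimage_in *)
  then show ?thesis by (simp add: PfPfInt_ob_Pf_func)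
qed

text \<open>
  The description is definite: the decomposition of \<open>s\<close> in \<open>beh\<close> provides \<open>w\<close>, and the
  projections are jointly injective on \<open>PfPfInt_ob (cofree H)\<close>.
\<close>

definition struct :: "('f, ('f, 'p, 'u) univ) func \<Rightarrow> ('f, ('f, 'p, 'u) univ) lax" where
  "struct H = lax_of (cofree H) (PfPfInt_ob (cofree H)) (\<lambda>n a. case a of
     USeq s \<Rightarrow> (THE w. w \<in> Car (fob (PfPfInt_ob (cofree H)) n) \<and>
       (\<forall>i. s (Suc i) = UPair (s 0) (uimage (uimage (int_comp (proj H i) n)) w)))
   | _ \<Rightarrow> a)"

lemma cmpt_struct:
  assumes H: "is_func \<Sigma> H" and s: "beh H n s"
  shows "cmpt (struct H) n (USeq s) \<in> Car (fob (PfPfInt_ob (cofree H)) n)"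
    "s (Suc i) = UPair (s 0) (uimage (uimage (int_comp (proj H i) n)) (cmpt (struct H) n (USeq s)))"
proof -
  let ?P = "\<lambda>w. w \<in> Car (fob (PfPfInt_ob (cofree H)) n) \<and>
       (\<forall>i. s (Suc i) = UPair (s 0) (uimage (uimage (int_comp (proj H i) n)) w))"
  obtain W where W: "\<And>i. s (Suc i) = UPair (s 0) (node (stage H i) n (\<lambda>_ z. z i) W)"
    "\<And>V k z. V \<in> fset W \<Longrightarrow> (k, z) \<in> fset V \<Longrightarrow> beh H (n + k) z"
    using s by (auto elim: beh.cases)
  have node: "uimage (uimage (int_comp (proj H i) n)) (node (cofree H) n (\<lambda>_ z. USeq z) W) =
      node (stage H i) n (\<lambda>_ z. z i) W" for i
    by (rule int_comp_proj_node[OF H W(2)])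
  have "?P (node (cofree H) n (\<lambda>_ z. USeq z) W)"
  proof (intro conjI allI)
    show "node (cofree H) n (\<lambda>_ z. USeq z) W \<in> Car (fob (PfPfInt_ob (cofree H)) n)"
      using W(2) by (intro node_in) simp
    show "s (Suc i) = UPair (s 0) (uimage (uimage (int_comp (proj H i) n)) (node (cofree H) n (\<lambda>_ z. USeq z) W))" for i
      unfolding node by (rule W(1))
  qed
  moreover have "w = w'" if "?P w" "?P w'" for w w'
  proof (rule limit_coneD(4)[OF limit_cone_PfPfInt[OF H]])
    show "w \<in> Car (fob (PfPfInt_ob (cofree H)) n)" "w' \<in> Car (fob (PfPfInt_ob (cofree H)) n)"
      using that by blast+
    show "uimage (uimage (int_comp (proj H i) n)) w = uimage (uimage (int_comp (proj H i) n)) w'" for i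
    proof -
      have "UPair (s 0) (uimage (uimage (int_comp (proj H i) n)) w) =
          UPair (s 0) (uimage (uimage (int_comp (proj H i) n)) w')"
        using that[THEN conjunct2, THEN spec, of i] by (rule HOL.trans[OF HOL.sym])
      then show ?thesis by simp
    qed
  qed
  ultimately have "\<exists>!w. ?P w" by blast
  then have P: "?P (THE w. ?P w)" by (rule theI')
  have eq: "cmpt (struct H) n (USeq s) = (THE w. ?P w)"
    using s by (simp add: struct_def)
  show "cmpt (struct H) n (USeq s) \<in> Car (fob (PfPfInt_ob (cofree H)) n)"
    unfolding eq by (rule P[THEN conjunct1])
  show "s (Suc i) = UPair (s 0) (uimage (uimage (int_comp (proj H i) n)) (cmpt (struct H) n (USeq s)))"
    unfolding eq by (rule P[THEN conjunct2, rule_format])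
qed

text \<open>Monotonicity and naturality are checked after all projections, which jointly reflect
  order and equality. The structure map turns out strict along all arrows, as the projections
  are.\<close>

lemma struct_hom:
  assumes H: "is_func \<Sigma> H"
  shows "struct H \<in> hom (Lax_Inj \<Sigma>) (cofree H) (PfPfInt_ob (cofree H))"
proof -
  note Z = is_func_cofree[OF H] and E = is_func_PfPfInt[OF is_func_cofree[OF H]]
  have "lax_family \<Sigma> (cofree H) (PfPfInt_ob (cofree H)) (cmpt (struct H))"
  proof (rule lax_family_strictI[OF E])
    fix n x assume "x \<in> Car (fob (cofree H) n)"
    then show "cmpt (struct H) n x \<in> Car (fob (PfPfInt_ob (cofree H)) n)"
      by (auto elim!: cofree_cases intro: cmpt_struct(1)[OF H])
  next
    fix n x y assume "(x, y) \<in> Le (fob (cofree H) n)"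
    then obtain s t where x: "x = USeq s" "y = USeq t" and s: "beh H n s" and t: "beh H n t"
      and le: "\<And>i. (s i, t i) \<in> Le (fob (stage H i) n)"
      by (rule cofree_Le_cases) blast
    show "(cmpt (struct H) n x, cmpt (struct H) n y) \<in> Le (fob (PfPfInt_ob (cofree H)) n)"
      unfolding x
    proof (rule limit_coneD(3)[OF limit_cone_PfPfInt[OF H] cmpt_struct(1)[OF H s] cmpt_struct(1)[OF H t]])
      fix i
      have "(UPair (s 0) (uimage (uimage (int_comp (proj H i) n)) (cmpt (struct H) n (USeq s))),
          UPair (t 0) (uimage (uimage (int_comp (proj H i) n)) (cmpt (struct H) n (USeq t))))
          \<in> Le (fob (prod_func H (PfPfInt_ob (stage H i))) n)"
        using le[of "Suc i"] unfolding cmpt_struct(2)[OF H s, of i] cmpt_struct(2)[OF H t, of i] by simp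
      then show "(uimage (uimage (int_comp (proj H i) n)) (cmpt (struct H) n (USeq s)),
          uimage (uimage (int_comp (proj H i) n)) (cmpt (struct H) n (USeq t)))
          \<in> Le (fob (PfPfInt_ob (stage H i)) n)"
        unfolding prod_func_simps by (rule conjunct2)
    qed
  next
    fix n m f x assume f: "f \<in> L \<Sigma> n m" and "x \<in> Car (fob (cofree H) m)"
    then obtain s where x: "x = USeq s" and s: "beh H m s" by (elim cofree_cases) blast
    let ?t = "\<lambda>i. fmap (stage H i) n f (s i)"
    have t: "beh H n ?t" by (rule beh_subst[OF H f s])
    note w = cmpt_struct(1)[OF H s]
    show "fmap (PfPfInt_ob (cofree H)) n f (cmpt (struct H) m x) = cmpt (struct H) n (fmap (cofree H) n f x)"
      unfolding x cofree_simps
    proof (rule limit_coneD(4)[OF limit_cone_PfPfInt[OF H] is_funcD(3)[OF E f w] cmpt_struct(1)[OF H t]])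
      fix i
      have "uimage (uimage (int_comp (proj H i) n)) (fmap (PfPfInt_ob (cofree H)) n f (cmpt (struct H) m (USeq s))) =
          fmap (PfPfInt_ob (stage H i)) n f (uimage (uimage (int_comp (proj H i) m)) (cmpt (struct H) m (USeq s)))"
        unfolding fmap_PfPfInt uimage2_uimage2 using w[unfolded PfPfInt_Car]
        by (rule uimage2_cong)
          (rule int_comp_strict[OF proj_hom[OF H] proj_strict[OF H] f, symmetric])
      moreover have "UPair (?t 0) (uimage (uimage (int_comp (proj H i) n)) (cmpt (struct H) n (USeq ?t))) =
          fmap (stage H (Suc i)) n f (s (Suc i))"
        using cmpt_struct(2)[OF H t, of i] by simp
      ultimately show "uimage (uimage (int_comp (proj H i) n)) (fmap (PfPfInt_ob (cofree H)) n f (cmpt (struct H) m (USeq s))) =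
          uimage (uimage (int_comp (proj H i) n)) (cmpt (struct H) n (USeq ?t))"
        unfolding cmpt_struct(2)[OF H s, of i] by simp
    qed
  qed
  moreover have "cmpt (struct H) n \<in> extensional (Car (fob (cofree H) n))" for n
    by (simp add: struct_def)
  ultimately show ?thesis
    using Z E by (simp add: hom_Lax_Inj is_lax_iff struct_def)
qed

text \<open>The defining property of the structure map, read as the recursion of
  \<open>approx\<close>: the projections are the approximations of the cofree coalgebra
  itself.\<close>

lemma proj_Suc:
  assumes H: "is_func \<Sigma> H"
  shows "proj H (Suc i) = pairing (proj H 0) (Cmp (Lax_Inj \<Sigma>) (Fa PfPfInt (proj H i)) (struct H))"
proof (rule lax_eqI[OF proj_hom[OF H]])
  note c = Cmp_hom[OF struct_hom[OF H] Fa_hom[OF proj_hom[OF H]]]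
  note p0 = proj_hom[OF H, of 0, unfolded stage.simps(1)]
  show "pairing (proj H 0) (Cmp (Lax_Inj \<Sigma>) (Fa PfPfInt (proj H i)) (struct H))
      \<in> hom (Lax_Inj \<Sigma>) (cofree H) (stage H (Suc i))"
    using pairing_hom[OF p0 c] by simp
  fix n x assume x: "x \<in> Car (fob (cofree H) n)"
  then obtain s where s: "x = USeq s" "beh H n s" by (rule cofree_cases)
  show "cmpt (proj H (Suc i)) n x =
      cmpt (pairing (proj H 0) (Cmp (Lax_Inj \<Sigma>) (Fa PfPfInt (proj H i)) (struct H))) n x"
    unfolding s(1) cmpt_pairing[OF p0 x[unfolded s(1)]] cmpt_Cmp[OF struct_hom[OF H] x[unfolded s(1)]]
      cmpt_Fa[OF proj_hom[OF H] cmpt_struct(1)[OF H s(2)]] cmpt_proj[OF s(2)]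
    by (rule cmpt_struct(2)[OF H s(2)])
qed

lemma proj_approx:
  assumes H: "is_func \<Sigma> H"
  shows "proj H i = approx \<Sigma> (struct H) (proj H 0) i"
  by (induction i) (simp_all add: proj_Suc[OF H])

text \<open>By coinduction on all such sequences. A single family of representatives for
  \<open>cmpt c n x\<close> serves every \<open>i\<close>, because the approximations differ only in
  what is done to the children.\<close>

lemma beh_approx:
  assumes c: "c \<in> hom (Lax_Inj \<Sigma>) X (PfPfInt_ob X)" and h: "h \<in> hom (Lax_Inj \<Sigma>) X H"
    and x: "x \<in> Car (fob X n)"
  shows "beh H n (\<lambda>i. cmpt (approx \<Sigma> c h i) n x)"
proof (rule beh_coinduct[where X = "\<lambda>n s. \<exists>x\<in>Car (fob X n). s = (\<lambda>i. cmpt (approx \<Sigma> c h i) n x)"])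
  show "\<exists>y\<in>Car (fob X n). (\<lambda>i. cmpt (approx \<Sigma> c h i) n x) = (\<lambda>i. cmpt (approx \<Sigma> c h i) n y)"
    using x by blast
next
  note X = hom_LaxD(1)[OF h] and a = approx_hom[OF c h]
  fix n s assume "\<exists>x\<in>Car (fob X n). s = (\<lambda>i. cmpt (approx \<Sigma> c h i) n x)"
  then obtain x where x: "x \<in> Car (fob X n)" and s: "s = (\<lambda>i. cmpt (approx \<Sigma> c h i) n x)" by blast
  note cx = lax_familyD(2)[OF hom_LaxD(5)[OF c] x]
  obtain W where W: "cmpt c n x = node X n (\<lambda>_ z. z) W"
    "\<And>V k z. V \<in> fset W \<Longrightarrow> (k, z) \<in> fset V \<Longrightarrow> z \<in> Car (fob X (n + k))"
    using node_surj[OF X cx] by metis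
  let ?\<phi> = "\<lambda>k z i. cmpt (approx \<Sigma> c h i) (n + k) z"
  let ?W = "(\<lambda>V. (\<lambda>(k, z). (k, ?\<phi> k z)) |`| V) |`| W"
  have "s i \<in> Car (fob (stage H i) n)" for i
    unfolding s by (rule lax_familyD(2)[OF hom_LaxD(5)[OF a] x])
  moreover have "s (Suc i) = UPair (s 0) (node (stage H i) n (\<lambda>_ z. z i) ?W)" for i
  proof -
    have "uimage (uimage (int_comp (approx \<Sigma> c h i) n)) (cmpt c n x) = node (stage H i) n (\<lambda>_ z. z i) ?W"
      unfolding W(1)
      by (rule uimage_node) (rule int_comp_\<rho>_lax[OF a upt_inj_maps W(2)], simp_all)
    then show ?thesis
      unfolding s approx.simps cmpt_pairing[OF h x] cmpt_Cmp[OF c x] cmpt_Fa[OF a cx] by simp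
  qed
  moreover have "\<exists>x\<in>Car (fob X (n + k)). z = (\<lambda>i. cmpt (approx \<Sigma> c h i) (n + k) x)"
    if V: "V \<in> fset ?W" "(k, z) \<in> fset V" for V k z
  proof -
    obtain V' z' where "V' \<in> fset W" "(k, z') \<in> fset V'" "z = ?\<phi> k z'" using V by auto
    then show ?thesis using W(2) by blast
  qed
  ultimately show "\<exists>W. (\<forall>i. s i \<in> Car (fob (stage H i) n)) \<and>
      (\<forall>i. s (Suc i) = UPair (s 0) (node (stage H i) n (\<lambda>_ z. z i) W)) \<and>
      (\<forall>V k z. V \<in> fset W \<longrightarrow> (k, z) \<in> fset V \<longrightarrow>
        (\<exists>x\<in>Car (fob X (n + k)). z = (\<lambda>i. cmpt (approx \<Sigma> c h i) (n + k) x)))"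
    by blast
qed

definition unfold ::
    "('f \<times> nat) set \<Rightarrow> ('f, ('f, 'p, 'u) univ) func \<Rightarrow> ('f, ('f, 'p, 'u) univ) func
       \<Rightarrow> ('f, ('f, 'p, 'u) univ) lax \<Rightarrow> ('f, ('f, 'p, 'u) univ) lax \<Rightarrow> ('f, ('f, 'p, 'u) univ) lax" where
  "unfold \<Sigma> X H c h = lax_of X (cofree H) (\<lambda>n x. USeq (\<lambda>i. cmpt (approx \<Sigma> c h i) n x))"

text \<open>The order of the carrier is taken stage by stage, so the lax inequalities of the
  approximations together give the one for the unfolding.\<close>

lemma unfold_hom:
  assumes c: "c \<in> hom (Lax_Inj \<Sigma>) X (PfPfInt_ob X)" and h: "h \<in> hom (Lax_Inj \<Sigma>) X H"
  shows "unfold \<Sigma> X H c h \<in> hom (Lax_Inj \<Sigma>) X (cofree H)"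
  unfolding unfold_def
proof (rule lax_of_hom[OF hom_LaxD(1)[OF h] is_func_cofree[OF hom_LaxD(2)[OF h]]], rule lax_familyI)
  note X = hom_LaxD(1)[OF h] and H = hom_LaxD(2)[OF h] and a = lax_familyD[OF hom_LaxD(5)[OF approx_hom[OF c h]]]
    and b = beh_approx[OF c h]
  {
    fix n x assume "x \<in> Car (fob X n)"
    then show "USeq (\<lambda>i. cmpt (approx \<Sigma> c h i) n x) \<in> Car (fob (cofree H) n)" by (simp add: b)
  next
    fix n x y assume "(x, y) \<in> Le (fob X n)"
    then show "(USeq (\<lambda>i. cmpt (approx \<Sigma> c h i) n x), USeq (\<lambda>i. cmpt (approx \<Sigma> c h i) n y)) \<in> Le (fob (cofree H) n)"
      using preorder_onD(1,2)[OF is_funcD(1)[OF X]] a(3) by (simp add: b)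
  next
    fix n m f x assume f: "f \<in> L \<Sigma> n m" and x: "x \<in> Car (fob X m)"
    show "(fmap (cofree H) n f (USeq (\<lambda>i. cmpt (approx \<Sigma> c h i) m x)),
        USeq (\<lambda>i. cmpt (approx \<Sigma> c h i) n (fmap X n f x))) \<in> Le (fob (cofree H) n)"
      using b[OF x] b[OF is_funcD(3)[OF X f x]] a(4)[OF f x] by (simp add: beh_subst[OF H f])
  next
    fix n m i x assume "i \<in> inj_maps n m" "x \<in> Car (fob X n)"
    then show "fmap (cofree H) m (J i) (USeq (\<lambda>i. cmpt (approx \<Sigma> c h i) n x)) =
        USeq (\<lambda>j. cmpt (approx \<Sigma> c h j) m (fmap X m (J i) x))"
      using a(5) by simp
  }
qed

lemma cmpt_unfold: "x \<in> Car (fob X n) \<Longrightarrow> cmpt (unfold \<Sigma> X H c h) n x = USeq (\<lambda>i. cmpt (approx \<Sigma> c h i) n x)"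
  by (simp add: unfold_def)

lemma proj_unfold:
  assumes c: "c \<in> hom (Lax_Inj \<Sigma>) X (PfPfInt_ob X)" and h: "h \<in> hom (Lax_Inj \<Sigma>) X H"
  shows "Cmp (Lax_Inj \<Sigma>) (proj H i) (unfold \<Sigma> X H c h) = approx \<Sigma> c h i"
proof (rule lax_eqI[OF Cmp_hom[OF unfold_hom[OF c h] proj_hom[OF hom_LaxD(2)[OF h]]] approx_hom[OF c h]])
  fix n x assume x: "x \<in> Car (fob X n)"
  show "cmpt (Cmp (Lax_Inj \<Sigma>) (proj H i) (unfold \<Sigma> X H c h)) n x = cmpt (approx \<Sigma> c h i) n x"
    unfolding cmpt_Cmp[OF unfold_hom[OF c h] x] cmpt_unfold[OF x] cmpt_proj[OF beh_approx[OF c h x]] ..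
qed

text \<open>After applying \<open>proj H i\<close> to the children, both sides become the second
  component of the approximation \<open>Suc i\<close> at \<open>x\<close>; the projections separate
  the elements of \<open>PfPfInt_ob (cofree H)\<close>.\<close>

lemma struct_unfold:
  assumes c: "c \<in> hom (Lax_Inj \<Sigma>) X (PfPfInt_ob X)" and h: "h \<in> hom (Lax_Inj \<Sigma>) X H"
  shows "Cmp (Lax_Inj \<Sigma>) (struct H) (unfold \<Sigma> X H c h) = Cmp (Lax_Inj \<Sigma>) (Fa PfPfInt (unfold \<Sigma> X H c h)) c"
proof -
  note H = hom_LaxD(2)[OF h] and u = unfold_hom[OF c h]
  show ?thesis
  proof (rule lax_eqI[OF Cmp_hom[OF u struct_hom[OF H]] Cmp_hom[OF c Fa_hom[OF u]]])
    fix n x assume x: "x \<in> Car (fob X n)"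
    note b = beh_approx[OF c h x] and cx = lax_familyD(2)[OF hom_LaxD(5)[OF c] x]
    let ?s = "\<lambda>i. cmpt (approx \<Sigma> c h i) n x"
    show "cmpt (Cmp (Lax_Inj \<Sigma>) (struct H) (unfold \<Sigma> X H c h)) n x =
        cmpt (Cmp (Lax_Inj \<Sigma>) (Fa PfPfInt (unfold \<Sigma> X H c h)) c) n x"
      unfolding cmpt_Cmp[OF u x] cmpt_Cmp[OF c x] cmpt_unfold[OF x]
    proof (rule limit_coneD(4)[OF limit_cone_PfPfInt[OF H] cmpt_struct(1)[OF H b]
          lax_familyD(2)[OF hom_LaxD(5)[OF Fa_hom[OF u]] cx]])
      fix i
      have "uimage (uimage (int_comp (proj H i) n)) (cmpt (Fa PfPfInt (unfold \<Sigma> X H c h)) n (cmpt c n x)) =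
          uimage (uimage (int_comp (approx \<Sigma> c h i) n)) (cmpt c n x)"
        unfolding cmpt_Fa[OF u cx] uimage2_uimage2 using cx[unfolded PfPfInt_Car]
        by (rule uimage2_cong)
          (rule int_comp_Cmp[OF u proj_hom[OF H], unfolded proj_unfold[OF c h], symmetric])
      moreover have "?s (Suc i) = UPair (?s 0) (uimage (uimage (int_comp (approx \<Sigma> c h i) n)) (cmpt c n x))"
        unfolding approx.simps cmpt_pairing[OF h x] cmpt_Cmp[OF c x] cmpt_Fa[OF approx_hom[OF c h] cx] ..
      ultimately show "uimage (uimage (int_comp (proj H i) n)) (cmpt (struct H) n (USeq ?s)) =
          uimage (uimage (int_comp (proj H i) n)) (cmpt (Fa PfPfInt (unfold \<Sigma> X H c h)) n (cmpt c n x))"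
        using cmpt_struct(2)[OF H b, of i] by simp
    qed
  qed
qed

text \<open>An element of the carrier is the sequence of its projections, and
  \<open>approx_Cmp\<close> forces the projections of any coalgebra map over \<open>h\<close> to be
  the approximations of \<open>c\<close>.\<close>

lemma unfold_unique:
  assumes c: "c \<in> hom (Lax_Inj \<Sigma>) X (PfPfInt_ob X)" and h: "h \<in> hom (Lax_Inj \<Sigma>) X H"
    and m: "\<mu> \<in> hom (Lax_Inj \<Sigma>) X (cofree H)"
    and eqs: "Cmp (Lax_Inj \<Sigma>) (struct H) \<mu> = Cmp (Lax_Inj \<Sigma>) (Fa PfPfInt \<mu>) c"
      "Cmp (Lax_Inj \<Sigma>) (proj H 0) \<mu> = h"
  shows "\<mu> = unfold \<Sigma> X H c h"
proof (rule lax_eqI[OF m unfold_hom[OF c h]])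
  note H = hom_LaxD(2)[OF h]
  have p: "Cmp (Lax_Inj \<Sigma>) (proj H i) \<mu> = approx \<Sigma> c h i" for i
    unfolding proj_approx[OF H, of i] eqs(2)[symmetric]
    by (rule approx_Cmp[OF struct_hom[OF H] proj_hom[OF H, of 0, unfolded stage.simps(1)] c m eqs(1)])
  fix n x assume x: "x \<in> Car (fob X n)"
  obtain s where s: "cmpt \<mu> n x = USeq s" "beh H n s"
    using lax_familyD(2)[OF hom_LaxD(5)[OF m] x] by (rule cofree_cases)
  have "s i = cmpt (approx \<Sigma> c h i) n x" for i
    unfolding p[symmetric] cmpt_Cmp[OF m x] s(1) cmpt_proj[OF s(2)] ..
  then show "cmpt \<mu> n x = cmpt (unfold \<Sigma> X H c h) n x"
    unfolding s(1) cmpt_unfold[OF x] by (simp add: ext)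
qed


section \<open>Cofree comonads from cofree coalgebras\<close>

lemma homI: "f \<in> Ar C \<Longrightarrow> Dom C f = x \<Longrightarrow> Cod C f = y \<Longrightarrow> f \<in> hom C x y"
  by (simp add: hom_def)

lemma homD: "f \<in> hom C x y \<Longrightarrow> f \<in> Ar C" "f \<in> hom C x y \<Longrightarrow> Dom C f = x" "f \<in> hom C x y \<Longrightarrow> Cod C f = y"
  by (simp_all add: hom_def)

locale endofunctor_on_category =
  fixes C :: "('o, 'a) category" and E :: "('o, 'a) endofunctor"
  assumes category: "is_category C" and endofunctor: "is_endofunctor C E"
begin

abbreviation comp (infixr "\<cdot>" 55) where "g \<cdot> f \<equiv> Cmp C g f"

lemma cat_simps [simp]:
  "f \<in> Ar C \<Longrightarrow> Dom C f \<in> Ob C" "f \<in> Ar C \<Longrightarrow> Cod C f \<in> Ob C"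
  "x \<in> Ob C \<Longrightarrow> Ide C x \<in> Ar C" "x \<in> Ob C \<Longrightarrow> Dom C (Ide C x) = x" "x \<in> Ob C \<Longrightarrow> Cod C (Ide C x) = x"
  "f \<in> Ar C \<Longrightarrow> g \<in> Ar C \<Longrightarrow> Cod C f = Dom C g \<Longrightarrow> g \<cdot> f \<in> Ar C"
  "f \<in> Ar C \<Longrightarrow> g \<in> Ar C \<Longrightarrow> Cod C f = Dom C g \<Longrightarrow> Dom C (g \<cdot> f) = Dom C f"
  "f \<in> Ar C \<Longrightarrow> g \<in> Ar C \<Longrightarrow> Cod C f = Dom C g \<Longrightarrow> Cod C (g \<cdot> f) = Cod C g"
  "f \<in> Ar C \<Longrightarrow> Dom C f = x \<Longrightarrow> f \<cdot> Ide C x = f" "f \<in> Ar C \<Longrightarrow> Cod C f = y \<Longrightarrow> Ide C y \<cdot> f = f"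
  "f \<in> Ar C \<Longrightarrow> g \<in> Ar C \<Longrightarrow> h \<in> Ar C \<Longrightarrow> Cod C f = Dom C g \<Longrightarrow> Cod C g = Dom C h \<Longrightarrow>
     (h \<cdot> g) \<cdot> f = h \<cdot> (g \<cdot> f)"
  using category unfolding is_category_def hom_def by (simp_all, blast+)

lemma endo_simps [simp]:
  "x \<in> Ob C \<Longrightarrow> Fo E x \<in> Ob C" "f \<in> Ar C \<Longrightarrow> Fa E f \<in> Ar C"
  "f \<in> Ar C \<Longrightarrow> Dom C (Fa E f) = Fo E (Dom C f)" "f \<in> Ar C \<Longrightarrow> Cod C (Fa E f) = Fo E (Cod C f)"
  "x \<in> Ob C \<Longrightarrow> Fa E (Ide C x) = Ide C (Fo E x)"
  using endofunctor unfolding is_endofunctor_def hom_def by simp_all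

lemma Fa_comp:
  "f \<in> Ar C \<Longrightarrow> g \<in> Ar C \<Longrightarrow> Cod C f = Dom C g \<Longrightarrow> Fa E (g \<cdot> f) = Fa E g \<cdot> Fa E f"
  using endofunctor unfolding is_endofunctor_def hom_def by simp

text \<open>The simplifier associates composites to the right, where one side of a commuting square
  is no longer a subterm. This form applies a square in front of a further arrow
  \<open>k\<close>.\<close>

lemma post:
  assumes "a \<cdot> b = c \<cdot> d" "k \<in> Ar C" "a \<in> Ar C" "b \<in> Ar C" "c \<in> Ar C" "d \<in> Ar C"
    "Cod C b = Dom C a" "Cod C d = Dom C c" "Cod C k = Dom C b" "Dom C d = Dom C b"
  shows "a \<cdot> (b \<cdot> k) = c \<cdot> (d \<cdot> k)"
  using assms cat_simps(11)[of k b a] cat_simps(11)[of k d c] by simp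

definition coalg_map :: "'o \<Rightarrow> 'a \<Rightarrow> 'o \<Rightarrow> 'a \<Rightarrow> 'a \<Rightarrow> bool" where
  "coalg_map x c y d m \<longleftrightarrow> m \<in> hom C x y \<and> d \<cdot> m = Fa E m \<cdot> c"

lemma coalg_map_comp:
  assumes "coalg_map x c y d m" "coalg_map y d z e m'"
    "c \<in> hom C x (Fo E x)" "d \<in> hom C y (Fo E y)" "e \<in> hom C z (Fo E z)"
  shows "coalg_map x c z e (m' \<cdot> m)"
proof -
  note h = assms(3-5)[THEN homD(1)] assms(3-5)[THEN homD(2)] assms(3-5)[THEN homD(3)]
  from assms have m: "m \<in> Ar C" "Dom C m = x" "Cod C m = y" "d \<cdot> m = Fa E m \<cdot> c"
    and m': "m' \<in> Ar C" "Dom C m' = y" "Cod C m' = z" "e \<cdot> m' = Fa E m' \<cdot> d"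
    by (auto simp: coalg_map_def hom_def)
  have "e \<cdot> (m' \<cdot> m) = Fa E m' \<cdot> (d \<cdot> m)"
    by (rule post[OF m'(4)]) (simp_all add: h m(1-3) m'(1-3))
  also have "\<dots> = Fa E (m' \<cdot> m) \<cdot> c"
    by (simp add: h m m'(1-3) Fa_comp)
  finally show ?thesis by (simp add: coalg_map_def homI m(1-3) m'(1-3))
qed

lemma coalg_map_Ide:
  assumes "c \<in> hom C x (Fo E x)" "x \<in> Ob C"
  shows "coalg_map x c x c (Ide C x)"
  using assms by (simp add: coalg_map_def hom_def)

end

lemma comonadD:
  assumes "is_comonad C D"
  shows "is_endofunctor C D"
    "x \<in> Ob C \<Longrightarrow> counit D x \<in> hom C (Fo D x) x"
    "x \<in> Ob C \<Longrightarrow> comult D x \<in> hom C (Fo D x) (Fo D (Fo D x))"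
    "f \<in> hom C x y \<Longrightarrow> Cmp C f (counit D x) = Cmp C (counit D y) (Fa D f)"
    "f \<in> hom C x y \<Longrightarrow> Cmp C (Fa D (Fa D f)) (comult D x) = Cmp C (comult D y) (Fa D f)"
    "x \<in> Ob C \<Longrightarrow> Cmp C (counit D (Fo D x)) (comult D x) = Ide C (Fo D x)"
    "x \<in> Ob C \<Longrightarrow> Cmp C (Fa D (counit D x)) (comult D x) = Ide C (Fo D x)"
    "x \<in> Ob C \<Longrightarrow> Cmp C (comult D (Fo D x)) (comult D x) = Cmp C (Fa D (comult D x)) (comult D x)"
  using assms unfolding is_comonad_def is_nat_trans_def by auto

lemma nat_transD:
  assumes "is_nat_trans C D E t"
  shows "x \<in> Ob C \<Longrightarrow> t x \<in> hom C (Fo D x) (Fo E x)"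
    "f \<in> hom C x y \<Longrightarrow> Cmp C (Fa E f) (t x) = Cmp C (t y) (Fa D f)"
  using assms unfolding is_nat_trans_def by auto

lemma endofunctorD:
  assumes "is_endofunctor C D"
  shows "x \<in> Ob C \<Longrightarrow> Fo D x \<in> Ob C" "f \<in> hom C x y \<Longrightarrow> Fa D f \<in> hom C (Fo D x) (Fo D y)"
  using assms unfolding is_endofunctor_def by auto

text \<open>Says in elementary terms that the forgetful functor from \<open>E\<close>-coalgebras has
  a right adjoint: \<open>ana\<close> is the transpose of \<open>h\<close>. The comonad built below
  is that of this adjunction.\<close>

locale cofree_coalgebras = endofunctor_on_category C E
  for C :: "('o, 'a) category" and E :: "('o, 'a) endofunctor" +
  fixes Z :: "'o \<Rightarrow> 'o" and \<epsilon> \<sigma> :: "'o \<Rightarrow> 'a" and ana :: "'o \<Rightarrow> 'o \<Rightarrow> 'a \<Rightarrow> 'a \<Rightarrow> 'a"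
  assumes Z_ob [simp]: "x \<in> Ob C \<Longrightarrow> Z x \<in> Ob C"
    and \<epsilon>_hom: "x \<in> Ob C \<Longrightarrow> \<epsilon> x \<in> hom C (Z x) x"
    and \<sigma>_hom: "x \<in> Ob C \<Longrightarrow> \<sigma> x \<in> hom C (Z x) (Fo E (Z x))"
    and ana_hom: "c \<in> hom C x (Fo E x) \<Longrightarrow> h \<in> hom C x y \<Longrightarrow> ana x y c h \<in> hom C x (Z y)"
    and ana_\<sigma>: "c \<in> hom C x (Fo E x) \<Longrightarrow> h \<in> hom C x y \<Longrightarrow>
      Cmp C (\<sigma> y) (ana x y c h) = Cmp C (Fa E (ana x y c h)) c"
    and ana_\<epsilon>: "c \<in> hom C x (Fo E x) \<Longrightarrow> h \<in> hom C x y \<Longrightarrow> Cmp C (\<epsilon> y) (ana x y c h) = h"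
    and ana_unique: "c \<in> hom C x (Fo E x) \<Longrightarrow> h \<in> hom C x y \<Longrightarrow> m \<in> hom C x (Z y) \<Longrightarrow>
      Cmp C (\<sigma> y) m = Cmp C (Fa E m) c \<Longrightarrow> Cmp C (\<epsilon> y) m = h \<Longrightarrow> m = ana x y c h"
begin

lemma \<epsilon>_simps [simp]:
  "x \<in> Ob C \<Longrightarrow> \<epsilon> x \<in> Ar C" "x \<in> Ob C \<Longrightarrow> Dom C (\<epsilon> x) = Z x" "x \<in> Ob C \<Longrightarrow> Cod C (\<epsilon> x) = x"
  using \<epsilon>_hom by (auto simp: hom_def)

lemma \<sigma>_simps [simp]:
  "x \<in> Ob C \<Longrightarrow> \<sigma> x \<in> Ar C" "x \<in> Ob C \<Longrightarrow> Dom C (\<sigma> x) = Z x" "x \<in> Ob C \<Longrightarrow> Cod C (\<sigma> x) = Fo E (Z x)"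
  using \<sigma>_hom by (auto simp: hom_def)

lemma coalg_map_ana:
  assumes "c \<in> hom C x (Fo E x)" "h \<in> hom C x y"
  shows "coalg_map x c (Z y) (\<sigma> y) (ana x y c h)"
  using ana_hom[OF assms] ana_\<sigma>[OF assms] by (simp add: coalg_map_def)

text \<open>The principle behind the laws below: their two sides are coalgebra maps into a cofree
  coalgebra, so they need only be compared after \<open>\<epsilon>\<close>.\<close>

lemma coalg_map_eqI:
  assumes "c \<in> hom C x (Fo E x)" "y \<in> Ob C"
    "coalg_map x c (Z y) (\<sigma> y) m" "coalg_map x c (Z y) (\<sigma> y) m'" "\<epsilon> y \<cdot> m = \<epsilon> y \<cdot> m'"
  shows "m = m'"
proof -
  have "\<epsilon> y \<cdot> m \<in> hom C x y"
    using assms by (auto simp: coalg_map_def hom_def)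
  then have "m = ana x y c (\<epsilon> y \<cdot> m)" "m' = ana x y c (\<epsilon> y \<cdot> m)"
    using assms by (auto simp: coalg_map_def intro: ana_unique)
  then show ?thesis by simp
qed

definition D :: "('o, 'a) comonad" where
  "D = \<lparr>Fo = Z, Fa = (\<lambda>f. ana (Z (Dom C f)) (Cod C f) (\<sigma> (Dom C f)) (f \<cdot> \<epsilon> (Dom C f))),
        counit = \<epsilon>, comult = (\<lambda>x. ana (Z x) (Z x) (\<sigma> x) (Ide C (Z x)))\<rparr>"

text \<open>Unfolds once and keeps only the counit of the children.\<close>

definition \<kappa> :: "'o \<Rightarrow> 'a" where "\<kappa> x = Fa E (\<epsilon> x) \<cdot> \<sigma> x"

lemma D_simps [simp]: "Fo D = Z" "counit D = \<epsilon>"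
  by (simp_all add: D_def)

lemma Fa_D:
  assumes "f \<in> hom C x y"
  shows "coalg_map (Z x) (\<sigma> x) (Z y) (\<sigma> y) (Fa D f)" "\<epsilon> y \<cdot> Fa D f = f \<cdot> \<epsilon> x"
proof -
  have x: "x \<in> Ob C" and f: "f \<in> Ar C" "Dom C f = x" "Cod C f = y" using assms by (auto simp: hom_def)
  have *: "f \<cdot> \<epsilon> x \<in> hom C (Z x) y" using x f by (intro homI) auto
  show "coalg_map (Z x) (\<sigma> x) (Z y) (\<sigma> y) (Fa D f)" "\<epsilon> y \<cdot> Fa D f = f \<cdot> \<epsilon> x"
    using coalg_map_ana[OF \<sigma>_hom[OF x] *] ana_\<epsilon>[OF \<sigma>_hom[OF x] *] by (simp_all add: D_def f)
qed

lemma Fa_D_hom: "f \<in> hom C x y \<Longrightarrow> Fa D f \<in> hom C (Z x) (Z y)"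
  using Fa_D(1) by (simp add: coalg_map_def)

lemma Fa_D_simps [simp]:
  "f \<in> Ar C \<Longrightarrow> Fa D f \<in> Ar C" "f \<in> Ar C \<Longrightarrow> Dom C (Fa D f) = Z (Dom C f)"
  "f \<in> Ar C \<Longrightarrow> Cod C (Fa D f) = Z (Cod C f)"
  using Fa_D_hom[of f "Dom C f" "Cod C f"] by (auto simp: hom_def)

lemma comult_D:
  assumes x: "x \<in> Ob C"
  shows "coalg_map (Z x) (\<sigma> x) (Z (Z x)) (\<sigma> (Z x)) (comult D x)" "\<epsilon> (Z x) \<cdot> comult D x = Ide C (Z x)"
proof -
  have *: "Ide C (Z x) \<in> hom C (Z x) (Z x)" using x by (intro homI) auto
  show "coalg_map (Z x) (\<sigma> x) (Z (Z x)) (\<sigma> (Z x)) (comult D x)" "\<epsilon> (Z x) \<cdot> comult D x = Ide C (Z x)"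
    using coalg_map_ana[OF \<sigma>_hom[OF x] *] ana_\<epsilon>[OF \<sigma>_hom[OF x] *] by (simp_all add: D_def)
qed

lemma comult_D_hom: "x \<in> Ob C \<Longrightarrow> comult D x \<in> hom C (Z x) (Z (Z x))"
  using comult_D(1) by (simp add: coalg_map_def)

lemma comult_D_simps [simp]:
  "x \<in> Ob C \<Longrightarrow> comult D x \<in> Ar C" "x \<in> Ob C \<Longrightarrow> Dom C (comult D x) = Z x"
  "x \<in> Ob C \<Longrightarrow> Cod C (comult D x) = Z (Z x)"
  using comult_D_hom by (auto simp: hom_def)

lemma \<epsilon>_Fa_D:
  assumes "f \<in> Ar C" "k \<in> Ar C" "Cod C k = Z (Dom C f)" "y = Cod C f" "x = Dom C f"
  shows "\<epsilon> y \<cdot> (Fa D f \<cdot> k) = f \<cdot> (\<epsilon> x \<cdot> k)"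
  using Fa_D(2)[OF homI[OF assms(1) HOL.refl HOL.refl]] assms by (intro post) auto

lemma \<epsilon>_comult:
  assumes "x \<in> Ob C" "k \<in> Ar C" "Cod C k = Z x"
  shows "\<epsilon> (Z x) \<cdot> (comult D x \<cdot> k) = k"
  using assms cat_simps(11)[of k "comult D x" "\<epsilon> (Z x)"] by (simp add: comult_D(2))

lemma endofunctor_D: "is_endofunctor C D"
  unfolding is_endofunctor_def D_simps
proof (intro conjI ballI allI impI)
  fix x assume x: "x \<in> Ob C"
  then show "Z x \<in> Ob C" by simp
  have *: "Ide C x \<in> hom C x x" using x by (intro homI) auto
  show "Fa D (Ide C x) = Ide C (Z x)"
    by (rule coalg_map_eqI[OF \<sigma>_hom[OF x] x Fa_D(1)[OF *] coalg_map_Ide[OF \<sigma>_hom[OF x]]])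
      (use x Fa_D(2)[OF *] in auto)
next
  fix x y f assume "f \<in> hom C x y"
  then show "Fa D f \<in> hom C (Z x) (Z y)" by (rule Fa_D_hom)
next
  fix x y z f g assume f: "f \<in> hom C x y" and g: "g \<in> hom C y z"
  note h = homD[OF f] homD[OF g]
  have x: "x \<in> Ob C" "y \<in> Ob C" "z \<in> Ob C" using h by auto
  have gf: "g \<cdot> f \<in> hom C x z" using h by (intro homI) auto
  show "Fa D (g \<cdot> f) = Fa D g \<cdot> Fa D f"
  proof (rule coalg_map_eqI[OF \<sigma>_hom[OF x(1)] x(3) Fa_D(1)[OF gf]
        coalg_map_comp[OF Fa_D(1)[OF f] Fa_D(1)[OF g] \<sigma>_hom \<sigma>_hom \<sigma>_hom]])
    have "\<epsilon> z \<cdot> (Fa D g \<cdot> Fa D f) = g \<cdot> (\<epsilon> y \<cdot> Fa D f)"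
      using h by (intro \<epsilon>_Fa_D) auto
    also have "\<dots> = g \<cdot> (f \<cdot> \<epsilon> x)" by (simp only: Fa_D(2)[OF f])
    finally show "\<epsilon> z \<cdot> Fa D (g \<cdot> f) = \<epsilon> z \<cdot> (Fa D g \<cdot> Fa D f)"
      using Fa_D(2)[OF gf] h x by simp
  qed (use x in auto)
qed

lemma comonad_D: "is_comonad C D"
  unfolding is_comonad_def
proof (intro conjI ballI)
  show "is_endofunctor C D" by (rule endofunctor_D)
  show "is_nat_trans C D \<lparr>Fo = id, Fa = id\<rparr> (counit D)"
    using \<epsilon>_hom Fa_D(2) by (simp add: is_nat_trans_def)
  show "is_nat_trans C D \<lparr>Fo = Fo D \<circ> Fo D, Fa = Fa D \<circ> Fa D\<rparr> (comult D)"
    unfolding is_nat_trans_def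
  proof (intro conjI ballI allI impI; simp)
    fix x assume "x \<in> Ob C" then show "comult D x \<in> hom C (Z x) (Z (Z x))" by (rule comult_D_hom)
  next
    fix x y f assume f: "f \<in> hom C x y"
    note h = homD[OF f]
    have x: "x \<in> Ob C" "y \<in> Ob C" using h by auto
    show "Fa D (Fa D f) \<cdot> comult D x = comult D y \<cdot> Fa D f"
    proof (rule coalg_map_eqI[OF \<sigma>_hom[OF x(1)] Z_ob[OF x(2)]
          coalg_map_comp[OF comult_D(1)[OF x(1)] Fa_D(1)[OF Fa_D_hom[OF f]] \<sigma>_hom \<sigma>_hom \<sigma>_hom]
          coalg_map_comp[OF Fa_D(1)[OF f] comult_D(1)[OF x(2)] \<sigma>_hom \<sigma>_hom \<sigma>_hom]])
      have "\<epsilon> (Z y) \<cdot> (Fa D (Fa D f) \<cdot> comult D x) = Fa D f \<cdot> (\<epsilon> (Z x) \<cdot> comult D x)"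
        using h x by (intro \<epsilon>_Fa_D) auto
      then show "\<epsilon> (Z y) \<cdot> (Fa D (Fa D f) \<cdot> comult D x) = \<epsilon> (Z y) \<cdot> (comult D y \<cdot> Fa D f)"
        using h x by (simp add: comult_D(2) \<epsilon>_comult)
    qed (use x in auto)
  qed
next
  fix x assume x: "x \<in> Ob C"
  show "counit D (Fo D x) \<cdot> comult D x = Ide C (Fo D x)" using comult_D(2)[OF x] by simp
  have "Fa D (\<epsilon> x) \<cdot> comult D x = Ide C (Z x)"
  proof (rule coalg_map_eqI[OF \<sigma>_hom[OF x] x
        coalg_map_comp[OF comult_D(1)[OF x] Fa_D(1)[OF \<epsilon>_hom[OF x]] \<sigma>_hom \<sigma>_hom \<sigma>_hom]
        coalg_map_Ide[OF \<sigma>_hom[OF x]]])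
    have "\<epsilon> x \<cdot> (Fa D (\<epsilon> x) \<cdot> comult D x) = \<epsilon> x \<cdot> (\<epsilon> (Z x) \<cdot> comult D x)"
      using x by (intro \<epsilon>_Fa_D) auto
    then show "\<epsilon> x \<cdot> (Fa D (\<epsilon> x) \<cdot> comult D x) = \<epsilon> x \<cdot> Ide C (Z x)"
      by (simp only: comult_D(2)[OF x])
  qed (use x in auto)
  then show "Fa D (counit D x) \<cdot> comult D x = Ide C (Fo D x)" by simp
  have "comult D (Z x) \<cdot> comult D x = Fa D (comult D x) \<cdot> comult D x"
  proof (rule coalg_map_eqI[OF \<sigma>_hom[OF x] Z_ob[OF Z_ob[OF x]]
        coalg_map_comp[OF comult_D(1)[OF x] comult_D(1)[OF Z_ob[OF x]] \<sigma>_hom \<sigma>_hom \<sigma>_hom]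
        coalg_map_comp[OF comult_D(1)[OF x] Fa_D(1)[OF comult_D_hom[OF x]] \<sigma>_hom \<sigma>_hom \<sigma>_hom]])
    have "\<epsilon> (Z (Z x)) \<cdot> (Fa D (comult D x) \<cdot> comult D x) = comult D x \<cdot> (\<epsilon> (Z x) \<cdot> comult D x)"
      using x by (intro \<epsilon>_Fa_D) auto
    then show "\<epsilon> (Z (Z x)) \<cdot> (comult D (Z x) \<cdot> comult D x) = \<epsilon> (Z (Z x)) \<cdot> (Fa D (comult D x) \<cdot> comult D x)"
      using x by (simp add: comult_D(2) \<epsilon>_comult)
  qed (use x in auto)
  then show "comult D (Fo D x) \<cdot> comult D x = Fa D (comult D x) \<cdot> comult D x" by simp
qed

lemma \<kappa>_simps [simp]:
  "x \<in> Ob C \<Longrightarrow> \<kappa> x \<in> Ar C" "x \<in> Ob C \<Longrightarrow> Dom C (\<kappa> x) = Z x" "x \<in> Ob C \<Longrightarrow> Cod C (\<kappa> x) = Fo E x"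
  by (simp_all add: \<kappa>_def)

lemma \<kappa>_natural:
  assumes f: "f \<in> hom C x y"
  shows "Fa E f \<cdot> \<kappa> x = \<kappa> y \<cdot> Fa D f"
proof -
  note h = homD[OF f]
  have x: "x \<in> Ob C" "y \<in> Ob C" using h by auto
  have "Fa E f \<cdot> \<kappa> x = Fa E (f \<cdot> \<epsilon> x) \<cdot> \<sigma> x" using h x by (simp add: \<kappa>_def Fa_comp)
  also have "\<dots> = Fa E (\<epsilon> y) \<cdot> (Fa E (Fa D f) \<cdot> \<sigma> x)"
    unfolding Fa_D(2)[OF f, symmetric] using h x by (simp add: Fa_comp)
  also have "Fa E (Fa D f) \<cdot> \<sigma> x = \<sigma> y \<cdot> Fa D f" using Fa_D(1)[OF f] by (simp add: coalg_map_def)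
  also have "Fa E (\<epsilon> y) \<cdot> (\<sigma> y \<cdot> Fa D f) = \<kappa> y \<cdot> Fa D f" using h x by (simp add: \<kappa>_def)
  finally show ?thesis .
qed

lemma nat_trans_\<kappa>: "is_nat_trans C D E \<kappa>"
  using \<kappa>_natural by (auto simp: is_nat_trans_def intro!: homI)

text \<open>Recovers the structure map of the cofree coalgebra from the comonad and
  \<open>\<kappa>\<close>. In a cofree comonad that is merely given, the same composite takes the
  place of a structure map.\<close>

lemma \<kappa>_comult:
  assumes x: "x \<in> Ob C"
  shows "\<kappa> (Z x) \<cdot> comult D x = \<sigma> x"
proof -
  have "\<kappa> (Z x) \<cdot> comult D x = Fa E (\<epsilon> (Z x)) \<cdot> (\<sigma> (Z x) \<cdot> comult D x)" using x by (simp add: \<kappa>_def)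
  also have "\<sigma> (Z x) \<cdot> comult D x = Fa E (comult D x) \<cdot> \<sigma> x"
    using comult_D(1)[OF x] by (simp add: coalg_map_def)
  also have "Fa E (\<epsilon> (Z x)) \<cdot> (Fa E (comult D x) \<cdot> \<sigma> x) = Fa E (\<epsilon> (Z x) \<cdot> comult D x) \<cdot> \<sigma> x"
    using x by (simp add: Fa_comp)
  finally show ?thesis using x by (simp add: comult_D(2))
qed

lemma \<kappa>_coalg_map:
  assumes m: "coalg_map x c (Z y) (\<sigma> y) m" and c: "c \<in> hom C x (Fo E x)" and y: "y \<in> Ob C"
  shows "\<kappa> y \<cdot> m = Fa E (\<epsilon> y \<cdot> m) \<cdot> c"
proof -
  have h: "m \<in> Ar C" "Dom C m = x" "Cod C m = Z y" and eq: "\<sigma> y \<cdot> m = Fa E m \<cdot> c"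
    using m by (auto simp: coalg_map_def hom_def)
  have "\<kappa> y \<cdot> m = Fa E (\<epsilon> y) \<cdot> (\<sigma> y \<cdot> m)" using y h by (simp add: \<kappa>_def)
  then show ?thesis using y h homD[OF c] by (simp add: eq Fa_comp)
qed

text \<open>For existence, the identity of \<open>x\<close> is lifted along \<open>p\<close>. For
  uniqueness, \<open>\<kappa>_comult\<close> turns the coassociativity of \<open>a\<close> into the
  equation of a coalgebra map, and the uniqueness of \<open>ana\<close> applies.\<close>

lemma coalgebra_D:
  assumes x: "x \<in> Ob C" and p: "p \<in> hom C x (Fo E x)"
  shows "\<exists>!a. is_comonad_coalg C D x a \<and> \<kappa> x \<cdot> a = p"
proof (rule ex1I)
  let ?a = "ana x x p (Ide C x)"
  have i: "Ide C x \<in> hom C x x" using x by (intro homI) auto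
  have a: "coalg_map x p (Z x) (\<sigma> x) ?a" and \<epsilon>: "\<epsilon> x \<cdot> ?a = Ide C x"
    using coalg_map_ana[OF p i] ana_\<epsilon>[OF p i] by auto
  have ah: "?a \<in> hom C x (Z x)" using a by (simp add: coalg_map_def)
  note h = homD[OF ah]
  have "comult D x \<cdot> ?a = Fa D ?a \<cdot> ?a"
  proof (rule coalg_map_eqI[OF p Z_ob[OF x] coalg_map_comp[OF a comult_D(1)[OF x] p \<sigma>_hom \<sigma>_hom]
        coalg_map_comp[OF a Fa_D(1)[OF ah] p \<sigma>_hom \<sigma>_hom]])
    have "\<epsilon> (Z x) \<cdot> (Fa D ?a \<cdot> ?a) = ?a \<cdot> (\<epsilon> x \<cdot> ?a)" using h x by (intro \<epsilon>_Fa_D) auto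
    then show "\<epsilon> (Z x) \<cdot> (comult D x \<cdot> ?a) = \<epsilon> (Z x) \<cdot> (Fa D ?a \<cdot> ?a)"
      using h x by (simp add: \<epsilon> \<epsilon>_comult)
  qed (use x in auto)
  moreover have "\<kappa> x \<cdot> ?a = p"
    using \<kappa>_coalg_map[OF a p x] homD[OF p] x by (simp add: \<epsilon>)
  ultimately show "is_comonad_coalg C D x ?a \<and> \<kappa> x \<cdot> ?a = p"
    using ah \<epsilon> by (simp add: is_comonad_coalg_def)
next
  fix a assume "is_comonad_coalg C D x a \<and> \<kappa> x \<cdot> a = p"
  then have a: "a \<in> hom C x (Z x)" "\<epsilon> x \<cdot> a = Ide C x" "comult D x \<cdot> a = Fa D a \<cdot> a" "\<kappa> x \<cdot> a = p"
    by (auto simp: is_comonad_coalg_def)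
  note h = homD[OF a(1)]
  have i: "Ide C x \<in> hom C x x" using x by (intro homI) auto
  have "\<sigma> x \<cdot> a = \<kappa> (Z x) \<cdot> (comult D x \<cdot> a)"
    unfolding \<kappa>_comult[OF x, symmetric] using x h by simp
  also have "\<dots> = \<kappa> (Z x) \<cdot> (Fa D a \<cdot> a)" by (simp only: a(3))
  also have "\<dots> = Fa E a \<cdot> (\<kappa> x \<cdot> a)"
    by (rule post[OF \<kappa>_natural[OF a(1), symmetric]]) (use x h in auto)
  finally show "a = ana x x p (Ide C x)"
    by (intro ana_unique p i a) (simp add: a(4))
qed

text \<open>Reduces comonad maps to coalgebra maps: the source carries the coalgebra
  \<open>\<tau>\<close> after \<open>comult'\<close>, and lying over the counit then pins the map
  down. This gives uniqueness in the universal property and describes the comparison with a given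
  cofree comonad.\<close>

lemma comonad_map_coalg_map:
  assumes D': "is_comonad C D'" and map: "is_comonad_map C D' D s" and s\<kappa>: "\<And>x. x \<in> Ob C \<Longrightarrow> \<kappa> x \<cdot> s x = \<tau> x"
    and x: "x \<in> Ob C"
  shows "coalg_map (Fo D' x) (\<tau> (Fo D' x) \<cdot> comult D' x) (Z x) (\<sigma> x) (s x)" "\<epsilon> x \<cdot> s x = counit D' x"
proof -
  note [simp] = endofunctorD(1)[OF comonadD(1)[OF D']] homD[OF comonadD(3)[OF D']]
  have s: "s x \<in> hom C (Fo D' x) (Z x)" "\<epsilon> x \<cdot> s x = counit D' x"
    "comult D x \<cdot> s x = Fa D (s x) \<cdot> (s (Fo D' x) \<cdot> comult D' x)" if "x \<in> Ob C" for x
    using map that unfolding is_comonad_map_def is_nat_trans_def D_simps by blast+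
  note [simp] = homD[OF s(1)]
  have "\<sigma> x \<cdot> s x = \<kappa> (Z x) \<cdot> (comult D x \<cdot> s x)"
    unfolding \<kappa>_comult[OF x, symmetric] using x by simp
  also have "\<dots> = \<kappa> (Z x) \<cdot> (Fa D (s x) \<cdot> (s (Fo D' x) \<cdot> comult D' x))" by (simp only: s(3)[OF x])
  also have "\<dots> = Fa E (s x) \<cdot> (\<kappa> (Fo D' x) \<cdot> (s (Fo D' x) \<cdot> comult D' x))"
    by (rule post[OF \<kappa>_natural[OF s(1)[OF x], symmetric]]) (use x in auto)
  also have "\<kappa> (Fo D' x) \<cdot> (s (Fo D' x) \<cdot> comult D' x) = (\<kappa> (Fo D' x) \<cdot> s (Fo D' x)) \<cdot> comult D' x"
    using x by simp
  also have "\<dots> = \<tau> (Fo D' x) \<cdot> comult D' x"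
    using x by (simp only: s\<kappa> endofunctorD(1)[OF comonadD(1)[OF D']])
  finally show "coalg_map (Fo D' x) (\<tau> (Fo D' x) \<cdot> comult D' x) (Z x) (\<sigma> x) (s x)"
    using s(1)[OF x] by (simp add: coalg_map_def)
  show "\<epsilon> x \<cdot> s x = counit D' x" by (rule s(2)[OF x])
qed

text \<open>\<open>\<tau>\<close> makes each \<open>Fo D' x\<close> an \<open>E\<close>-coalgebra
  \<open>c x\<close>, natural in \<open>x\<close> and compatible with the comultiplication, and
  \<open>t x\<close> is its unfolding over the counit. Naturality of \<open>t\<close> and its law
  for the comultiplication compare coalgebra maps into cofree coalgebras.\<close>

lemma universal_D:
  assumes D': "is_comonad C D'" and \<tau>: "is_nat_trans C D' E \<tau>"
  shows "\<exists>!t. t \<in> extensional (Ob C) \<and> is_comonad_map C D' D t \<and> (\<forall>x\<in>Ob C. \<kappa> x \<cdot> t x = \<tau> x)"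
proof -
  note d = comonadD[OF D'] and fd = endofunctorD[OF comonadD(1)[OF D']] and n = nat_transD[OF \<tau>]
  note fd_simps [simp] = fd(1) homD[OF fd(2)[OF homI[OF _ HOL.refl HOL.refl]]]
  note d_simps [simp] = homD[OF d(2)] homD[OF d(3)] homD[OF n(1)]
  define c where "c x = \<tau> (Fo D' x) \<cdot> comult D' x" for x
  have c: "c x \<in> hom C (Fo D' x) (Fo E (Fo D' x))" if "x \<in> Ob C" for x
    using that by (intro homI) (auto simp: c_def)
  have c_nat: "coalg_map (Fo D' x) (c x) (Fo D' y) (c y) (Fa D' f)" if f: "f \<in> hom C x y" for x y f
  proof -
    note h = homD[OF f]
    have x: "x \<in> Ob C" "y \<in> Ob C" using h by auto
    have "c y \<cdot> Fa D' f = \<tau> (Fo D' y) \<cdot> (comult D' y \<cdot> Fa D' f)" using h x by (simp add: c_def)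
    also have "\<dots> = \<tau> (Fo D' y) \<cdot> (Fa D' (Fa D' f) \<cdot> comult D' x)" by (simp only: d(5)[OF f])
    also have "\<dots> = Fa E (Fa D' f) \<cdot> (\<tau> (Fo D' x) \<cdot> comult D' x)"
      by (rule post[OF n(2)[OF fd(2)[OF f], symmetric]]) (use h x in auto)
    finally show ?thesis using fd(2)[OF f] by (simp add: coalg_map_def c_def)
  qed
  have c_comult: "coalg_map (Fo D' x) (c x) (Fo D' (Fo D' x)) (c (Fo D' x)) (comult D' x)"
    if x: "x \<in> Ob C" for x
  proof -
    have "c (Fo D' x) \<cdot> comult D' x = \<tau> (Fo D' (Fo D' x)) \<cdot> (comult D' (Fo D' x) \<cdot> comult D' x)"
      using x by (simp add: c_def)
    also have "\<dots> = \<tau> (Fo D' (Fo D' x)) \<cdot> (Fa D' (comult D' x) \<cdot> comult D' x)" by (simp only: d(8)[OF x])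
    also have "\<dots> = Fa E (comult D' x) \<cdot> (\<tau> (Fo D' x) \<cdot> comult D' x)"
      by (rule post[OF n(2)[OF d(3)[OF x], symmetric]]) (use x in auto)
    finally show ?thesis using d(3)[OF x] by (simp add: coalg_map_def c_def)
  qed
  define t where "t = (\<lambda>x\<in>Ob C. ana (Fo D' x) x (c x) (counit D' x))"
  have t: "coalg_map (Fo D' x) (c x) (Z x) (\<sigma> x) (t x)" "\<epsilon> x \<cdot> t x = counit D' x" if x: "x \<in> Ob C" for x
    using coalg_map_ana[OF c[OF x] d(2)[OF x]] ana_\<epsilon>[OF c[OF x] d(2)[OF x]] x by (simp_all add: t_def)
  have t_hom: "t x \<in> hom C (Fo D' x) (Z x)" if x: "x \<in> Ob C" for x
    using t(1)[OF x] by (simp add: coalg_map_def)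
  note t_simps [simp] = homD[OF t_hom]
  have t_nat: "Fa D f \<cdot> t x = t y \<cdot> Fa D' f" if f: "f \<in> hom C x y" for x y f
  proof -
    note h = homD[OF f]
    have x: "x \<in> Ob C" "y \<in> Ob C" using h by auto
    show ?thesis
    proof (rule coalg_map_eqI[OF c[OF x(1)] x(2)
          coalg_map_comp[OF t(1)[OF x(1)] Fa_D(1)[OF f] c \<sigma>_hom \<sigma>_hom]
          coalg_map_comp[OF c_nat[OF f] t(1)[OF x(2)] c c \<sigma>_hom]])
      have "\<epsilon> y \<cdot> (Fa D f \<cdot> t x) = f \<cdot> (\<epsilon> x \<cdot> t x)" using h x by (intro \<epsilon>_Fa_D) auto
      also have "\<dots> = counit D' y \<cdot> Fa D' f" using x by (simp add: t(2) d(4)[OF f])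
      also have "\<dots> = (\<epsilon> y \<cdot> t y) \<cdot> Fa D' f" using x by (simp only: t(2))
      also have "\<dots> = \<epsilon> y \<cdot> (t y \<cdot> Fa D' f)" by (rule cat_simps(11)) (use h x in auto)
      finally show "\<epsilon> y \<cdot> (Fa D f \<cdot> t x) = \<epsilon> y \<cdot> (t y \<cdot> Fa D' f)" .
    qed (use x in auto)
  qed
  have t_comult: "comult D x \<cdot> t x = Fa D (t x) \<cdot> (t (Fo D' x) \<cdot> comult D' x)" if x: "x \<in> Ob C" for x
  proof (rule coalg_map_eqI[OF c[OF x] Z_ob[OF x]
        coalg_map_comp[OF t(1)[OF x] comult_D(1)[OF x] c \<sigma>_hom \<sigma>_hom]
        coalg_map_comp[OF coalg_map_comp[OF c_comult[OF x] t(1)[OF fd(1)[OF x]] c c \<sigma>_hom]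
          Fa_D(1)[OF t_hom[OF x]] c \<sigma>_hom \<sigma>_hom]])
    have "\<epsilon> (Z x) \<cdot> (Fa D (t x) \<cdot> (t (Fo D' x) \<cdot> comult D' x)) = t x \<cdot> (\<epsilon> (Fo D' x) \<cdot> (t (Fo D' x) \<cdot> comult D' x))"
      using x by (intro \<epsilon>_Fa_D) auto
    also have "\<epsilon> (Fo D' x) \<cdot> (t (Fo D' x) \<cdot> comult D' x) = (\<epsilon> (Fo D' x) \<cdot> t (Fo D' x)) \<cdot> comult D' x"
      using x by simp
    also have "\<dots> = Ide C (Fo D' x)" using x by (simp only: t(2) fd(1) d(6))
    finally show "\<epsilon> (Z x) \<cdot> (comult D x \<cdot> t x) = \<epsilon> (Z x) \<cdot> (Fa D (t x) \<cdot> (t (Fo D' x) \<cdot> comult D' x))"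
      using x by (simp add: \<epsilon>_comult)
  qed (use x in auto)
  have \<kappa>_t: "\<kappa> x \<cdot> t x = \<tau> x" if x: "x \<in> Ob C" for x
  proof -
    have "\<kappa> x \<cdot> t x = Fa E (counit D' x) \<cdot> (\<tau> (Fo D' x) \<cdot> comult D' x)"
      using \<kappa>_coalg_map[OF t(1)[OF x] c[OF x] x] unfolding t(2)[OF x] c_def .
    also have "\<dots> = \<tau> x \<cdot> (Fa D' (counit D' x) \<cdot> comult D' x)"
      by (rule post[OF n(2)[OF d(2)[OF x]]]) (use x in auto)
    also have "\<dots> = \<tau> x" using x by (simp add: d(7))
    finally show ?thesis .
  qed
  show ?thesis
  proof (rule ex1I)
    show "t \<in> extensional (Ob C) \<and> is_comonad_map C D' D t \<and> (\<forall>x\<in>Ob C. \<kappa> x \<cdot> t x = \<tau> x)"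
    proof (intro conjI ballI)
      show "t \<in> extensional (Ob C)" by (simp add: t_def)
      show "is_comonad_map C D' D t"
        unfolding is_comonad_map_def is_nat_trans_def D_simps
        using t_hom t_nat t(2) t_comult by blast
    qed (rule \<kappa>_t)
  next
    fix s assume "s \<in> extensional (Ob C) \<and> is_comonad_map C D' D s \<and> (\<forall>x\<in>Ob C. \<kappa> x \<cdot> s x = \<tau> x)"
    then have ext: "s \<in> extensional (Ob C)" and map: "is_comonad_map C D' D s"
      and \<kappa>_s: "\<And>x. x \<in> Ob C \<Longrightarrow> \<kappa> x \<cdot> s x = \<tau> x" by auto
    show "s = t"
    proof (rule extensionalityI[OF ext])
      show "t \<in> extensional (Ob C)" by (simp add: t_def)
      fix x assume x: "x \<in> Ob C"
      note m = comonad_map_coalg_map[OF D' map \<kappa>_s x, folded c_def]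
      have "s x = ana (Fo D' x) x (c x) (counit D' x)"
        using m by (intro ana_unique c d(2) x) (simp_all add: coalg_map_def)
      then show "s x = t x" using x by (simp add: t_def)
    qed
  qed
qed

lemma is_cofree_comonad_D: "is_cofree_comonad C E D \<kappa>"
  unfolding is_cofree_comonad_def
  by (intro conjI allI impI ballI comonad_D nat_trans_\<kappa> coalgebra_D) (elim conjE, rule universal_D)

end

context endofunctor_on_category
begin

section \<open>Comparison of cofree comonads\<close>

lemma comonad_map_Ide:
  assumes D: "is_comonad C D"
  shows "is_comonad_map C D D (\<lambda>x. Ide C (Fo D x))"
proof -
  note d = comonadD[OF D] and fd = endofunctorD[OF comonadD(1)[OF D]]
  note [simp] = fd(1) homD[OF fd(2)[OF homI[OF _ HOL.refl HOL.refl]]] homD[OF d(2)] homD[OF d(3)]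
  have [simp]: "Fa D (Ide C x) = Ide C (Fo D x)" if "x \<in> Ob C" for x
    using d(1) that by (simp add: is_endofunctor_def)
  show ?thesis
    unfolding is_comonad_map_def is_nat_trans_def
    by (auto intro!: homI simp: homD)
qed

lemma comonad_map_comp:
  assumes D1: "is_comonad C D1" and D2: "is_comonad C D2" and D3: "is_comonad C D3"
    and t: "is_comonad_map C D1 D2 t" and s: "is_comonad_map C D2 D3 s"
  shows "is_comonad_map C D1 D3 (\<lambda>x. s x \<cdot> t x)"
proof -
  note f1 = endofunctorD[OF comonadD(1)[OF D1]] and f2 = endofunctorD[OF comonadD(1)[OF D2]]
    and f3 = endofunctorD[OF comonadD(1)[OF D3]]
  have t': "t x \<in> hom C (Fo D1 x) (Fo D2 x)" "counit D2 x \<cdot> t x = counit D1 x"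
    "comult D2 x \<cdot> t x = Fa D2 (t x) \<cdot> (t (Fo D1 x) \<cdot> comult D1 x)" if "x \<in> Ob C" for x
    using t that unfolding is_comonad_map_def is_nat_trans_def by blast+
  have tn: "Fa D2 f \<cdot> t x = t y \<cdot> Fa D1 f" if "f \<in> hom C x y" for x y f
    using t that unfolding is_comonad_map_def is_nat_trans_def by blast
  have s': "s x \<in> hom C (Fo D2 x) (Fo D3 x)" "counit D3 x \<cdot> s x = counit D2 x"
    "comult D3 x \<cdot> s x = Fa D3 (s x) \<cdot> (s (Fo D2 x) \<cdot> comult D2 x)" if "x \<in> Ob C" for x
    using s that unfolding is_comonad_map_def is_nat_trans_def by blast+
  have sn: "Fa D3 f \<cdot> s x = s y \<cdot> Fa D2 f" if "f \<in> hom C x y" for x y f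
    using s that unfolding is_comonad_map_def is_nat_trans_def by blast
  have F3: "Fa D3 (g \<cdot> f) = Fa D3 g \<cdot> Fa D3 f" if "f \<in> hom C x y" "g \<in> hom C y z" for x y z f g
    using comonadD(1)[OF D3] that unfolding is_endofunctor_def by blast
  note [simp] = f1(1) f2(1) f3(1) homD[OF f1(2)[OF homI[OF _ HOL.refl HOL.refl]]]
    homD[OF f2(2)[OF homI[OF _ HOL.refl HOL.refl]]] homD[OF f3(2)[OF homI[OF _ HOL.refl HOL.refl]]]
    homD[OF t'(1)] homD[OF s'(1)]
    homD[OF comonadD(2)[OF D1]] homD[OF comonadD(3)[OF D1]] homD[OF comonadD(2)[OF D2]]
    homD[OF comonadD(3)[OF D2]] homD[OF comonadD(2)[OF D3]] homD[OF comonadD(3)[OF D3]]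
  show ?thesis
    unfolding is_comonad_map_def is_nat_trans_def
  proof (intro conjI ballI allI impI)
    fix x assume x: "x \<in> Ob C"
    show "s x \<cdot> t x \<in> hom C (Fo D1 x) (Fo D3 x)" using x by (intro homI) auto
    have "counit D3 x \<cdot> (s x \<cdot> t x) = (counit D3 x \<cdot> s x) \<cdot> t x" using x by simp
    then show "counit D3 x \<cdot> (s x \<cdot> t x) = counit D1 x" using x by (simp only: s'(2) t'(2))
    have "comult D3 x \<cdot> (s x \<cdot> t x) = Fa D3 (s x) \<cdot> ((s (Fo D2 x) \<cdot> comult D2 x) \<cdot> t x)"
      by (rule post[OF s'(3)[OF x]]) (use x in auto)
    also have "(s (Fo D2 x) \<cdot> comult D2 x) \<cdot> t x = s (Fo D2 x) \<cdot> (comult D2 x \<cdot> t x)" using x by simp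
    also have "\<dots> = s (Fo D2 x) \<cdot> (Fa D2 (t x) \<cdot> (t (Fo D1 x) \<cdot> comult D1 x))" by (simp only: t'(3)[OF x])
    also have "\<dots> = Fa D3 (t x) \<cdot> (s (Fo D1 x) \<cdot> (t (Fo D1 x) \<cdot> comult D1 x))"
      by (rule post[OF sn[OF t'(1)[OF x], symmetric]]) (use x in auto)
    also have "Fa D3 (s x) \<cdot> \<dots> = Fa D3 (s x \<cdot> t x) \<cdot> ((s (Fo D1 x) \<cdot> t (Fo D1 x)) \<cdot> comult D1 x)"
      using x by (simp add: F3[OF t'(1) s'(1)])
    finally show "comult D3 x \<cdot> (s x \<cdot> t x) = Fa D3 (s x \<cdot> t x) \<cdot> ((s (Fo D1 x) \<cdot> t (Fo D1 x)) \<cdot> comult D1 x)" .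
  next
    fix x y f assume f: "f \<in> hom C x y"
    note h = homD[OF f]
    have x: "x \<in> Ob C" "y \<in> Ob C" using h by auto
    have "Fa D3 f \<cdot> (s x \<cdot> t x) = s y \<cdot> (Fa D2 f \<cdot> t x)"
      by (rule post[OF sn[OF f]]) (use h x in auto)
    then show "Fa D3 f \<cdot> (s x \<cdot> t x) = (s y \<cdot> t y) \<cdot> Fa D1 f"
      using h x by (simp add: tn[OF f])
  qed
qed

lemma comonad_map_cong:
  assumes "is_comonad_map C D D' t" "is_comonad C D" "\<And>x. x \<in> Ob C \<Longrightarrow> t x = t' x"
  shows "is_comonad_map C D D' t'"
  using assms(1,3) endofunctorD(1)[OF comonadD(1)[OF assms(2)]]
  unfolding is_comonad_map_def is_nat_trans_def by (auto simp: hom_def)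

text \<open>Cofree comonads on \<open>E\<close> are isomorphic; only one of the two equations is needed.\<close>

lemma cofree_comonad_split_mono:
  assumes D: "is_cofree_comonad C E D \<kappa>" and D': "is_cofree_comonad C E D' \<kappa>'"
  obtains t s where "is_comonad_map C D D' t" "\<And>x. x \<in> Ob C \<Longrightarrow> \<kappa>' x \<cdot> t x = \<kappa> x"
    "\<And>x. x \<in> Ob C \<Longrightarrow> s x \<in> hom C (Fo D' x) (Fo D x)"
    "\<And>x. x \<in> Ob C \<Longrightarrow> s x \<cdot> t x = Ide C (Fo D x)"
proof -
  have c: "is_comonad C D" "is_comonad C D'" and n: "is_nat_trans C D E \<kappa>" "is_nat_trans C D' E \<kappa>'"
    using D D' by (auto simp: is_cofree_comonad_def)
  note univ = D[unfolded is_cofree_comonad_def, THEN conjunct2, THEN conjunct2, THEN conjunct1, rule_format, OF conjI]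
  note univ' = D'[unfolded is_cofree_comonad_def, THEN conjunct2, THEN conjunct2, THEN conjunct1, rule_format, OF conjI]
  obtain t where t: "is_comonad_map C D D' t" "\<And>x. x \<in> Ob C \<Longrightarrow> \<kappa>' x \<cdot> t x = \<kappa> x"
    using univ'[OF c(1) n(1)] by blast
  obtain s where s: "is_comonad_map C D' D s" "\<And>x. x \<in> Ob C \<Longrightarrow> \<kappa> x \<cdot> s x = \<kappa>' x"
    using univ[OF c(2) n(2)] by blast
  have th: "t x \<in> hom C (Fo D x) (Fo D' x)" and sh: "s x \<in> hom C (Fo D' x) (Fo D x)" if "x \<in> Ob C" for x
    using t(1) s(1) that unfolding is_comonad_map_def is_nat_trans_def by blast+
  note fd = endofunctorD(1)[OF comonadD(1)[OF c(1)]]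
  note [simp] = fd homD[OF th] homD[OF sh] homD[OF nat_transD(1)[OF n(1)]]
  \<comment> \<open>Uniqueness holds among extensional families, so the composite and the identities
    are both restricted to the objects.\<close>
  define r where "r = (\<lambda>x\<in>Ob C. s x \<cdot> t x)"
  define i where "i = (\<lambda>x\<in>Ob C. Ide C (Fo D x))"
  have "is_comonad_map C D D r"
    by (rule comonad_map_cong[OF comonad_map_comp[OF c(1,2,1) t(1) s(1)] c(1)]) (simp add: r_def)
  moreover have "is_comonad_map C D D i"
    by (rule comonad_map_cong[OF comonad_map_Ide[OF c(1)] c(1)]) (simp add: i_def)
  moreover have "\<kappa> x \<cdot> r x = \<kappa> x" if x: "x \<in> Ob C" for x
  proof -
    have "\<kappa> x \<cdot> r x = (\<kappa> x \<cdot> s x) \<cdot> t x" using x by (simp add: r_def)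
    then show ?thesis using x by (simp only: s(2) t(2))
  qed
  moreover have "\<kappa> x \<cdot> i x = \<kappa> x" if "x \<in> Ob C" for x
    using that by (simp add: i_def)
  moreover have "r \<in> extensional (Ob C)" "i \<in> extensional (Ob C)" by (simp_all add: r_def i_def)
  ultimately have "r = i"
    using univ[OF c(1) n(1)] by blast
  then have "s x \<cdot> t x = Ide C (Fo D x)" if "x \<in> Ob C" for x
  proof -
    from \<open>r = i\<close> have "r x = i x" by (rule fun_cong)
    with that show ?thesis unfolding r_def i_def by (simp only: restrict_apply if_True)
  qed
  then show thesis using that[OF t sh] by blast
qed

text \<open>Naturality of \<open>\<kappa>\<close> turns the coassociativity law of \<open>a\<close>
  into the equation of a coalgebra map. The argument takes place in any cofree comonad, without
  reference to the constructed one.\<close>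

lemma corresponding_coalg_map:
  assumes D: "is_cofree_comonad C E D \<kappa>" and x: "x \<in> Ob C" and p: "p \<in> hom C x (Fo E x)"
  defines "a \<equiv> corresponding_coalg C D \<kappa> x p"
  shows "coalg_map x p (Fo D x) (\<kappa> (Fo D x) \<cdot> comult D x) a" "counit D x \<cdot> a = Ide C x"
proof -
  have c: "is_comonad C D" and n: "is_nat_trans C D E \<kappa>" using D by (auto simp: is_cofree_comonad_def)
  have "\<exists>!a. is_comonad_coalg C D x a \<and> \<kappa> x \<cdot> a = p"
    using D x p by (simp add: is_cofree_comonad_def)
  from theI'[OF this] have "is_comonad_coalg C D x a" and \<kappa>a: "\<kappa> x \<cdot> a = p"
    by (simp_all add: a_def corresponding_coalg_def)
  then have a: "a \<in> hom C x (Fo D x)" "counit D x \<cdot> a = Ide C x" "comult D x \<cdot> a = Fa D a \<cdot> a"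
    by (simp_all add: is_comonad_coalg_def)
  note fd = endofunctorD[OF comonadD(1)[OF c]]
  note [simp] = fd(1) homD[OF fd(2)[OF a(1)]] homD[OF a(1)] homD[OF nat_transD(1)[OF n]] homD[OF comonadD(3)[OF c]]
  have "(\<kappa> (Fo D x) \<cdot> comult D x) \<cdot> a = \<kappa> (Fo D x) \<cdot> (Fa D a \<cdot> a)"
    using x by (simp add: a(3))
  also have "\<dots> = Fa E a \<cdot> (\<kappa> x \<cdot> a)"
    by (rule post[OF nat_transD(2)[OF n a(1), symmetric]]) (use x in auto)
  finally show "coalg_map x p (Fo D x) (\<kappa> (Fo D x) \<cdot> comult D x) a"
    using a(1) by (simp add: coalg_map_def \<kappa>a)
  show "counit D x \<cdot> a = Ide C x" by (rule a(2))
qed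

end

section \<open>The cofree comonad on the endofunctor and its cones\<close>

lemma endofunctor_on_Lax_Inj: "endofunctor_on_category (Lax_Inj \<Sigma>) PfPfInt"
  by (simp add: endofunctor_on_category_def is_category_Lax_Inj is_endofunctor_PfPfInt)

lemma cofree_coalgebras_Lax_Inj:
  "cofree_coalgebras (Lax_Inj \<Sigma>) PfPfInt cofree (\<lambda>H. proj H 0) struct (unfold \<Sigma>)"
proof (intro cofree_coalgebras.intro endofunctor_on_Lax_Inj cofree_coalgebras_axioms.intro;
    unfold Lax_Inj_simps mem_Collect_eq Fo_PfPfInt)
  fix x y c h m
  show "proj x 0 \<in> hom (Lax_Inj \<Sigma>) (cofree x) x" if "is_func \<Sigma> x"
    using proj_hom[OF that, of 0] by simp
  assume c: "c \<in> hom (Lax_Inj \<Sigma>) x (PfPfInt_ob x)" and h: "h \<in> hom (Lax_Inj \<Sigma>) x y"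
  show "Cmp (Lax_Inj \<Sigma>) (proj y 0) (unfold \<Sigma> x y c h) = h"
    using proj_unfold[OF c h, of 0] by simp
qed (rule is_func_cofree struct_hom unfold_hom struct_unfold unfold_unique; assumption)+

text \<open>Brings the cone of an arbitrary cofree comonad within reach of
  \<open>approx_Cmp\<close>.\<close>

lemma cone_approx:
  "cone \<Sigma> D \<kappa> H i = approx \<Sigma> (Cmp (Lax_Inj \<Sigma>) (\<kappa> (Fo D H)) (comult D H)) (counit D H) i"
  by (induction i) simp_all

lemma cone_coalg_hom:
  assumes D: "is_cofree_comonad (Lax_Inj \<Sigma>) PfPfInt D \<kappa>" and H: "is_func \<Sigma> H"
  shows "Cmp (Lax_Inj \<Sigma>) (\<kappa> (Fo D H)) (comult D H) \<in> hom (Lax_Inj \<Sigma>) (Fo D H) (PfPfInt_ob (Fo D H))"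
    "counit D H \<in> hom (Lax_Inj \<Sigma>) (Fo D H) H"
proof -
  have c: "is_comonad (Lax_Inj \<Sigma>) D" and n: "is_nat_trans (Lax_Inj \<Sigma>) D PfPfInt \<kappa>"
    using D by (auto simp: is_cofree_comonad_def)
  have H': "H \<in> Ob (Lax_Inj \<Sigma>)" using H by simp
  have "Fo D H \<in> Ob (Lax_Inj \<Sigma>)" by (rule endofunctorD(1)[OF comonadD(1)[OF c] H'])
  then show "Cmp (Lax_Inj \<Sigma>) (\<kappa> (Fo D H)) (comult D H) \<in> hom (Lax_Inj \<Sigma>) (Fo D H) (PfPfInt_ob (Fo D H))"
    using Cmp_hom[OF comonadD(3)[OF c H'] nat_transD(1)[OF n]] by simp
  show "counit D H \<in> hom (Lax_Inj \<Sigma>) (Fo D H) H" by (rule comonadD(2)[OF c H'])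
qed

text \<open>The comparison \<open>t H\<close> with the constructed comonad is a split monomorphism,
  hence injective pointwise. Followed by the projections it gives the cone, and sequences are
  determined by their entries. This justifies identifying an element with the tree that has the same
  images.\<close>

lemma inj_on_cone:
  assumes D: "is_cofree_comonad (Lax_Inj \<Sigma>) PfPfInt D \<kappa>" and H: "is_func \<Sigma> H"
  shows "inj_on (\<lambda>a i. cmpt (cone \<Sigma> D \<kappa> H i) n a) (Car (fob (Fo D H) n))"
proof -
  interpret Z: cofree_coalgebras "Lax_Inj \<Sigma>" PfPfInt cofree "\<lambda>H. proj H 0" struct "unfold \<Sigma>"
    by (rule cofree_coalgebras_Lax_Inj)
  have H': "H \<in> Ob (Lax_Inj \<Sigma>)" using H by simp
  have c: "is_comonad (Lax_Inj \<Sigma>) D" using D by (auto simp: is_cofree_comonad_def)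
  obtain t s where t: "is_comonad_map (Lax_Inj \<Sigma>) D Z.D t"
      "\<And>x. x \<in> Ob (Lax_Inj \<Sigma>) \<Longrightarrow> Cmp (Lax_Inj \<Sigma>) (Z.\<kappa> x) (t x) = \<kappa> x"
    and "\<And>x. x \<in> Ob (Lax_Inj \<Sigma>) \<Longrightarrow> s x \<in> hom (Lax_Inj \<Sigma>) (Fo Z.D x) (Fo D x)"
    and st: "\<And>x. x \<in> Ob (Lax_Inj \<Sigma>) \<Longrightarrow> Cmp (Lax_Inj \<Sigma>) (s x) (t x) = Ide (Lax_Inj \<Sigma>) (Fo D x)"
    using Z.cofree_comonad_split_mono[OF D Z.is_cofree_comonad_D] by metis
  let ?c = "Cmp (Lax_Inj \<Sigma>) (\<kappa> (Fo D H)) (comult D H)"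
  have "Z.coalg_map (Fo D H) ?c (cofree H) (struct H) (t H)"
    "Cmp (Lax_Inj \<Sigma>) (proj H 0) (t H) = counit D H"
    using Z.comonad_map_coalg_map[OF c t(1) _ H', of \<kappa>] t(2) by blast+
  note m = this[unfolded Z.coalg_map_def]
  have th: "t H \<in> hom (Lax_Inj \<Sigma>) (Fo D H) (cofree H)" using m(1) by blast
  have cone: "cone \<Sigma> D \<kappa> H i = Cmp (Lax_Inj \<Sigma>) (proj H i) (t H)" for i
    unfolding cone_approx proj_approx[OF H, of i]
    using approx_Cmp[OF struct_hom[OF H] proj_hom[OF H, of 0, unfolded stage.simps(1)] cone_coalg_hom(1)[OF D H] th
          m(1)[THEN conjunct2], of i] unfolding m(2) by (rule HOL.sym)
  show ?thesis
  proof (rule inj_onI)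
    fix a b assume a: "a \<in> Car (fob (Fo D H) n)" and b: "b \<in> Car (fob (Fo D H) n)"
      and eq: "(\<lambda>i. cmpt (cone \<Sigma> D \<kappa> H i) n a) = (\<lambda>i. cmpt (cone \<Sigma> D \<kappa> H i) n b)"
    obtain u where u: "cmpt (t H) n a = USeq u" "beh H n u"
      using lax_familyD(2)[OF hom_LaxD(5)[OF th] a] by (rule cofree_cases)
    obtain v where v: "cmpt (t H) n b = USeq v" "beh H n v"
      using lax_familyD(2)[OF hom_LaxD(5)[OF th] b] by (rule cofree_cases)
    have "u i = v i" for i
      using fun_cong[OF eq, of i]
      unfolding cone cmpt_Cmp[OF th a] cmpt_Cmp[OF th b] u(1) v(1) cmpt_proj[OF u(2)] cmpt_proj[OF v(2)] .
    then have "cmpt (t H) n a = cmpt (t H) n b" unfolding u(1) v(1) by (simp add: ext)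
    then have "cmpt (Cmp (Lax_Inj \<Sigma>) (s H) (t H)) n a = cmpt (Cmp (Lax_Inj \<Sigma>) (s H) (t H)) n b"
      unfolding cmpt_Cmp[OF th a] cmpt_Cmp[OF th b] by simp
    then show "a = b"
      unfolding st[OF H'] cmpt_Ide[OF a] cmpt_Ide[OF b] .
  qed
qed

text \<open>\<open>a\<close> is a coalgebra map from \<open>p\<close> lying over the identity, so
  \<open>approx_Cmp\<close> replaces the unknown comonad by the approximations of \<open>p\<close>
  itself.\<close>

lemma cone_corresponding_coalg:
  assumes D: "is_cofree_comonad (Lax_Inj \<Sigma>) PfPfInt D \<kappa>"
    and p: "p \<in> hom (Lax_Inj \<Sigma>) X (PfPfInt_ob X)"
  defines "a \<equiv> corresponding_coalg (Lax_Inj \<Sigma>) D \<kappa> X p"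
  shows "a \<in> hom (Lax_Inj \<Sigma>) X (Fo D X)"
    "Cmp (Lax_Inj \<Sigma>) (cone \<Sigma> D \<kappa> X i) a = approx \<Sigma> p (Ide (Lax_Inj \<Sigma>) X) i"
proof -
  interpret E: endofunctor_on_category "Lax_Inj \<Sigma>" PfPfInt by (rule endofunctor_on_Lax_Inj)
  have X: "is_func \<Sigma> X" "X \<in> Ob (Lax_Inj \<Sigma>)" using hom_LaxD(1)[OF p] by auto
  note m = E.corresponding_coalg_map[OF D X(2) p[folded Fo_PfPfInt], folded a_def, unfolded E.coalg_map_def]
  show a: "a \<in> hom (Lax_Inj \<Sigma>) X (Fo D X)" using m(1) by blast
  show "Cmp (Lax_Inj \<Sigma>) (cone \<Sigma> D \<kappa> X i) a = approx \<Sigma> p (Ide (Lax_Inj \<Sigma>) X) i"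
    unfolding cone_approx m(2)[symmetric]
    by (rule approx_Cmp[OF cone_coalg_hom[OF D X(1)] p a m(1)[THEN conjunct2]])
qed


section \<open>The coalgebra of a logic program\<close>

lemma At_simps [simp]:
  "UAtom A \<in> Car (fob (At \<Sigma> R) n) \<longleftrightarrow> A \<in> atoms_in \<Sigma> R n"
  "Le (fob (At \<Sigma> R) n) = Id_on (Car (fob (At \<Sigma> R) n))"
  "fmap (At \<Sigma> R) n f (UAtom A) = UAtom (asubst (tuple_subst f) A)"
  by (auto simp: At_def)

lemma At_cases:
  assumes "a \<in> Car (fob (At \<Sigma> R) n)"
  obtains A where "a = UAtom A" "A \<in> atoms_in \<Sigma> R n"
  using assms by (auto simp: At_def)

lemma asubst_atoms_in:
  assumes f: "f \<in> L \<Sigma> n m" and A: "A \<in> atoms_in \<Sigma> R m"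
  shows "asubst (tuple_subst f) A \<in> atoms_in \<Sigma> R n"
proof -
  have "tvars (tuple_subst f v) \<subseteq> {..<n}" if "v \<in> avars A" for v
  proof -
    have "v < m" using A that by (auto simp: atoms_in_def)
    then show ?thesis using f by (simp add: L_iff tuple_subst_def)
  qed
  then show ?thesis
    using A tuple_subst_terms[OF f] by (auto simp: atoms_in_def avars_asubst intro!: asubst_atoms)
qed

lemma is_func_At: "is_func \<Sigma> (At \<Sigma> R)"
  unfolding is_func_def
proof (intro conjI allI ballI)
  fix n show "preorder_on (Car (fob (At \<Sigma> R) n)) (Le (fob (At \<Sigma> R) n))"
    by (rule preorder_onI) auto
next
  fix n m f assume f: "f \<in> L \<Sigma> n m"
  show "fmap (At \<Sigma> R) n f \<in> monotone_maps (fob (At \<Sigma> R) m) (fob (At \<Sigma> R) n)"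
    by (rule monotone_mapsI) (auto elim!: At_cases simp: asubst_atoms_in[OF f])
next
  fix n x assume "x \<in> Car (fob (At \<Sigma> R) n)"
  then obtain A where A: "x = UAtom A" "A \<in> atoms_in \<Sigma> R n" by (rule At_cases)
  have "asubst (tuple_subst (map Var [0..<n])) A = asubst Var A"
    by (rule asubst_cong) (auto simp: tuple_subst_def)
  then show "fmap (At \<Sigma> R) n (map Var [0..<n]) x = x" using A by simp
next
  fix n m k f g x assume f: "f \<in> L \<Sigma> n m" and g: "g \<in> L \<Sigma> m k" and "x \<in> Car (fob (At \<Sigma> R) k)"
  then obtain A where A: "x = UAtom A" "A \<in> atoms_in \<Sigma> R k" by (elim At_cases)
  have "asubst (tuple_subst (lcomp g f)) A = asubst (\<lambda>v. tsubst (tuple_subst f) (tuple_subst g v)) A"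
    using A(2) g by (intro asubst_cong) (auto simp: atoms_in_def tuple_subst_def nth_lcomp L_length)
  then show "fmap (At \<Sigma> R) n (lcomp g f) x = fmap (At \<Sigma> R) n f (fmap (At \<Sigma> R) m g x)"
    using A by (simp add: asubst_asubst)
qed

section \<open>Matchers and fresh variables\<close>

lemma matchers_terms: "\<theta> \<in> matchers \<Sigma> B A \<Longrightarrow> \<theta> v \<in> terms \<Sigma>"
  by (simp add: matchers_def substs_def)

lemma matchers_tvars: "\<theta> \<in> matchers \<Sigma> B A \<Longrightarrow> v \<in> avars B \<Longrightarrow> tvars (\<theta> v) \<subseteq> avars A"
  by (auto simp: matchers_def avars_asubst)

lemma matchers_agree: "\<theta> \<in> matchers \<Sigma> B A \<Longrightarrow> \<theta>' \<in> matchers \<Sigma> B A \<Longrightarrow> v \<in> avars B \<Longrightarrow> \<theta> v = \<theta>' v"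
  using asubst_eq_iff[of \<theta> B \<theta>'] by (simp add: matchers_def)

lemma matchersI:
  assumes "\<theta> \<in> matchers \<Sigma> B A" "\<And>v. v \<in> avars B \<Longrightarrow> \<theta>' v = \<theta> v" "\<And>v. \<theta>' v \<in> terms \<Sigma>"
  shows "\<theta>' \<in> matchers \<Sigma> B A"
  using assms asubst_cong[of B \<theta>' \<theta>] by (simp add: matchers_def substs_def)

text \<open>If there is no matcher, the values on the variables of the head are arbitrary.\<close>

definition std_matcher ::
    "('f \<times> nat) set \<Rightarrow> nat \<Rightarrow> ('f, 'p) clause \<Rightarrow> ('f, 'p) atom \<Rightarrow> nat \<Rightarrow> 'f trm" where
  "std_matcher \<Sigma> n c A v =
     (if v \<in> avars (head c) then (SOME \<theta>. \<theta> \<in> matchers \<Sigma> (head c) A) v else Var (n + v))"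

text \<open>One more than every variable index in the body, so that \<open>Var (n + v)\<close> lies
  in the context \<open>n + body_bound c\<close> for each such \<open>v\<close>. The inserted
  \<open>0\<close> keeps \<open>Max\<close> meaningful when the body has no variables.\<close>

definition body_bound :: "('f, 'p) clause \<Rightarrow> nat" where
  "body_bound c = Suc (Max (insert 0 (\<Union> (avars ` set (body c)))))"

lemma body_bound: "B \<in> set (body c) \<Longrightarrow> v \<in> avars B \<Longrightarrow> v < body_bound c"
  by (auto simp: body_bound_def less_Suc_eq_le intro!: Max_ge)

lemma existential_vars_bound: "v \<in> existential_vars c \<Longrightarrow> v < body_bound c"
  by (auto simp: existential_vars_def body_bound)

lemma finite_existential_vars: "finite (existential_vars c)"
  by (simp add: existential_vars_def)

lemma std_matcher_matchers:
  assumes "matchers \<Sigma> (head c) A \<noteq> {}"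
  shows "std_matcher \<Sigma> n c A \<in> matchers \<Sigma> (head c) A"
proof -
  have *: "(SOME \<theta>. \<theta> \<in> matchers \<Sigma> (head c) A) \<in> matchers \<Sigma> (head c) A"
    using assms by (simp add: some_in_eq)
  show ?thesis
    by (rule matchersI[OF *]) (auto simp: std_matcher_def matchers_terms[OF *] terms.intros)
qed

lemma std_matcher_existential:
  "v \<in> existential_vars c \<Longrightarrow> std_matcher \<Sigma> n c A v = Var (n + v)"
  by (simp add: std_matcher_def existential_vars_def)

lemma std_matcher_inj: "inj_on (std_matcher \<Sigma> n c A) (existential_vars c)"
  by (auto simp: inj_on_def std_matcher_existential)

lemma std_matcher_image: "std_matcher \<Sigma> n c A ` existential_vars c \<subseteq> Var ` {n..<n + body_bound c}"
  by (auto simp: std_matcher_existential existential_vars_bound)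

text \<open>\<open>A\<close> uses only variables below \<open>n\<close>, so the factorizing
  substitution can fix those and send the variable \<open>n + v\<close> to the value of
  \<open>\<sigma>\<close> at \<open>v\<close>.\<close>

lemma std_matcher_mgm:
  assumes m: "matchers \<Sigma> (head c) A \<noteq> {}" and A: "avars A \<subseteq> {..<n}"
  shows "is_mgm \<Sigma> (head c) A (std_matcher \<Sigma> n c A)"
  unfolding is_mgm_def
proof (intro conjI ballI std_matcher_matchers m)
  fix \<sigma> assume \<sigma>: "\<sigma> \<in> matchers \<Sigma> (head c) A"
  define \<tau> where "\<tau> u = (if u < n then Var u else \<sigma> (u - n))" for u
  have "\<tau> \<in> substs \<Sigma>" using matchers_terms[OF \<sigma>] by (simp add: \<tau>_def substs_def terms.intros)
  moreover have "\<sigma> v = tsubst \<tau> (std_matcher \<Sigma> n c A v)" for v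
  proof (cases "v \<in> avars (head c)")
    case True
    then have "std_matcher \<Sigma> n c A v = \<sigma> v"
      using matchers_agree[OF std_matcher_matchers[OF m] \<sigma>] by blast
    moreover have "tsubst \<tau> (\<sigma> v) = tsubst Var (\<sigma> v)"
      using matchers_tvars[OF \<sigma> True] A by (intro tsubst_cong) (auto simp: \<tau>_def)
    ultimately show ?thesis by simp
  next
    case False
    then show ?thesis by (simp add: std_matcher_def \<tau>_def)
  qed
  ultimately show "\<exists>\<tau>\<in>substs \<Sigma>. \<forall>v. \<sigma> v = tsubst \<tau> (std_matcher \<Sigma> n c A v)" by blast
qed

text \<open>The standard matcher factors through any most general one and is injective on the
  existential variables, which forces the latter to be injective there. The shift \<open>0\<close>
  suffices, as injectivity is all that is wanted from it.\<close>

lemma is_mgm_inj: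
  assumes "is_mgm \<Sigma> (head c) A \<theta>"
  shows "inj_on \<theta> (existential_vars c)"
proof -
  have "std_matcher \<Sigma> 0 c A \<in> matchers \<Sigma> (head c) A"
    using assms by (intro std_matcher_matchers) (auto simp: is_mgm_def)
  then obtain \<tau> where "\<And>v. std_matcher \<Sigma> 0 c A v = tsubst \<tau> (\<theta> v)"
    using assms by (auto simp: is_mgm_def)
  then show ?thesis using std_matcher_inj[of \<Sigma> 0 c A] unfolding inj_on_def by metis
qed

lemma body_atoms_in:
  assumes \<theta>: "\<theta> \<in> matchers \<Sigma> (head c) A" and A: "A \<in> atoms_in \<Sigma> R n" and nm: "n \<le> m"
    and ex: "\<theta> ` existential_vars c \<subseteq> Var ` {n..<m}" and B: "B \<in> set (body c)" "B \<in> atoms \<Sigma> R"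
  shows "asubst \<theta> B \<in> atoms_in \<Sigma> R m"
proof -
  have "tvars (\<theta> v) \<subseteq> {..<m}" if v: "v \<in> avars B" for v
  proof (cases "v \<in> avars (head c)")
    case True
    then show ?thesis using matchers_tvars[OF \<theta> True] A nm by (force simp: atoms_in_def)
  next
    case False
    then have "v \<in> existential_vars c" using v B(1) by (auto simp: existential_vars_def)
    then have "\<theta> v \<in> Var ` {n..<m}" using ex by blast
    then show ?thesis by auto
  qed
  then show ?thesis
    using B(2) matchers_terms[OF \<theta>] by (auto simp: atoms_in_def avars_asubst intro: asubst_atoms)
qed

text \<open>The two instances of \<open>B\<close> are related by an injective renaming that fixes
  the first \<open>n\<close> variables, and such a renaming does not change the element of the
  colimit. So neither the choice of the matcher nor the size of the context matters.\<close>

lemma \<rho>_body_independent: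
  fixes c :: "('f, 'p) clause"
  assumes \<theta>: "\<theta> \<in> matchers \<Sigma> (head c) A" "inj_on \<theta> (existential_vars c)"
      "\<theta> ` existential_vars c \<subseteq> Var ` {n..<m}" "n \<le> m"
    and \<theta>': "\<theta>' \<in> matchers \<Sigma> (head c) A" "inj_on \<theta>' (existential_vars c)"
      "\<theta>' ` existential_vars c \<subseteq> Var ` {n..<m'}" "n \<le> m'"
    and A: "A \<in> atoms_in \<Sigma> R n" and B: "B \<in> set (body c)" "B \<in> atoms \<Sigma> R"
  shows "\<rho> (At \<Sigma> R) n m [0..<n] (UAtom (asubst \<theta> B) :: ('f, 'p, 'u) univ) =
    \<rho> (At \<Sigma> R) n m' [0..<n] (UAtom (asubst \<theta>' B))"
proof -
  let ?X = "existential_vars c"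
  define xs where "xs = sorted_list_of_set ?X"
  have xs: "set xs = ?X" "distinct xs" by (simp_all add: xs_def finite_existential_vars)
  define var where "var t = (case t of Var v \<Rightarrow> v | Fn f ts \<Rightarrow> 0)" for t :: "'f trm"
  \<comment> \<open>Lists the \<open>n\<close> variables of the context, then the names that
    \<open>\<theta>\<close> gives to the existential variables. An injection between contexts that
    carries one such list to the other carries one instance to the other.\<close>
  define w where "w \<theta> = [0..<n] @ map (\<lambda>v. var (\<theta> v)) xs" for \<theta>
  have w: "w \<theta> \<in> inj_maps (n + length xs) m" and varw: "\<And>v. v \<in> ?X \<Longrightarrow> \<theta> v = Var (var (\<theta> v))"
    if "inj_on \<theta> ?X" "\<theta> ` ?X \<subseteq> Var ` {n..<m}" "n \<le> m" for \<theta> m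
  proof -
    have v: "\<theta> v = Var (var (\<theta> v)) \<and> n \<le> var (\<theta> v) \<and> var (\<theta> v) < m" if "v \<in> ?X" for v
    proof -
      have "\<theta> v \<in> Var ` {n..<m}" using \<open>\<theta> ` ?X \<subseteq> _\<close> that by blast
      then show ?thesis by (auto simp: var_def)
    qed
    then show "\<And>v. v \<in> ?X \<Longrightarrow> \<theta> v = Var (var (\<theta> v))" by blast
    have "inj_on (\<lambda>v. var (\<theta> v)) ?X"
      using v that(1) unfolding inj_on_def by metis
    then have "distinct (w \<theta>)"
      using v xs by (auto simp: w_def distinct_map) (meson leD)
    then show "w \<theta> \<in> inj_maps (n + length xs) m"
      using v xs that(3) by (auto simp: inj_maps_def w_def)
  qed
  obtain q where q: "q \<in> inj_maps m' (m + m' + 0)" "map ((!) q) (w \<theta>') = w \<theta>"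
    using inj_extend[OF w[OF \<theta>'(2-4)] w[OF \<theta>(2-4)]] by blast
  have q': "q \<in> inj_maps m' (m + m')" and len: "length q = m'" using q(1) by (simp_all add: inj_maps_length)
  have "map ((!) q) [0..<n] = [0..<n]" and qx: "map (\<lambda>v. q ! var (\<theta>' v)) xs = map (\<lambda>v. var (\<theta> v)) xs"
    using q(2) by (simp_all add: w_def comp_def)
  then have qn: "map ((!) q) [0..<n] = [0..<n]" "\<And>i. i < n \<Longrightarrow> q ! i = i"
    by (auto simp: map_eq_conv[of _ _ "\<lambda>i. i", simplified] dest: map_eq_conv[THEN iffD1, of _ _ "\<lambda>i. i"])
  have qv: "q ! var (\<theta>' v) = var (\<theta> v)" if "v \<in> ?X" for v
    using qx that xs(1) by (simp add: map_eq_conv)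
  have subst: "asubst (tuple_subst (J q)) (asubst \<theta>' B) = asubst \<theta> B"
    unfolding asubst_asubst
  proof (rule asubst_cong)
    fix v assume v: "v \<in> avars B"
    show "tsubst (tuple_subst (J q)) (\<theta>' v) = \<theta> v"
    proof (cases "v \<in> avars (head c)")
      case True
      have "tsubst (tuple_subst (J q)) (\<theta>' v) = tsubst Var (\<theta>' v)"
        using matchers_tvars[OF \<theta>'(1) True] A \<theta>'(4) len
        by (intro tsubst_cong) (force simp: tuple_subst_def atoms_in_def qn(2))
      then show ?thesis using matchers_agree[OF \<theta>(1) \<theta>'(1) True] by simp
    next
      case False
      then have x: "v \<in> ?X" using v B(1) by (auto simp: existential_vars_def)
      have "\<theta>' v \<in> Var ` {n..<m'}" using \<theta>'(3) x by blast
      then obtain u where u: "\<theta>' v = Var u" "u < m'" by auto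
      have "tsubst (tuple_subst (J q)) (\<theta>' v) = Var (q ! var (\<theta>' v))"
        using u len by (simp add: var_def tuple_subst_def)
      then show ?thesis using qv[OF x] varw[OF \<theta>(2-4) x] by simp
    qed
  qed
  have in_m: "(UAtom (asubst \<theta> B) :: ('f, 'p, 'u) univ) \<in> Car (fob (At \<Sigma> R) m)"
    "(UAtom (asubst \<theta>' B) :: ('f, 'p, 'u) univ) \<in> Car (fob (At \<Sigma> R) m')"
    using body_atoms_in[OF \<theta>(1) A \<theta>(4,3) B] body_atoms_in[OF \<theta>'(1) A \<theta>'(4,3) B] by simp_all
  have up: "[0..<m] \<in> inj_maps m (m + m')" by (rule upt_inj_maps) simp
  have "asubst (tuple_subst (J [0..<m])) (asubst \<theta> B) = asubst Var (asubst \<theta> B)"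
    by (rule asubst_cong) (auto simp: tuple_subst_def)
  then have "\<rho> (At \<Sigma> R) n m [0..<n] (UAtom (asubst \<theta> B) :: ('f, 'p, 'u) univ) =
      \<rho> (At \<Sigma> R) n (m + m') [0..<n] (UAtom (asubst \<theta> B))"
    using \<rho>_push[OF upt_inj_maps[OF \<theta>(4)] up in_m(1)] map_nth_upt_id[of "[0..<n]" m] \<theta>(4)
    by (simp add: atLeast0LessThan)
  also have "\<dots> = \<rho> (At \<Sigma> R) n m' [0..<n] (UAtom (asubst \<theta>' B))"
    using \<rho>_push[OF upt_inj_maps[OF \<theta>'(4)] q' in_m(2)] by (simp add: subst qn(1))
  finally show ?thesis .
qed

lemma fset_Abs_fset: "finite S \<Longrightarrow> fset (Abs_fset S) = S"
  by (simp add: Abs_fset_inverse)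

lemma uset_Car_iff: "finite S \<Longrightarrow> uset S \<in> Car (Pf X) \<longleftrightarrow> S \<subseteq> Car X"
  by (simp add: uset_def fset_Abs_fset)

lemma uset_Le: "finite T \<Longrightarrow> S \<subseteq> T \<Longrightarrow> T \<subseteq> Car X \<Longrightarrow> preorder_on (Car X) (Le X) \<Longrightarrow> (uset S, uset T) \<in> Le (Pf X)"
  using preorder_onD(3)[of "Car X" "Le X"] finite_subset[of S T]
  by (auto simp: uset_def fset_Abs_fset)

lemma uimage_uset: "finite S \<Longrightarrow> uimage g (uset S) = uset (g ` S)"
  by (simp add: uset_def fset_inject[symmetric] fset_Abs_fset fimage.rep_eq)

definition body_class ::
    "('f \<times> nat) set \<Rightarrow> ('p \<times> nat) set \<Rightarrow> nat \<Rightarrow> ('f, 'p) atom \<Rightarrow> ('f, 'p) clause \<Rightarrow> ('f, 'p, 'u) univ" where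
  "body_class \<Sigma> R n A c = uset ((\<lambda>B. \<rho> (At \<Sigma> R) n (n + body_bound c) [0..<n]
     (UAtom (asubst (std_matcher \<Sigma> n c A) B))) ` set (body c))"

abbreviation matching :: "('f \<times> nat) set \<Rightarrow> ('f, 'p) clause set \<Rightarrow> ('f, 'p) atom \<Rightarrow> ('f, 'p) clause set" where
  "matching \<Sigma> P A \<equiv> {c \<in> P. matchers \<Sigma> (head c) A \<noteq> {}}"

text \<open>The definition ranges over all admissible matchers, but by
  \<open>\<rho>_body_independent\<close> those of one clause give the same element. Hence the outer
  set is indexed by the matching clauses and is finite, as \<open>uset\<close> demands.\<close>

lemma program_comp_eq:
  fixes A :: "('f, 'p) atom"
  assumes P: "is_program \<Sigma> R P" and A: "A \<in> atoms_in \<Sigma> R n"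
  shows "(program_comp \<Sigma> R P n A :: ('f, 'p, 'u) univ) = uset (body_class \<Sigma> R n A ` matching \<Sigma> P A)"
proof -
  have eq: "uset {\<rho> (At \<Sigma> R) n (n + l) [0..<n] (UAtom (asubst \<theta> B)) | B. B \<in> set (body c)} = body_class \<Sigma> R n A c"
    if "c \<in> P" "\<theta> \<in> matchers \<Sigma> (head c) A" "bij_betw \<theta> (existential_vars c) (Var ` {n..<n + l})" for c \<theta> l
  proof -
    have m: "matchers \<Sigma> (head c) A \<noteq> {}" using that by blast
    have "\<rho> (At \<Sigma> R) n (n + l) [0..<n] (UAtom (asubst \<theta> B)) =
        \<rho> (At \<Sigma> R) n (n + body_bound c) [0..<n] (UAtom (asubst (std_matcher \<Sigma> n c A) B))"
      if B: "B \<in> set (body c)" for B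
    proof (rule \<rho>_body_independent[OF _ _ _ _ std_matcher_matchers[OF m] std_matcher_inj std_matcher_image _ A B])
      show "B \<in> atoms \<Sigma> R" using P \<open>c \<in> P\<close> B by (auto simp: is_program_def)
    qed (use \<open>\<theta> \<in> _\<close> \<open>bij_betw _ _ _\<close> in \<open>auto simp: bij_betw_def\<close>)
    then have "{\<rho> (At \<Sigma> R) n (n + l) [0..<n] (UAtom (asubst \<theta> B)) | B. B \<in> set (body c)} =
        (\<lambda>B. \<rho> (At \<Sigma> R) n (n + body_bound c) [0..<n] (UAtom (asubst (std_matcher \<Sigma> n c A) B))) ` set (body c)"
      by (auto simp: image_iff) metis+
    from arg_cong[OF this, of uset] show ?thesis unfolding body_class_def .
  qed
  have ex: "\<exists>\<theta> l. \<theta> \<in> matchers \<Sigma> (head c) A \<and> bij_betw \<theta> (existential_vars c) (Var ` {n..<n + l})"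
    if c: "c \<in> matching \<Sigma> P A" for c
  proof -
    let ?X = "existential_vars c" let ?l = "card (existential_vars c)"
    have "card ?X = card (Var ` {n..<n + ?l} :: 'f trm set)" by (subst card_image) (auto simp: inj_on_def)
    then obtain e where e: "bij_betw e ?X (Var ` {n..<n + ?l} :: 'f trm set)"
      using finite_same_card_bij[OF finite_existential_vars] by blast
    \<comment> \<open>The standard matcher may leave gaps among the fresh variables, whereas the
      definition wants exactly those from \<open>n\<close> to \<open>n + ?l - 1\<close>; so it is
      overridden by a bijection on the existential variables.\<close>
    define \<theta> where "\<theta> v = (if v \<in> ?X then e v else std_matcher \<Sigma> n c A v)" for v
    have m: "std_matcher \<Sigma> n c A \<in> matchers \<Sigma> (head c) A" using c by (intro std_matcher_matchers) auto
    have "\<theta> \<in> matchers \<Sigma> (head c) A"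
    proof (rule matchersI[OF m])
      show "\<theta> v = std_matcher \<Sigma> n c A v" if "v \<in> avars (head c)" for v
        using that by (simp add: \<theta>_def existential_vars_def)
      show "\<theta> v \<in> terms \<Sigma>" for v
      proof (cases "v \<in> ?X")
        case True
        then have "e v \<in> Var ` {n..<n + ?l}" using bij_betwE[OF e] by blast
        then show ?thesis using True by (auto simp: \<theta>_def intro: terms.intros)
      qed (simp add: \<theta>_def matchers_terms[OF m])
    qed
    moreover have "bij_betw \<theta> ?X (Var ` {n..<n + ?l})"
      using e by (subst bij_betw_cong[of ?X \<theta> e]) (auto simp: \<theta>_def)
    ultimately show ?thesis by blast
  qed
  have "{uset {\<rho> (At \<Sigma> R) n (n + l) [0..<n] (UAtom (asubst \<theta> B) :: ('f, 'p, 'u) univ) | B. B \<in> set (body c)} | c \<theta> l.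
        c \<in> P \<and> \<theta> \<in> matchers \<Sigma> (head c) A \<and> bij_betw \<theta> (existential_vars c) (Var ` {n..<n + l})} =
      body_class \<Sigma> R n A ` matching \<Sigma> P A" (is "?S = ?T")
  proof (intro equalityI subsetI)
    fix a assume "a \<in> ?S"
    then obtain c \<theta> l where *: "c \<in> P" "\<theta> \<in> matchers \<Sigma> (head c) A" "bij_betw \<theta> (existential_vars c) (Var ` {n..<n + l})"
      "a = uset {\<rho> (At \<Sigma> R) n (n + l) [0..<n] (UAtom (asubst \<theta> B)) | B. B \<in> set (body c)}" by blast
    then show "a \<in> ?T" using eq[OF *(1-3)] by blast
  next
    fix a assume "a \<in> ?T"
    then obtain c where c: "c \<in> matching \<Sigma> P A" "a = body_class \<Sigma> R n A c" by blast
    then obtain \<theta> l where "\<theta> \<in> matchers \<Sigma> (head c) A" "bij_betw \<theta> (existential_vars c) (Var ` {n..<n + l})"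
      using ex by blast
    then show "a \<in> ?S" using c eq[of c \<theta> l, symmetric] by blast
  qed
  then show ?thesis by (simp add: program_comp_def)
qed


section \<open>Coinductive trees\<close>

lemma std_body_atoms_in:
  assumes P: "is_program \<Sigma> R P" and A: "A \<in> atoms_in \<Sigma> R n" and c: "c \<in> matching \<Sigma> P A"
    and B: "B \<in> set (body c)"
  shows "asubst (std_matcher \<Sigma> n c A) B \<in> atoms_in \<Sigma> R (n + body_bound c)"
proof -
  have "B \<in> atoms \<Sigma> R" using P c B by (auto simp: is_program_def)
  then show ?thesis
    using c by (intro body_atoms_in[OF std_matcher_matchers A _ std_matcher_image B]) auto
qed

lemma body_class_in:
  assumes P: "is_program \<Sigma> R P" and A: "A \<in> atoms_in \<Sigma> R n" and c: "c \<in> matching \<Sigma> P A"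
  shows "body_class \<Sigma> R n A c \<in> Car (Pf (int_ob (At \<Sigma> R) n))"
  unfolding body_class_def
  by (subst uset_Car_iff) (auto intro!: \<rho>_in_int upt_inj_maps std_body_atoms_in[OF P A c])

lemma finite_matching: "is_program \<Sigma> R P \<Longrightarrow> finite (matching \<Sigma> P A)"
  by (simp add: is_program_def)

lemma program_comp_in:
  assumes P: "is_program \<Sigma> R P" and A: "A \<in> atoms_in \<Sigma> R n"
  shows "program_comp \<Sigma> R P n A \<in> Car (fob (PfPfInt_ob (At \<Sigma> R)) n)"
  unfolding program_comp_eq[OF P A] PfPfInt_Car using body_class_in[OF P A] finite_matching[OF P]
  by (subst uset_Car_iff) auto

text \<open>\<open>f\<close> extended by fresh variables carries the standard matcher at
  \<open>m\<close> to the one at \<open>n\<close>: on the variables of the head the result agrees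
  with a matcher for \<open>A'\<close>, on the other body variables \<open>Var (m + v)\<close>
  becomes \<open>Var (n + v)\<close>.\<close>

lemma body_class_subst:
  fixes c :: "('f, 'p) clause"
  assumes P: "is_program \<Sigma> R P" and A: "A \<in> atoms_in \<Sigma> R m" and c: "c \<in> matching \<Sigma> P A"
    and f: "f \<in> L \<Sigma> n m"
  defines "A' \<equiv> asubst (tuple_subst f) A"
  shows "uimage (int_map (At \<Sigma> R) n f) (body_class \<Sigma> R m A c) = (body_class \<Sigma> R n A' c :: ('f, 'p, 'u) univ)"
    "c \<in> matching \<Sigma> P A'"
proof -
  let ?b = "body_bound c"
  let ?f = "f @ map Var [n..<n + ?b]"
  let ?\<theta> = "\<lambda>v. tsubst (tuple_subst f) (std_matcher \<Sigma> m c A v)"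
  have std: "std_matcher \<Sigma> m c A \<in> matchers \<Sigma> (head c) A" using c by (intro std_matcher_matchers) auto
  have "?\<theta> \<in> matchers \<Sigma> (head c) A'"
    using std tuple_subst_terms[OF f]
    by (auto simp: matchers_def substs_def A'_def asubst_asubst[symmetric] intro: tsubst_terms)
  then show c': "c \<in> matching \<Sigma> P A'" using c by blast
  have len: "length f = m" by (rule L_length[OF f])
  have "asubst (tuple_subst ?f) (asubst (std_matcher \<Sigma> m c A) B) = asubst (std_matcher \<Sigma> n c A') B"
    if B: "B \<in> set (body c)" for B
    unfolding asubst_asubst
  proof (rule asubst_cong)
    fix v assume v: "v \<in> avars B"
    show "tsubst (tuple_subst ?f) (std_matcher \<Sigma> m c A v) = std_matcher \<Sigma> n c A' v"
    proof (cases "v \<in> avars (head c)")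
      case True
      have "tsubst (tuple_subst ?f) (std_matcher \<Sigma> m c A v) = ?\<theta> v"
        using matchers_tvars[OF std True] A len
        by (intro tsubst_cong) (force simp: tuple_subst_def atoms_in_def nth_append)
      also have "\<dots> = std_matcher \<Sigma> n c A' v"
        using c' by (intro matchers_agree[OF \<open>?\<theta> \<in> _\<close> std_matcher_matchers True]) auto
      finally show ?thesis .
    next
      case False
      then show ?thesis
        using body_bound[OF B v] len by (simp add: std_matcher_def tuple_subst_def nth_append)
    qed
  qed
  then have "int_map (At \<Sigma> R) n f (\<rho> (At \<Sigma> R) m (m + ?b) [0..<m] (UAtom (asubst (std_matcher \<Sigma> m c A) B))) =
      \<rho> (At \<Sigma> R) n (n + ?b) [0..<n] (UAtom (asubst (std_matcher \<Sigma> n c A') B) :: ('f, 'p, 'u) univ)"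
    if B: "B \<in> set (body c)" for B
    using std_body_atoms_in[OF P A c B] B by (subst int_map_\<rho>[OF is_func_At f]) simp_all
  then show "uimage (int_map (At \<Sigma> R) n f) (body_class \<Sigma> R m A c) = (body_class \<Sigma> R n A' c :: ('f, 'p, 'u) univ)"
    unfolding body_class_def by (simp add: uimage_uset image_image cong: image_cong)
qed

text \<open>The index set remains that of \<open>A\<close>. Clauses whose head matches only after
  instantiation are absent here but present in \<open>program_comp\<close> at the instance, and this
  is where strict naturality can fail.\<close>

lemma program_comp_subst:
  fixes A :: "('f, 'p) atom"
  assumes P: "is_program \<Sigma> R P" and A: "A \<in> atoms_in \<Sigma> R m" and f: "f \<in> L \<Sigma> n m"
  shows "fmap (PfPfInt_ob (At \<Sigma> R)) n f (program_comp \<Sigma> R P m A) =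
    (uset (body_class \<Sigma> R n (asubst (tuple_subst f) A) ` matching \<Sigma> P A) :: ('f, 'p, 'u) univ)"
proof -
  have "(\<lambda>c. uimage (int_map (At \<Sigma> R) n f) (body_class \<Sigma> R m A c)) ` matching \<Sigma> P A =
      (body_class \<Sigma> R n (asubst (tuple_subst f) A) :: _ \<Rightarrow> ('f, 'p, 'u) univ) ` matching \<Sigma> P A"
    by (rule image_cong[OF HOL.refl]) (rule body_class_subst(1)[OF P A _ f])
  then show ?thesis
    unfolding fmap_PfPfInt program_comp_eq[OF P A]
    using finite_matching[OF P] by (simp add: uimage_uset image_image)
qed

text \<open>An injective renaming can be undone by a substitution.\<close>

lemma matching_renaming:
  assumes A: "A \<in> atoms_in \<Sigma> R n" and i: "i \<in> inj_maps n m"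
  shows "matching \<Sigma> P (asubst (tuple_subst (J i)) A) \<subseteq> matching \<Sigma> P A"
proof
  fix c assume "c \<in> matching \<Sigma> P (asubst (tuple_subst (J i)) A)"
  then obtain \<theta> where c: "c \<in> P" and \<theta>: "\<theta> \<in> matchers \<Sigma> (head c) (asubst (tuple_subst (J i)) A)" by blast
  obtain q where q: "q \<in> inj_maps m (n + m + 0)" "map ((!) q) i = [0..<n]"
    using inj_extend[OF i upt_inj_maps[of n n]] by blast
  have len: "length i = n" "length q = m" using i q(1) by (simp_all add: inj_maps_length)
  have "asubst (tuple_subst (J q)) (asubst (tuple_subst (J i)) A) = asubst Var A"
    unfolding asubst_asubst
  proof (rule asubst_cong)
    fix v assume "v \<in> avars A"
    then have v: "v < n" using A by (auto simp: atoms_in_def)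
    then have "q ! (i ! v) = v" using arg_cong[OF q(2), of "\<lambda>l. l ! v"] len by simp
    then show "tsubst (tuple_subst (J q)) (tuple_subst (J i) v) = Var v"
      using v inj_maps_nth[OF i v] len by (simp add: tuple_subst_def)
  qed
  then have "(\<lambda>v. tsubst (tuple_subst (J q)) (\<theta> v)) \<in> matchers \<Sigma> (head c) A"
    using \<theta> tuple_subst_terms[OF J_inj_in_L[OF q(1)]]
    by (auto simp: matchers_def substs_def asubst_asubst[symmetric] intro: tsubst_terms)
  then show "c \<in> matching \<Sigma> P A" using c by blast
qed

text \<open>Instantiation preserves matching clauses and may add some; the resulting inclusion is
  the lax inequality. Along an injection none is added, by \<open>matching_renaming\<close>, and the
  inequality becomes an equality.\<close>

lemma program_coalg_hom:
  fixes R :: "('p \<times> nat) set" and P :: "('f, 'p) clause set"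
  assumes P: "is_program \<Sigma> R P"
  shows "(program_coalg \<Sigma> R P :: ('f, ('f, 'p, 'u) univ) lax)
    \<in> hom (Lax_Inj \<Sigma>) (At \<Sigma> R) (PfPfInt_ob (At \<Sigma> R))"
proof -
  let ?At = "At \<Sigma> R :: ('f, ('f, 'p, 'u) univ) func"
  let ?g = "\<lambda>n a. case a of UAtom A \<Rightarrow> program_comp \<Sigma> R P n A | _ \<Rightarrow> (a :: ('f, 'p, 'u) univ)"
  note At = is_func_At[of \<Sigma> R]
  note E = is_func_PfPfInt[OF is_func_At[of \<Sigma> R]]
  have "lax_family \<Sigma> ?At (PfPfInt_ob ?At) ?g"
  proof (rule lax_familyI)
    fix n x assume "x \<in> Car (fob ?At n)"
    then show "?g n x \<in> Car (fob (PfPfInt_ob ?At) n)"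
      by (auto elim!: At_cases simp: program_comp_in[OF P])
  next
    fix n x y assume "(x, y) \<in> Le (fob ?At n)"
    then show "(?g n x, ?g n y) \<in> Le (fob (PfPfInt_ob ?At) n)"
      by (auto elim!: At_cases simp: program_comp_in[OF P] preorder_onD(3)[OF is_funcD(1)[OF E]])
  next
    fix n m f x assume f: "f \<in> L \<Sigma> n m" and "x \<in> Car (fob ?At m)"
    then obtain A where A: "x = UAtom A" "A \<in> atoms_in \<Sigma> R m" by (elim At_cases)
    let ?A = "asubst (tuple_subst f) A"
    have A': "?A \<in> atoms_in \<Sigma> R n" by (rule asubst_atoms_in[OF f A(2)])
    have "matching \<Sigma> P A \<subseteq> matching \<Sigma> P ?A" using body_class_subst(2)[OF P A(2) _ f] by blast
    then have "(uset (body_class \<Sigma> R n ?A ` matching \<Sigma> P A), uset (body_class \<Sigma> R n ?A ` matching \<Sigma> P ?A))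
        \<in> Le (Pf (Pf (int_ob ?At n)))"
      using body_class_in[OF P A']
      by (intro uset_Le Pf_preorder int_ob_preorder[OF At] finite_imageI finite_matching[OF P] image_mono
          image_subsetI)
    then show "(fmap (PfPfInt_ob ?At) n f (?g m x), ?g n (fmap ?At n f x)) \<in> Le (fob (PfPfInt_ob ?At) n)"
      unfolding PfPfInt_Le by (simp add: A(1) program_comp_subst[OF P A(2) f] program_comp_eq[OF P A'])
  next
    fix n m i x assume i: "i \<in> inj_maps n m" and "x \<in> Car (fob ?At n)"
    then obtain A where A: "x = UAtom A" "A \<in> atoms_in \<Sigma> R n" by (elim At_cases)
    note f = J_inj_in_L[OF i, of \<Sigma>]
    let ?A = "asubst (tuple_subst (J i)) A"
    have "matching \<Sigma> P A = matching \<Sigma> P ?A"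
      using body_class_subst(2)[OF P A(2) _ f] matching_renaming[OF A(2) i, of P] by blast
    then show "fmap (PfPfInt_ob ?At) m (J i) (?g n x) = ?g m (fmap ?At m (J i) x)"
      by (simp add: A(1) program_comp_subst[OF P A(2) f] program_comp_eq[OF P asubst_atoms_in[OF f A(2)]])
  qed
  from lax_of_hom[OF At E this] show ?thesis by (simp add: program_coalg_def)
qed

lemma cmpt_program_coalg:
  "A \<in> atoms_in \<Sigma> R n \<Longrightarrow> cmpt (program_coalg \<Sigma> R P) n (UAtom A) = program_comp \<Sigma> R P n A"
  by (simp add: program_coalg_def)

section \<open>Truncations and existence of coinductive trees\<close>

lemma is_coind_treeD:
  assumes "is_coind_tree \<Sigma> R P T"
  shows "label T \<in> atoms_in \<Sigma> R (ctx T)"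
    "c \<in> matching \<Sigma> P (label T) \<Longrightarrow>
      \<exists>\<theta> m S. is_mgm \<Sigma> (head c) (label T) \<theta> \<and>
         \<theta> ` existential_vars c \<subseteq> Var ` {ctx T..} \<and> ctx T \<le> m \<and>
         asubst \<theta> ` set (body c) \<subseteq> atoms_in \<Sigma> R m \<and> ors T c = Some S \<and>
         bij_betw label (fset S) (asubst \<theta> ` set (body c)) \<and>
         (\<forall>T\<in>fset S. ctx T = m \<and> is_coind_tree \<Sigma> R P T)"
    "c \<notin> matching \<Sigma> P (label T) \<Longrightarrow> ors T c = None"
  using assms by (cases; auto)+

text \<open>Induction on the depth, for all trees at once. Whichever most general matcher the tree
  uses at a clause, its body atoms give the same elements of the colimit as those of the standard
  matcher, and the bijection by labels pairs the children with these atoms.\<close>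

lemma approx_program_truncation:
  fixes R :: "('p \<times> nat) set" and P :: "('f, 'p) clause set"
  assumes P: "is_program \<Sigma> R P"
    and "is_coind_tree \<Sigma> R P T"
  shows "cmpt (approx \<Sigma> (program_coalg \<Sigma> R P) (Ide (Lax_Inj \<Sigma>) (At \<Sigma> R)) i) (ctx T)
      (UAtom (label T) :: ('f, 'p, 'u) univ) = truncation \<Sigma> R i T"
  using assms(2)
proof (induction i arbitrary: T)
  case 0
  then show ?case using is_coind_treeD(1)[OF 0] by (simp add: cmpt_Ide)
next
  case (Suc i)
  let ?At = "At \<Sigma> R :: ('f, ('f, 'p, 'u) univ) func"
  define n where "n = ctx T"
  define A where "A = label T"
  let ?\<alpha> = "approx \<Sigma> (program_coalg \<Sigma> R P) (Ide (Lax_Inj \<Sigma>) ?At) i"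
  note p = program_coalg_hom[OF P, where ?'u = 'u] and I = Ide_hom[OF is_func_At[of \<Sigma> R, where ?'c = 'u]]
  note \<alpha> = approx_hom[OF p I, of i]
  have A: "A \<in> atoms_in \<Sigma> R n" using is_coind_treeD(1)[OF Suc.prems] by (simp add: n_def A_def)
  then have x: "UAtom A \<in> Car (fob ?At n)" by simp
  have pin: "program_comp \<Sigma> R P n A \<in> Car (fob (PfPfInt_ob ?At) n)" by (rule program_comp_in[OF P A])
  let ?t = "\<lambda>S. uset {\<rho> (stage ?At i) n (ctx T') [0..<n] (truncation \<Sigma> R i T') | T'. T' \<in> fset S}"
  have child: "\<exists>S. ors T c = Some S \<and> uimage (int_comp ?\<alpha> n) (body_class \<Sigma> R n A c) = ?t S"
    if c: "c \<in> matching \<Sigma> P A" for c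
  proof -
    have "c \<in> matching \<Sigma> P (label T)" using c by (simp only: A_def)
    from is_coind_treeD(2)[OF Suc.prems this, folded n_def A_def]
    obtain \<theta> m S where \<theta>: "is_mgm \<Sigma> (head c) A \<theta>" "\<theta> ` existential_vars c \<subseteq> Var ` {n..}" "n \<le> m"
         "asubst \<theta> ` set (body c) \<subseteq> atoms_in \<Sigma> R m" "ors T c = Some S"
         "bij_betw label (fset S) (asubst \<theta> ` set (body c))"
         "\<And>T. T \<in> fset S \<Longrightarrow> ctx T = m \<and> is_coind_tree \<Sigma> R P T"
      by (elim exE conjE) (rule that, (assumption | erule (1) bspec)+)
    have \<theta>m: "\<theta> \<in> matchers \<Sigma> (head c) A" using \<theta>(1) by (simp add: is_mgm_def)
    \<comment> \<open>A tree bounds the images of the existential variables only from below. The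
      upper bound holds because each of these variables occurs in some body atom, whose instance
      lies in the context \<open>m\<close>.\<close>
    have ex: "\<theta> ` existential_vars c \<subseteq> Var ` {n..<m}"
    proof
      fix t assume "t \<in> \<theta> ` existential_vars c"
      then obtain v where v: "t = \<theta> v" "v \<in> existential_vars c" by blast
      then obtain u where u: "\<theta> v = Var u" "n \<le> u" using \<theta>(2) by auto
      obtain B where B: "B \<in> set (body c)" "v \<in> avars B" using v(2) by (auto simp: existential_vars_def)
      have "avars (asubst \<theta> B) \<subseteq> {..<m}" using B(1) \<theta>(4) by (auto simp: atoms_in_def)
      moreover have "u \<in> avars (asubst \<theta> B)" using B(2) u(1) by (auto simp: avars_asubst intro!: bexI[of _ v])
      ultimately have "u < m" by blast
      then show "t \<in> Var ` {n..<m}" using v(1) u by auto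
    qed
    have std: "std_matcher \<Sigma> n c A \<in> matchers \<Sigma> (head c) A" using c by (intro std_matcher_matchers) auto
    have up: "[0..<n] \<in> inj_maps n m" by (rule upt_inj_maps[OF \<theta>(3)])
    have B: "int_comp ?\<alpha> n (\<rho> ?At n (n + body_bound c) [0..<n] (UAtom (asubst (std_matcher \<Sigma> n c A) B))) =
        \<rho> (stage ?At i) n m [0..<n] (cmpt ?\<alpha> m (UAtom (asubst \<theta> B)))" if B: "B \<in> set (body c)" for B
    proof -
      have "B \<in> atoms \<Sigma> R" using P c B by (auto simp: is_program_def)
      then have "\<rho> ?At n (n + body_bound c) [0..<n] (UAtom (asubst (std_matcher \<Sigma> n c A) B)) =
          \<rho> ?At n m [0..<n] (UAtom (asubst \<theta> B))"
        by (intro \<rho>_body_independent[OF std std_matcher_inj std_matcher_image _ \<theta>m is_mgm_inj[OF \<theta>(1)] ex \<theta>(3) A B]) simp_all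
      then show ?thesis using \<theta>(4) B by (simp add: int_comp_\<rho>_lax[OF \<alpha> up] image_subset_iff)
    qed
    have "uimage (int_comp ?\<alpha> n) (body_class \<Sigma> R n A c) =
        uset ((\<lambda>B. \<rho> (stage ?At i) n m [0..<n] (cmpt ?\<alpha> m (UAtom B))) ` (asubst \<theta> ` set (body c)))"
      unfolding body_class_def using B by (simp add: uimage_uset image_image cong: image_cong)
    \<comment> \<open>From here on the body atoms are indexed by the child trees, so that the
      induction hypothesis applies to each of them.\<close>
    also have "asubst \<theta> ` set (body c) = label ` fset S" using \<theta>(6) by (simp add: bij_betw_def)
    also have "(\<lambda>B. \<rho> (stage ?At i) n m [0..<n] (cmpt ?\<alpha> m (UAtom B))) ` label ` fset S =
        (\<lambda>T'. \<rho> (stage ?At i) n (ctx T') [0..<n] (truncation \<Sigma> R i T')) ` fset S"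
      unfolding image_image
    proof (rule image_cong)
      fix T' assume "T' \<in> fset S"
      from \<theta>(7)[OF this] show "\<rho> (stage ?At i) n m [0..<n] (cmpt ?\<alpha> m (UAtom (label T'))) =
          \<rho> (stage ?At i) n (ctx T') [0..<n] (truncation \<Sigma> R i T')"
        using Suc.IH[of T'] by auto
    qed simp
    finally show ?thesis using \<theta>(5) by (auto simp: Setcompr_eq_image)
  qed
  have "uimage (uimage (int_comp ?\<alpha> n)) (program_comp \<Sigma> R P n A) =
      uset ((\<lambda>c. uimage (int_comp ?\<alpha> n) (body_class \<Sigma> R n A c)) ` matching \<Sigma> P A)"
    unfolding program_comp_eq[OF P A] using finite_matching[OF P] by (simp add: uimage_uset image_image)
  also have "(\<lambda>c. uimage (int_comp ?\<alpha> n) (body_class \<Sigma> R n A c)) ` matching \<Sigma> P A =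
      {?t S | c S. ors T c = Some S}"
  proof (intro equalityI subsetI)
    fix a assume "a \<in> (\<lambda>c. uimage (int_comp ?\<alpha> n) (body_class \<Sigma> R n A c)) ` matching \<Sigma> P A"
    then show "a \<in> {?t S | c S. ors T c = Some S}" using child by blast
  next
    fix a assume "a \<in> {?t S | c S. ors T c = Some S}"
    then obtain c S where cS: "a = ?t S" "ors T c = Some S" by blast
    then have c: "c \<in> matching \<Sigma> P A"
      using is_coind_treeD(3)[OF Suc.prems, of c] unfolding A_def by fastforce
    then show "a \<in> (\<lambda>c. uimage (int_comp ?\<alpha> n) (body_class \<Sigma> R n A c)) ` matching \<Sigma> P A"
      using child[OF c] cS by (auto intro!: image_eqI[of _ _ c])
  qed
  finally have "uimage (uimage (int_comp ?\<alpha> n)) (program_comp \<Sigma> R P n A) = uset {?t S | c S. ors T c = Some S}" .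
  then show ?case
    unfolding n_def[symmetric] A_def[symmetric] approx.simps cmpt_pairing[OF I x] cmpt_Cmp[OF p x]
      cmpt_program_coalg[OF A] cmpt_Fa[OF \<alpha> pin] cmpt_Ide[OF x]
    by (simp add: n_def A_def)
qed

text \<open>A canonical tree, with standard matchers throughout, showing that the description of
  coinductive trees can be satisfied. The corecursive call sits below the mappings of functions,
  options and finite sets, a shape that nested corecursion accepts.\<close>

primcorec coind_tree ::
    "('f \<times> nat) set \<Rightarrow> ('f, 'p) clause set \<Rightarrow> nat \<times> ('f, 'p) atom \<Rightarrow> ('f, 'p) tree" where
  "ctx (coind_tree \<Sigma> P x) = fst x"
| "label (coind_tree \<Sigma> P x) = snd x"
| "ors (coind_tree \<Sigma> P x) = map_option (fimage (coind_tree \<Sigma> P)) \<circ> (\<lambda>c.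
     if c \<in> matching \<Sigma> P (snd x)
     then Some (Abs_fset ((\<lambda>B. (fst x + body_bound c, asubst (std_matcher \<Sigma> (fst x) c (snd x)) B)) ` set (body c)))
     else None)"

lemma is_coind_tree_coind_tree:
  assumes P: "is_program \<Sigma> R P" and "A \<in> atoms_in \<Sigma> R n"
  shows "is_coind_tree \<Sigma> R P (coind_tree \<Sigma> P (n, A))"
proof (rule is_coind_tree.coinduct[where X = "\<lambda>T. \<exists>n A. A \<in> atoms_in \<Sigma> R n \<and> T = coind_tree \<Sigma> P (n, A)"])
  show "\<exists>n' A'. A' \<in> atoms_in \<Sigma> R n' \<and> coind_tree \<Sigma> P (n, A) = coind_tree \<Sigma> P (n', A')"
    using assms(2) by blast
next
  fix T assume "\<exists>n A. A \<in> atoms_in \<Sigma> R n \<and> T = coind_tree \<Sigma> P (n, A)"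
  then obtain n A where A: "A \<in> atoms_in \<Sigma> R n" and T: "T = coind_tree \<Sigma> P (n, A)" by blast
  let ?X = "\<lambda>T. \<exists>n A. A \<in> atoms_in \<Sigma> R n \<and> T = coind_tree \<Sigma> P (n, A)"
  have 1: "\<exists>\<theta> m S. is_mgm \<Sigma> (head c) A \<theta> \<and> \<theta> ` existential_vars c \<subseteq> Var ` {n..} \<and> n \<le> m \<and>
         asubst \<theta> ` set (body c) \<subseteq> atoms_in \<Sigma> R m \<and> ors T c = Some S \<and>
         bij_betw label (fset S) (asubst \<theta> ` set (body c)) \<and>
         (\<forall>T\<in>fset S. ctx T = m \<and> (?X T \<or> is_coind_tree \<Sigma> R P T))"
    if c: "c \<in> P \<and> matchers \<Sigma> (head c) A \<noteq> {}" for c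
  proof -
    let ?\<theta> = "std_matcher \<Sigma> n c A" and ?m = "n + body_bound c"
    let ?S = "coind_tree \<Sigma> P |`| Abs_fset ((\<lambda>B. (?m, asubst ?\<theta> B)) ` set (body c))"
    have S: "fset ?S = (\<lambda>B. coind_tree \<Sigma> P (?m, B)) ` asubst ?\<theta> ` set (body c)"
      by (simp add: fimage.rep_eq fset_Abs_fset image_image)
    have body: "asubst ?\<theta> ` set (body c) \<subseteq> atoms_in \<Sigma> R ?m"
      using std_body_atoms_in[OF P A, of c] c by auto
    have "is_mgm \<Sigma> (head c) A ?\<theta>" using c A by (intro std_matcher_mgm) (auto simp: atoms_in_def)
    moreover have "?\<theta> ` existential_vars c \<subseteq> Var ` {n..}" using std_matcher_image[of \<Sigma> n c A] by fastforce
    moreover have "ors T c = Some ?S" using c by (simp add: T)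
    \<comment> \<open>In the fixed context \<open>?m\<close> a child is built from its atom alone,
      and \<open>label\<close> returns that atom.\<close>
    moreover have "bij_betw label (fset ?S) (asubst ?\<theta> ` set (body c))"
      unfolding S by (rule bij_betwI[where g = "\<lambda>B. coind_tree \<Sigma> P (?m, B)"]) auto
    moreover have "\<forall>T\<in>fset ?S. ctx T = ?m \<and> (?X T \<or> is_coind_tree \<Sigma> R P T)"
      unfolding S using body by auto
    ultimately show ?thesis using body by (intro exI[of _ ?\<theta>] exI[of _ ?m] exI[of _ ?S]) simp
  qed
  have 2: "ors T c = None" if "\<not> (c \<in> P \<and> matchers \<Sigma> (head c) A \<noteq> {})" for c
    using that by (simp add: T)
  have "T = AndNode n A (ors T)" by (simp add: T tree.expand)
  then show "\<exists>A n ks. T = AndNode n A ks \<and> A \<in> atoms_in \<Sigma> R n \<and>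
      (\<forall>c. c \<in> P \<and> matchers \<Sigma> (head c) A \<noteq> {} \<longrightarrow>
        (\<exists>\<theta> m S. is_mgm \<Sigma> (head c) A \<theta> \<and> \<theta> ` existential_vars c \<subseteq> Var ` {n..} \<and> n \<le> m \<and>
           asubst \<theta> ` set (body c) \<subseteq> atoms_in \<Sigma> R m \<and> ks c = Some S \<and>
           bij_betw label (fset S) (asubst \<theta> ` set (body c)) \<and>
           (\<forall>T\<in>fset S. ctx T = m \<and> (?X T \<or> is_coind_tree \<Sigma> R P T)))) \<and>
      (\<forall>c. \<not> (c \<in> P \<and> matchers \<Sigma> (head c) A \<noteq> {}) \<longrightarrow> ks c = None)"
    using A 1 2 by (intro exI[of _ A] exI[of _ n] exI[of _ "ors T"]) (intro conjI allI impI; assumption)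
qed

text \<open>A cofree comonad is determined only up to isomorphism, so the claim is made for each of
  them. Injectivity of the cones makes \<open>represents\<close> a genuine identification with a
  tree, and the existence of a tree keeps the claim about all trees from being vacuous.\<close>

theorem theorem23:
  fixes \<Sigma> :: "('f \<times> nat) set"
  shows "let C = (Lax_Inj \<Sigma> :: (('f, ('f, 'p, 'u) univ) func, ('f, ('f, 'p, 'u) univ) lax) category) in
    is_category C \<and> is_endofunctor C PfPfInt \<and>
    (\<exists>D \<kappa>. is_cofree_comonad C PfPfInt D \<kappa>) \<and>
    (\<forall>(R :: ('p \<times> nat) set) P. is_program \<Sigma> R P \<longrightarrow>
       At \<Sigma> R \<in> Ob C \<and>
       program_coalg \<Sigma> R P \<in> hom C (At \<Sigma> R) (Fo PfPfInt (At \<Sigma> R)) \<and>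
       (\<forall>D \<kappa>. is_cofree_comonad C PfPfInt D \<kappa> \<longrightarrow>
          (\<forall>n. inj_on (\<lambda>a i. cmpt (cone \<Sigma> D \<kappa> (At \<Sigma> R) i) n a) (Car (fob (Fo D (At \<Sigma> R)) n))) \<and>
          (\<forall>n. \<forall>A\<in>atoms_in \<Sigma> R n.
             (\<exists>T. is_coind_tree \<Sigma> R P T \<and> ctx T = n \<and> label T = A) \<and>
             (\<forall>T. is_coind_tree \<Sigma> R P T \<and> ctx T = n \<and> label T = A \<longrightarrow>
                represents \<Sigma> R D \<kappa> n
                  (cmpt (corresponding_coalg C D \<kappa> (At \<Sigma> R) (program_coalg \<Sigma> R P)) n (UAtom A)) T))))"
  unfolding Let_def
proof (intro conjI allI impI ballI)
  let ?C = "Lax_Inj \<Sigma> :: (('f, ('f, 'p, 'u) univ) func, ('f, ('f, 'p, 'u) univ) lax) category"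
  show "is_category ?C" by (rule is_category_Lax_Inj)
  show "is_endofunctor ?C PfPfInt" by (rule is_endofunctor_PfPfInt)
  show "\<exists>D \<kappa>. is_cofree_comonad ?C PfPfInt D \<kappa>"
    using cofree_coalgebras.is_cofree_comonad_D[OF cofree_coalgebras_Lax_Inj] by blast
  fix R :: "('p \<times> nat) set" and P
  assume P: "is_program \<Sigma> R P"
  let ?At = "At \<Sigma> R :: ('f, ('f, 'p, 'u) univ) func"
  show "?At \<in> Ob ?C" using is_func_At by simp
  note p = program_coalg_hom[OF P, where ?'u = 'u]
  show "program_coalg \<Sigma> R P \<in> hom ?C ?At (Fo PfPfInt ?At)" using p by simp
  fix D \<kappa> assume D: "is_cofree_comonad ?C PfPfInt D \<kappa>"
  show "inj_on (\<lambda>a i. cmpt (cone \<Sigma> D \<kappa> ?At i) n a) (Car (fob (Fo D ?At) n))" for n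
    by (rule inj_on_cone[OF D is_func_At])
  fix n A assume A: "A \<in> atoms_in \<Sigma> R n"
  show "\<exists>T. is_coind_tree \<Sigma> R P T \<and> ctx T = n \<and> label T = A"
    using is_coind_tree_coind_tree[OF P A] by (intro exI[of _ "coind_tree \<Sigma> P (n, A)"]) simp
  fix T assume T: "is_coind_tree \<Sigma> R P T \<and> ctx T = n \<and> label T = A"
  let ?a = "corresponding_coalg ?C D \<kappa> ?At (program_coalg \<Sigma> R P)"
  note a = cone_corresponding_coalg[OF D p]
  have x: "UAtom A \<in> Car (fob ?At n)" using A by simp
  have "cmpt (cone \<Sigma> D \<kappa> ?At i) n (cmpt ?a n (UAtom A)) = truncation \<Sigma> R i T" for i
    using approx_program_truncation[OF P, of T i, where ?'u = 'u] T
    unfolding cmpt_Cmp[OF a(1) x, symmetric] a(2) by simp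
  then show "represents \<Sigma> R D \<kappa> n (cmpt ?a n (UAtom A)) T"
    using T lax_familyD(2)[OF hom_LaxD(5)[OF a(1)] x] by (simp add: represents_def)
qed

end
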